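(* Let $n\ge2$ and let $a=(a_1,\dots,a_n)$ with $a_j>1$ for every $j$. Let $1\le q\le\infty$ and $s\in\mathbb{R}$. Then there is a constant $C$ such that $$\|M^{**}f\|_{L^q(\mathbb{R}^n)}\le C\,\|f\|_{\dot H_s}\qquad\text{for all } f\in\mathcal{S}(\mathbb{R}^n)$$ if and only if $4\le q<\infty$ and $s=n\left(\frac12-\frac1q\right)$.
   Context: $\mathcal{S}(\mathbb{R}^n)$ is the Schwartz class and $\widehat f(\xi)=\int_{\mathbb{R}^n}e^{-ix\cdot\xi}f(x)\,dx$. For $f\in\mathcal{S}(\mathbb{R}^n)$ and $t=(t_1,\dots,t_n)\in\mathbb{R}^n$, $$S_tf(x)=\int_{\mathbb{R}^n}e^{ix\cdot\xi}e^{i(t_1|\xi_1|^{a_1}+t_2|\xi_2|^{a_2}+\dots+t_n|\xi_n|^{a_n})}\widehat f(\xi)\,d\xi,\qquad x\in\mathbb{R}^n,$$ and $M^{**}f(x)=\sup_{t_1,\dots,t_n\in\mathbb{R}}|S_tf(x)|$. The homogeneous Sobolev norm is $\|f\|_{\dot H_s}=\left(\int_{\mathbb{R}^n}|\xi|^{2s}|\widehat f(\xi)|^2\,d\xi\right)^{1/2}$ (possibly $+\infty$, in which case the inequality is trivially true for that $f$). *)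

theory Defs
  imports "HOL-Analysis.Analysis" "HOL-Probability.Essential_Supremum"
begin

fun iter_partial :: "'n::finite list \<Rightarrow> (real^'n \<Rightarrow> complex) \<Rightarrow> real^'n \<Rightarrow> complex" where
  "iter_partial [] f = f"
| "iter_partial (j # js) f =
     (\<lambda>x. frechet_derivative (iter_partial js f) (at x) (axis j 1))"

text \<open>
  Differentiability of every iterated partial derivative is equivalent to smoothness; the lists
  of indices run over all orders of differentiation, so they cover all multi-indices. The
  multi-index monomials are \<open>\<Prod>j\<in>UNIV. (x $ j) ^ \<alpha> j\<close>.
\<close>

definition schwartz :: "(real^'n::finite \<Rightarrow> complex) set" where
  "schwartz = {f. \<forall>js. iter_partial js f differentiable_on UNIV \<and>
     (\<forall>\<alpha> :: 'n \<Rightarrow> nat.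
        bounded (range (\<lambda>x. of_real (\<Prod>j\<in>UNIV. (x $ j) ^ \<alpha> j) * iter_partial js f x)))}"

definition fourier :: "(real^'n::finite \<Rightarrow> complex) \<Rightarrow> real^'n \<Rightarrow> complex" where
  "fourier f \<xi> = (LINT x|lborel. exp (- \<i> * of_real (x \<bullet> \<xi>)) * f x)"

definition S_op ::
  "real^'n::finite \<Rightarrow> real^'n \<Rightarrow> (real^'n \<Rightarrow> complex) \<Rightarrow> real^'n \<Rightarrow> complex" where
  "S_op a t f x = (LINT \<xi>|lborel. exp (\<i> * of_real (x \<bullet> \<xi>)) *
     exp (\<i> * of_real (\<Sum>j\<in>UNIV. t $ j * \<bar>\<xi> $ j\<bar> powr (a $ j))) * fourier f \<xi>)"

definition maximal :: "real^'n::finite \<Rightarrow> (real^'n \<Rightarrow> complex) \<Rightarrow> real^'n \<Rightarrow> ennreal" where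
  "maximal a f x = (SUP t. ennreal (norm (S_op a t f x)))"

text \<open>Powers with exponent \<open>p > 0\<close>.\<close>

definition ennpowr :: "ennreal \<Rightarrow> real \<Rightarrow> ennreal" where
  "ennpowr x p = (if x = \<infinity> then \<infinity> else ennreal (enn2real x powr p))"

definition Lq_norm :: "ennreal \<Rightarrow> (real^'n::finite \<Rightarrow> ennreal) \<Rightarrow> ennreal" where
  "Lq_norm q g = (if q = \<infinity> then esssup lborel g
     else ennpowr (\<integral>\<^sup>+x. ennpowr (g x) (enn2real q) \<partial>lborel) (1 / enn2real q))"

text \<open>
  The weight \<open>norm \<xi> powr (2 * s)\<close> is \<open>0\<close> at the origin for every \<open>s\<close>; the origin is a null set.
\<close>

definition sobolev_norm :: "real \<Rightarrow> (real^'n::finite \<Rightarrow> complex) \<Rightarrow> ennreal" where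
  "sobolev_norm s f =
     ennpowr (\<integral>\<^sup>+\<xi>. ennreal (norm \<xi> powr (2 * s) * (norm (fourier f \<xi>))\<^sup>2) \<partial>lborel) (1 / 2)"

end

theory Submission
  imports Defs "HOL-Probability.Probability"
begin

text \<open>
  Necessity. Take Fourier transforms of width \<open>\<lambda>\<close> centred at \<open>\<lambda> L (1, \<dots>, 1)\<close>. Choosing \<open>t\<^sub>j\<close> so that the
  phase is stationary at the centre keeps the maximal function large on a cube of side \<open>L / \<lambda>\<close>, while
  the Sobolev norm grows like \<open>L\<^sup>s\<close>. Letting \<open>\<lambda>\<close> tend to \<open>0\<close> and \<open>\<infinity>\<close> gives \<open>s = n (1/2 - 1/q)\<close>, and letting
  \<open>L\<close> tend to \<open>\<infinity>\<close> gives \<open>n / q \<le> s\<close>, that is \<open>4 \<le> q\<close>. The case \<open>q = \<infinity>\<close> fails by the usual logarithmic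
  divergence in the critical Sobolev embedding.

  Sufficiency. Replace the supremum by a measurable choice \<open>t(x)\<close> and dualize. Since
  \<open>\<Prod>\<^sub>j \<bar>\<xi>\<^sub>j\<bar> \<le> \<bar>\<xi>\<bar>\<^sup>n\<close>, the \<open>T T\<^sup>*\<close> method leads to a kernel that is a product of one-dimensional oscillatory
  integrals with weight \<open>\<bar>r\<bar> powr (2/q - 1)\<close>. By van der Corput they are \<open>O(\<bar>x\<^sub>j - y\<^sub>j\<bar> powr (- 2/q))\<close> uniformly in
  \<open>t\<close>, exactly because \<open>1/2 \<le> 1 - 2/q < 1\<close>, and the Hardy-Littlewood-Sobolev inequality, applied
  in one variable at a time, concludes.
\<close>

subsection \<open>Lebesgue measure on real vectors\<close>

text \<open>Two computations explain the answer. A packet of unit width at frequency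
  \<open>L\<close> with the stationary choice of \<open>t\<close> has a phase error of second order,
  a constant times \<open>\<bar>x\<bar> / L\<close>; the powers \<open>L powr a\<close> cancel, so
  the condition does not see \<open>a\<close> and the cube has side proportional to
  \<open>L\<close>. Conversely put \<open>\<alpha> = 1 - 2 / q\<close>, so that
  \<open>2 * s = n * \<alpha>\<close>. A stationary point at \<open>p\<close> has a window of width
  about \<open>sqrt p\<close> and amplitude about \<open>p powr (- \<alpha>)\<close>. Its
  contribution \<open>p powr (1 / 2 - \<alpha>)\<close> stays bounded as \<open>p\<close> grows
  exactly when \<open>1 / 2 \<le> \<alpha>\<close>, that is \<open>4 \<le> q\<close>.

  Necessity must treat every real \<open>s\<close>, including those for which a Gaussian has
  infinite norm and the inequality says nothing; the test functions are therefore modified near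
  frequency zero. Sufficiency works with absolutely convergent integrals only: frequencies are cut
  to a cube and positions to a ball, all bounds are uniform in both cutoffs, and monotone
  convergence removes them.\<close>

lemma measurable_vec_lambda_PiM [measurable]:
  "(\<lambda>f. \<chi> i. f i) \<in> (\<Pi>\<^sub>M i\<in>(UNIV::'n::finite set). (lborel::real measure)) \<rightarrow>\<^sub>M (borel :: (real^'n) measure)"
  by (rule borel_measurable_euclidean_space[THEN iffD2])
     (auto simp: Basis_vec_def inner_axis intro!: measurable_component_singleton)

text \<open>Both measures give a box the product of its side lengths, and this determines Lebesgue
  measure. Integrals over vectors thus become iterated integrals over coordinates, the form needed
  for product integrands.\<close>

lemma lborel_vec:
  "(lborel :: (real^'n::finite) measure) =
     distr (\<Pi>\<^sub>M i\<in>UNIV. lborel) borel (\<lambda>f. \<chi> i. f i)"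
proof (rule lborel_eqI)
  interpret finite_product_sigma_finite "\<lambda>_::'n. lborel :: real measure" UNIV
    by standard auto
  fix l u :: "real^'n" assume le: "\<And>b. b \<in> Basis \<Longrightarrow> l \<bullet> b \<le> u \<bullet> b"
  have le': "l $ i \<le> u $ i" for i
    using le[of "axis i 1"] by (auto simp: Basis_vec_def inner_axis)
  have eq: "(\<lambda>f. \<chi> i. f i) -` box l u \<inter> space (\<Pi>\<^sub>M i\<in>(UNIV::'n set). (lborel::real measure)) =
     (\<Pi>\<^sub>E i\<in>UNIV. {l $ i <..< u $ i})"
    by (auto simp: mem_box_cart space_PiM PiE_def extensional_def Pi_def)
  have "emeasure (distr (\<Pi>\<^sub>M i\<in>UNIV. lborel) borel (\<lambda>f. \<chi> i. f i)) (box l u) =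
     (\<Prod>i\<in>UNIV. emeasure lborel {l $ i <..< u $ i})"
    by (subst emeasure_distr) (auto simp: eq measure_times)
  also have "\<dots> = ennreal (\<Prod>i\<in>UNIV. u $ i - l $ i)"
    using le' by (simp add: prod_ennreal)
  also have "(\<Prod>i\<in>UNIV. u $ i - l $ i) = (\<Prod>b\<in>Basis. (u - l) \<bullet> b)"
    by (simp add: Basis_vec_def prod.UNION_disjoint axis_eq_axis inner_axis)
  finally show "emeasure (distr (\<Pi>\<^sub>M i\<in>UNIV. lborel) borel (\<lambda>f. \<chi> i. f i)) (box l u) =
     ennreal (\<Prod>b\<in>Basis. (u - l) \<bullet> b)" .
qed simp

lemma measurable_vec_nth [measurable (raw)]:
  fixes f :: "'a \<Rightarrow> real^'n::finite"
  assumes "f \<in> borel_measurable M"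
  shows "(\<lambda>x. f x $ i) \<in> borel_measurable M"
proof -
  have "(\<lambda>x::real^'n. x $ i) \<in> borel_measurable borel"
    by (intro borel_measurable_continuous_onI continuous_intros)
  with assms show ?thesis by (rule measurable_compose)
qed

lemma
  fixes f :: "'n::finite \<Rightarrow> real \<Rightarrow> 'b::{real_normed_field,banach,second_countable_topology}"
  assumes f: "\<And>i. integrable lborel (f i)"
  shows integrable_prod_vec: "integrable lborel (\<lambda>x::real^'n. \<Prod>i\<in>UNIV. f i (x $ i))" (is ?A)
    and integral_prod_vec:
      "(LINT x::(real^'n)|lborel. (\<Prod>i\<in>UNIV. f i (x $ i))) = (\<Prod>i\<in>UNIV. (LINT r|lborel. f i r))" (is ?B)
proof -
  interpret product_sigma_finite "\<lambda>_::'n. lborel :: real measure"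
    by standard
  have [measurable]: "f i \<in> borel_measurable borel" for i
    using borel_measurable_integrable[OF f] by simp
  show ?A
    by (subst lborel_vec, subst integrable_distr_eq)
       (auto intro!: product_integrable_prod f)
  show ?B
    by (subst lborel_vec, subst integral_distr)
       (auto intro!: product_integral_prod f)
qed

lemma nn_integral_vec:
  assumes [measurable]: "f \<in> borel_measurable (borel :: (real^'n::finite) measure)"
  shows "(\<integral>\<^sup>+x. f x \<partial>lborel) = (\<integral>\<^sup>+x. f (\<chi> i. x i) \<partial>(\<Pi>\<^sub>M i\<in>UNIV. lborel))"
  by (subst lborel_vec, subst nn_integral_distr) auto

lemma nn_integral_affine:
  fixes t :: "'a::euclidean_space"
  assumes [measurable]: "f \<in> borel_measurable borel" and c: "c \<noteq> 0"
  shows "(\<integral>\<^sup>+x. f x \<partial>lborel) = ennreal (\<bar>c\<bar> ^ DIM('a)) * (\<integral>\<^sup>+x. f (t + c *\<^sub>R x) \<partial>lborel)"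
  by (subst lborel_affine[OF c, of t])
     (simp add: nn_integral_density nn_integral_distr nn_integral_cmult ennreal_power)

lemma integrable_affine:
  fixes f :: "'a::euclidean_space \<Rightarrow> 'b :: {banach, second_countable_topology}"
  assumes f: "integrable lborel f"
  shows "c \<noteq> 0 \<Longrightarrow> integrable lborel (\<lambda>x. f (t + c *\<^sub>R x))"
  using f f[THEN borel_measurable_integrable] unfolding integrable_iff_bounded
  by (subst (asm) nn_integral_affine[where c=c and t=t]) (auto simp: ennreal_mult_less_top)

lemma integral_affine:
  fixes f :: "'a::euclidean_space \<Rightarrow> 'b :: {banach, second_countable_topology}"
  assumes c: "c \<noteq> 0" and f: "integrable lborel f"
  shows "(LINT x|lborel. f x) = (\<bar>c\<bar> ^ DIM('a)) *\<^sub>R (LINT x|lborel. f (t + c *\<^sub>R x))"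
proof -
  have [measurable]: "f \<in> borel_measurable borel"
    using f borel_measurable_integrable by auto
  have "(LINT x|lborel. f x) = (LINT x|density (distr lborel borel (\<lambda>x. t + c *\<^sub>R x)) (\<lambda>_. ennreal (\<bar>c\<bar> ^ DIM('a))). f x)"
    using lborel_affine[OF c, of t] by (simp add: ennreal_power)
  also have "\<dots> = (\<bar>c\<bar> ^ DIM('a)) *\<^sub>R (LINT x|lborel. f (t + c *\<^sub>R x))"
    by (simp add: integral_density integral_distr)
  finally show ?thesis .
qed

text \<open>A product weight such as \<open>cube_weight\<close> vanishes on the coordinate
  hyperplanes because \<open>0 powr _ = 0\<close>, although it stands for a singularity there. Lower
  bounds for it hold off this null set.\<close>

lemma AE_vec_nth_nonzero: "AE x in lborel. (x::real^'n::finite) $ j \<noteq> 0"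
proof -
  have "negligible {x::real^'n. axis j 1 \<bullet> x = 0}"
    by (rule negligible_hyperplane) (auto simp: axis_eq_0_iff)
  then have "{x::real^'n. x $ j = 0} \<in> null_sets lebesgue"
    by (simp add: negligible_iff_null_sets inner_commute[of "axis _ _"] inner_axis)
  then have "AE x in lebesgue. (x::real^'n) $ j \<noteq> 0"
    using AE_not_in by fastforce
  then show ?thesis
    by (simp add: AE_completion_iff)
qed

subsection \<open>Schwartz functions from Gaussians\<close>

text \<open>The coefficient \<open>z\<close> is complex so that one family is stable under all
  operations used: its imaginary part is a modulation, and a translation by \<open>b\<close> turns
  \<open>z\<close> into \<open>z - c * b\<close> up to a constant factor.\<close>

definition gaussian :: "real \<Rightarrow> complex^'n::finite \<Rightarrow> real^'n \<Rightarrow> complex" where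
  "gaussian c z x = exp (\<Sum>j\<in>UNIV. z $ j * of_real (x $ j) - of_real (c / 2 * (x $ j)\<^sup>2))"

text \<open>The span of the functions \<open>P * gaussian c z\<close> with \<open>P\<close> a polynomial is closed under partial
  derivatives, so decay of its members makes all of them Schwartz.\<close>

inductive_set gauss_poly :: "(real^'n::finite \<Rightarrow> complex) set" where
  gaussian: "0 < c \<Longrightarrow> gaussian c z \<in> gauss_poly"
| coord: "f \<in> gauss_poly \<Longrightarrow> (\<lambda>x. of_real (x $ j) * f x) \<in> gauss_poly"
| scale: "f \<in> gauss_poly \<Longrightarrow> (\<lambda>x. k * f x) \<in> gauss_poly"
| add: "f \<in> gauss_poly \<Longrightarrow> g \<in> gauss_poly \<Longrightarrow> (\<lambda>x. f x + g x) \<in> gauss_poly"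

lemma norm_vec_power2: "(norm (x::real^'n::finite))\<^sup>2 = (\<Sum>j\<in>UNIV. (x $ j)\<^sup>2)"
  by (simp add: norm_vec_def L2_set_def sum_nonneg)

lemma has_derivative_gaussian:
  fixes x :: "real^'n::finite"
  shows "(gaussian c z has_derivative (\<lambda>h. gaussian c z x *
      (\<Sum>j\<in>UNIV. z $ j * of_real (h $ j) - of_real (c * x $ j * h $ j)))) (at x)"
proof -
  have nth: "((\<lambda>x::real^'n. x $ j) has_derivative (\<lambda>h. h $ j)) (at x)" for j
    by (rule bounded_linear.has_derivative[OF bounded_linear_vec_nth has_derivative_ident])
  have "((\<lambda>x::real^'n. z $ j * of_real (x $ j) - of_real (c / 2 * (x $ j)\<^sup>2)) has_derivative
        (\<lambda>h. z $ j * of_real (h $ j) - of_real (c * x $ j * h $ j))) (at x)" for j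
    by (rule derivative_eq_intros nth | simp add: mult_ac)+
  then have "((\<lambda>x::real^'n. \<Sum>j\<in>UNIV. z $ j * of_real (x $ j) - of_real (c / 2 * (x $ j)\<^sup>2)) has_derivative
        (\<lambda>h. \<Sum>j\<in>UNIV. z $ j * of_real (h $ j) - of_real (c * x $ j * h $ j))) (at x)"
    by (intro has_derivative_sum) auto
  from has_derivative_compose[OF this] DERIV_exp
  have "((\<lambda>x. exp (\<Sum>j\<in>UNIV. z $ j * of_real (x $ j) - of_real (c / 2 * (x $ j)\<^sup>2))) has_derivative
      (\<lambda>h. exp (\<Sum>j\<in>UNIV. z $ j * of_real (x $ j) - of_real (c / 2 * (x $ j)\<^sup>2)) *
      (\<Sum>j\<in>UNIV. z $ j * of_real (h $ j) - of_real (c * x $ j * h $ j)))) (at x)"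
    unfolding has_field_derivative_def by blast
  then show ?thesis
    unfolding gaussian_def[abs_def] .
qed

text \<open>The derivative and the membership of its partials come out of one induction, because
  \<open>iter_partial\<close> needs both at each order: existence for smoothness, membership to
  continue.\<close>

lemma gauss_poly_has_derivative:
  assumes "f \<in> gauss_poly"
  shows "\<exists>f'. (\<forall>x. (f has_derivative f' x) (at x)) \<and> (\<forall>j. (\<lambda>x. f' x (axis j 1)) \<in> gauss_poly)"
  using assms
proof induction
  case (gaussian c z)
  have "(\<lambda>x. gaussian c z x * (\<Sum>i\<in>UNIV. z $ i * of_real (axis j 1 $ i) - of_real (c * x $ i * axis j 1 $ i)))
      = (\<lambda>x. z $ j * gaussian c z x + (- of_real c) * (of_real (x $ j) * gaussian c z x))" for j
  proof
    fix x :: "real^'a"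
    have eq: "(\<Sum>i\<in>UNIV. z $ i * of_real (axis j 1 $ i) - of_real (c * x $ i * axis j 1 $ i))
       = (\<Sum>i\<in>UNIV. if i = j then z $ j - of_real (c * x $ j) else 0)"
      by (intro sum.cong) (auto simp: axis_def)
    show "gaussian c z x * (\<Sum>i\<in>UNIV. z $ i * of_real (axis j 1 $ i) - of_real (c * x $ i * axis j 1 $ i))
      = z $ j * gaussian c z x + (- of_real c) * (of_real (x $ j) * gaussian c z x)"
      unfolding eq by (simp add: algebra_simps)
  qed
  moreover have "(\<lambda>x. z $ j * gaussian c z x + (- of_real c) * (of_real (x $ j) * gaussian c z x)) \<in> gauss_poly" for j
    using gaussian by (intro gauss_poly.intros)
  ultimately show ?case
    using has_derivative_gaussian[of c z] by (intro exI[of _ "\<lambda>x h. gaussian c z x *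
      (\<Sum>j\<in>UNIV. z $ j * of_real (h $ j) - of_real (c * x $ j * h $ j))"]) simp
next
  case (coord f i)
  then obtain f' where f': "\<And>x. (f has_derivative f' x) (at x)" "\<And>j. (\<lambda>x. f' x (axis j 1)) \<in> gauss_poly"
    by blast
  have nth: "((\<lambda>x::real^'a. x $ j) has_derivative (\<lambda>h. h $ j)) (at x)" for j x
    by (rule bounded_linear.has_derivative[OF bounded_linear_vec_nth has_derivative_ident])
  have "((\<lambda>x. of_real (x $ i) * f x) has_derivative (\<lambda>h. of_real (x $ i) * f' x h + of_real (h $ i) * f x)) (at x)" for x
    by (rule derivative_eq_intros nth f'(1) | simp)+
  moreover have "(\<lambda>x. of_real (x $ i) * f' x (axis j 1) + of_real (axis j 1 $ i) * f x) \<in> gauss_poly" for j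
    by (intro gauss_poly.intros f'(2) coord)
  ultimately show ?case
    by (intro exI[of _ "\<lambda>x h. of_real (x $ i) * f' x h + of_real (h $ i) * f x"]) blast
next
  case (scale f k)
  then obtain f' where f': "\<And>x. (f has_derivative f' x) (at x)" "\<And>j. (\<lambda>x. f' x (axis j 1)) \<in> gauss_poly"
    by blast
  then show ?case
    by (intro exI[of _ "\<lambda>x h. k * f' x h"]) (auto intro!: gauss_poly.intros has_derivative_mult_right)
next
  case (add f g)
  then obtain f' g' where "\<And>x. (f has_derivative f' x) (at x)" "\<And>j. (\<lambda>x. f' x (axis j 1)) \<in> gauss_poly"
     "\<And>x. (g has_derivative g' x) (at x)" "\<And>j. (\<lambda>x. g' x (axis j 1)) \<in> gauss_poly"
    by blast
  then show ?case
    by (intro exI[of _ "\<lambda>x h. f' x h + g' x h"]) (auto intro!: gauss_poly.intros has_derivative_add)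
qed

text \<open>Every rule for generating the class may spend part of the Gaussian rate: completing the
  square absorbs the linear term and halves \<open>c / 2\<close> to \<open>c / 4\<close>, a
  coordinate factor halves \<open>\<delta>\<close>, and a sum keeps the smaller rate.\<close>

lemma gauss_poly_decay:
  assumes "f \<in> gauss_poly"
  shows "\<exists>C \<delta>. 0 < C \<and> 0 < \<delta> \<and> (\<forall>x. norm (f x) \<le> C * exp (- \<delta> * (norm x)\<^sup>2))"
  using assms
proof induction
  case (gaussian c z)
  have "norm (gaussian c z x) \<le> exp (\<Sum>j\<in>UNIV. (Re (z $ j))\<^sup>2 / c) * exp (- (c / 4) * (norm x)\<^sup>2)" for x
  proof -
    have "Re (z $ j) * x $ j - c / 2 * (x $ j)\<^sup>2 \<le> (Re (z $ j))\<^sup>2 / c - c / 4 * (x $ j)\<^sup>2" for j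
    proof -
      have "0 \<le> (Re (z $ j) - c / 2 * x $ j)\<^sup>2 / c"
        using gaussian by simp
      also have "\<dots> = (Re (z $ j))\<^sup>2 / c - Re (z $ j) * x $ j + c / 4 * (x $ j)\<^sup>2"
        using gaussian by (simp add: power2_eq_square field_simps)
      finally show ?thesis by simp
    qed
    then have "(\<Sum>j\<in>UNIV. Re (z $ j) * x $ j - c / 2 * (x $ j)\<^sup>2) \<le>
      (\<Sum>j\<in>UNIV. (Re (z $ j))\<^sup>2 / c - c / 4 * (x $ j)\<^sup>2)"
      by (intro sum_mono)
    then show ?thesis
      by (simp add: gaussian_def norm_vec_power2 sum_subtractf sum_negf sum_distrib_left flip: exp_add)
  qed
  with gaussian show ?case
    by (intro exI[of _ "exp (\<Sum>j\<in>UNIV. (Re (z $ j))\<^sup>2 / c)"] exI[of _ "c / 4"]) auto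
next
  case (coord f j)
  then obtain C \<delta> where C: "0 < C" "0 < \<delta>" "\<And>x. norm (f x) \<le> C * exp (- \<delta> * (norm x)\<^sup>2)" by blast
  have "norm (of_real (x $ j) * f x) \<le> (1 + 2 / \<delta>) * C * exp (- (\<delta> / 2) * (norm x)\<^sup>2)" for x
  proof -
    have "norm x \<le> 1 + (norm x)\<^sup>2"
      using zero_le_power2[of "norm x - 1"] by (simp add: power2_eq_square algebra_simps)
        (smt (verit) mult_nonneg_nonneg norm_ge_zero)
    also have "\<dots> \<le> (1 + 2 / \<delta>) * (1 + \<delta> / 2 * (norm x)\<^sup>2)"
      using C by (simp add: field_simps add_nonneg_nonneg)
    also have "\<dots> \<le> (1 + 2 / \<delta>) * exp (\<delta> / 2 * (norm x)\<^sup>2)"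
      using C by (intro mult_left_mono exp_ge_add_one_self) auto
    finally have 1: "norm x \<le> (1 + 2 / \<delta>) * exp (\<delta> / 2 * (norm x)\<^sup>2)" .
    have "norm (of_real (x $ j) * f x) \<le> norm x * (C * exp (- \<delta> * (norm x)\<^sup>2))"
      using C component_le_norm_cart[of x j] by (simp add: norm_mult mult_mono)
    also have "\<dots> \<le> (1 + 2 / \<delta>) * exp (\<delta> / 2 * (norm x)\<^sup>2) * (C * exp (- \<delta> * (norm x)\<^sup>2))"
      using 1 C by (intro mult_right_mono) auto
    also have "\<dots> = (1 + 2 / \<delta>) * C * exp (- (\<delta> / 2) * (norm x)\<^sup>2)"
      by (simp add: field_simps flip: exp_add)
    finally show ?thesis .
  qed
  with C show ?case
    by (intro exI[of _ "(1 + 2 / \<delta>) * C"] exI[of _ "\<delta> / 2"]) (auto intro!: mult_pos_pos add_pos_pos)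
next
  case (scale f k)
  then obtain C \<delta> where C: "0 < C" "0 < \<delta>" "\<And>x. norm (f x) \<le> C * exp (- \<delta> * (norm x)\<^sup>2)" by blast
  have "norm (k * f x) \<le> ((norm k + 1) * C) * exp (- \<delta> * (norm x)\<^sup>2)" for x
    using C(3)[of x] by (simp add: norm_mult mult.assoc mult_mono)
  with C show ?case
    by (intro exI[of _ "(norm k + 1) * C"] exI[of _ \<delta>]) (auto intro!: mult_pos_pos add_nonneg_pos)
next
  case (add f g)
  then obtain C \<delta> D \<epsilon> where C: "0 < C" "0 < \<delta>" "\<And>x. norm (f x) \<le> C * exp (- \<delta> * (norm x)\<^sup>2)"
    and D: "0 < D" "0 < \<epsilon>" "\<And>x. norm (g x) \<le> D * exp (- \<epsilon> * (norm x)\<^sup>2)" by blast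
  have "norm (f x + g x) \<le> (C + D) * exp (- min \<delta> \<epsilon> * (norm x)\<^sup>2)" for x
  proof -
    have "norm (f x + g x) \<le> C * exp (- \<delta> * (norm x)\<^sup>2) + D * exp (- \<epsilon> * (norm x)\<^sup>2)"
      using C(3)[of x] D(3)[of x] norm_triangle_ineq[of "f x" "g x"] by linarith
    also have "\<dots> \<le> C * exp (- min \<delta> \<epsilon> * (norm x)\<^sup>2) + D * exp (- min \<delta> \<epsilon> * (norm x)\<^sup>2)"
      using C D by (intro add_mono mult_left_mono) (auto intro!: mult_right_mono)
    finally show ?thesis by (simp add: algebra_simps)
  qed
  with C D show ?case
    by (intro exI[of _ "C + D"] exI[of _ "min \<delta> \<epsilon>"]) auto
qed

lemma iter_partial_gauss_poly:
  "f \<in> gauss_poly \<Longrightarrow> iter_partial js f \<in> gauss_poly"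
proof (induction js)
  case (Cons j js)
  then obtain f' where f': "\<And>x. (iter_partial js f has_derivative f' x) (at x)"
     "(\<lambda>x. f' x (axis j 1)) \<in> gauss_poly"
    using gauss_poly_has_derivative by blast
  then show ?case
    by (simp add: frechet_derivative_at[OF f'(1), symmetric])
qed simp

lemma monomial_gauss_poly:
  assumes "f \<in> gauss_poly"
  shows "(\<lambda>x. of_real (\<Prod>j\<in>J. (x $ j) ^ \<alpha> j) * f x) \<in> gauss_poly"
proof (induction J rule: infinite_finite_induct)
  case (insert j J)
  have "(\<lambda>x. of_real ((x $ j) ^ k) * (of_real (\<Prod>j\<in>J. (x $ j) ^ \<alpha> j) * f x)) \<in> gauss_poly" for k
  proof (induction k)
    case (Suc k)
    from gauss_poly.coord[OF Suc, of j] show ?case by (simp add: mult.assoc)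
  qed (use insert in simp)
  with insert show ?case by (simp add: mult.assoc)
qed (use assms in simp_all)

lemma gauss_poly_continuous:
  assumes "f \<in> gauss_poly"
  shows "continuous_on UNIV f"
  using gauss_poly_has_derivative[OF assms]
  by (auto intro!: continuous_at_imp_continuous_on dest: has_derivative_continuous)

lemma gauss_poly_measurable:
  "f \<in> gauss_poly \<Longrightarrow> f \<in> borel_measurable borel"
  by (intro borel_measurable_continuous_onI gauss_poly_continuous)

lemma gauss_poly_bounded:
  assumes "f \<in> gauss_poly"
  shows "bounded (range f)"
proof -
  obtain C \<delta> where C: "0 < C" "0 < \<delta>" "\<And>x. norm (f x) \<le> C * exp (- \<delta> * (norm x)\<^sup>2)"
    using gauss_poly_decay[OF assms] by blast
  have "norm (f x) \<le> C" for x
  proof -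
    have "C * exp (- \<delta> * (norm x)\<^sup>2) \<le> C * 1"
      using C by (intro mult_left_mono) auto
    then show ?thesis using C(3)[of x] by simp
  qed
  then show ?thesis by (auto simp: bounded_iff)
qed

lemma gauss_poly_schwartz: "f \<in> gauss_poly \<Longrightarrow> f \<in> schwartz"
  unfolding schwartz_def
proof safe
  fix js assume f: "f \<in> gauss_poly"
  have g: "iter_partial js f \<in> gauss_poly" by (rule iter_partial_gauss_poly[OF f])
  show "iter_partial js f differentiable_on UNIV"
    using gauss_poly_has_derivative[OF g] unfolding differentiable_on_def differentiable_def by auto
  show "bounded (range (\<lambda>x. of_real (\<Prod>j\<in>UNIV. (x $ j) ^ \<alpha> j) * iter_partial js f x))" for \<alpha>
    by (rule gauss_poly_bounded[OF monomial_gauss_poly[OF g]])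
qed

lemma gauss_poly_sum:
  assumes "finite K" "K \<noteq> {}" "\<And>k. k \<in> K \<Longrightarrow> f k \<in> gauss_poly"
  shows "(\<lambda>x. \<Sum>k\<in>K. f k x) \<in> gauss_poly"
  using assms by (induction rule: finite_ne_induct) (auto intro: gauss_poly.add)

lemma gauss_poly_translate:
  assumes "f \<in> gauss_poly"
  shows "(\<lambda>x. f (b + x)) \<in> gauss_poly"
  using assms
proof induction
  case (gaussian c z)
  have "gaussian c z (b + x) = exp (\<Sum>j\<in>UNIV. z $ j * of_real (b $ j) - of_real (c / 2 * (b $ j)\<^sup>2)) *
      gaussian c (\<chi> j. z $ j - of_real (c * b $ j)) x" for x
    unfolding gaussian_def exp_add[symmetric] sum.distrib[symmetric]
    by (intro arg_cong[of _ _ exp] sum.cong) (auto simp: power2_eq_square algebra_simps)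
  then have "(\<lambda>x. gaussian c z (b + x)) = (\<lambda>x. exp (\<Sum>j\<in>UNIV. z $ j * of_real (b $ j) - of_real (c / 2 * (b $ j)\<^sup>2)) *
      gaussian c (\<chi> j. z $ j - of_real (c * b $ j)) x)" by blast
  with gaussian show ?case by (auto intro: gauss_poly.intros)
next
  case (coord f j)
  have "(\<lambda>x. of_real ((b + x) $ j) * f (b + x)) =
      (\<lambda>x. of_real (b $ j) * f (b + x) + of_real (x $ j) * f (b + x))"
    by (auto simp: algebra_simps)
  with coord show ?case by (auto intro: gauss_poly.intros)
qed (auto intro: gauss_poly.intros)

lemma gauss_poly_dilate:
  assumes "f \<in> gauss_poly" "l \<noteq> 0"
  shows "(\<lambda>x. f (l *\<^sub>R x)) \<in> gauss_poly"
  using assms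
proof induction
  case (gaussian c z)
  have "(\<lambda>x. gaussian c z (l *\<^sub>R x)) = gaussian (c * l\<^sup>2) (\<chi> j. of_real l * z $ j)"
    unfolding gaussian_def
    by (intro ext arg_cong[of _ _ exp] sum.cong) (auto simp: power2_eq_square algebra_simps)
  with gaussian show ?case by (auto intro: gauss_poly.intros)
next
  case (coord f j)
  have "(\<lambda>x. of_real ((l *\<^sub>R x) $ j) * f (l *\<^sub>R x)) = (\<lambda>x. of_real l * (of_real (x $ j) * f (l *\<^sub>R x)))"
    by (auto simp: algebra_simps)
  with coord show ?case by (auto intro: gauss_poly.intros)
qed (auto intro: gauss_poly.intros)

section \<open>Gaussian integrals and the transform of a modulated Gaussian\<close>

lemma integrable_exp_neg_square:
  assumes "0 < (\<delta>::real)"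
  shows "integrable lborel (\<lambda>r::real. exp (- \<delta> * r\<^sup>2))"
proof -
  let ?\<sigma> = "1 / sqrt (2 * \<delta>)"
  have "0 < ?\<sigma>" using assms by simp
  have "2 * ?\<sigma>\<^sup>2 = 1 / \<delta>" using assms by (simp add: power_divide)
  then have "(\<lambda>r. exp (- \<delta> * r\<^sup>2)) = (\<lambda>r. sqrt (2 * pi * ?\<sigma>\<^sup>2) * normal_density 0 ?\<sigma> r)"
    using assms by (auto simp: normal_density_def fun_eq_iff field_simps)
  then show ?thesis
    using integrable_normal_density[OF \<open>0 < ?\<sigma>\<close>, of 0] by simp
qed

lemma integrable_exp_neg_norm_square:
  assumes "0 < (\<delta>::real)"
  shows "integrable lborel (\<lambda>x::real^'n::finite. exp (- \<delta> * (norm x)\<^sup>2))"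
proof -
  have "(\<lambda>x::real^'n. exp (- \<delta> * (norm x)\<^sup>2)) = (\<lambda>x. \<Prod>j\<in>UNIV. exp (- \<delta> * (x $ j)\<^sup>2))"
    by (simp add: norm_vec_power2 sum_distrib_left exp_sum)
  then show ?thesis
    using integrable_prod_vec[of "\<lambda>_::'n. \<lambda>r. exp (- \<delta> * r\<^sup>2)"] integrable_exp_neg_square[OF assms] by simp
qed

lemma gauss_poly_integrable:
  assumes "f \<in> gauss_poly"
  shows "integrable lborel f"
proof -
  obtain C \<delta> where C: "0 < C" "0 < \<delta>" "\<And>x. norm (f x) \<le> C * exp (- \<delta> * (norm x)\<^sup>2)"
    using gauss_poly_decay[OF assms] by blast
  show ?thesis
  proof (rule Bochner_Integration.integrable_bound)
    show "integrable lborel (\<lambda>x::real^'a. C * exp (- \<delta> * (norm x)\<^sup>2))"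
      using C integrable_exp_neg_norm_square by auto
  qed (use gauss_poly_measurable[OF assms] C in auto)
qed

text \<open>Take logarithms: \<open>M * ln (1 + r) \<le> M * r\<close>, and completing the square
  finishes. This absorbs a weight of any real degree into an arbitrarily small share of a
  Gaussian.\<close>

lemma one_plus_powr_le_exp_square:
  assumes "0 < (\<delta>::real)" "0 \<le> r" "0 \<le> M"
  shows "(1 + r) powr M \<le> exp (M\<^sup>2 / (4 * \<delta>)) * exp (\<delta> * r\<^sup>2)"
proof -
  have "M * ln (1 + r) \<le> M * r"
    using assms by (intro mult_left_mono ln_add_one_self_le_self) auto
  also have "\<dots> \<le> M\<^sup>2 / (4 * \<delta>) + \<delta> * r\<^sup>2"
  proof -
    have "0 \<le> (M - 2 * \<delta> * r)\<^sup>2 / (4 * \<delta>)" using assms by simp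
    also have "\<dots> = M\<^sup>2 / (4 * \<delta>) - M * r + \<delta> * r\<^sup>2"
      using assms by (simp add: power2_eq_square field_simps)
    finally show ?thesis by simp
  qed
  finally show ?thesis
    using assms by (simp add: powr_def flip: exp_add)
qed

text \<open>The integral is the characteristic function of the standard normal distribution, freed
  of the normalization \<open>sqrt (2 * pi)\<close>.\<close>

lemma integral_gaussian_char:
  "integrable lborel (\<lambda>r. exp (\<i> * of_real (t * r)) * of_real (exp (- (r\<^sup>2) / 2)))" (is ?A)
  "(LINT r|lborel. exp (\<i> * of_real (t * r)) * of_real (exp (- (r\<^sup>2) / 2))) =
     of_real (sqrt (2 * pi) * exp (- (t\<^sup>2) / 2))" (is ?B)
proof -
  show ?A
  proof (rule Bochner_Integration.integrable_bound)
    show "integrable lborel (\<lambda>r::real. exp (- (1/2) * r\<^sup>2))"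
      by (rule integrable_exp_neg_square) simp
  qed (auto simp: norm_mult)
  have eq: "(\<lambda>r. exp (\<i> * of_real (t * r)) * of_real (exp (- (r\<^sup>2) / 2))) =
     (\<lambda>r. of_real (sqrt (2 * pi)) * (std_normal_density r *\<^sub>R exp (\<i> * of_real (t * r))))"
    by (auto simp: std_normal_density_def scaleR_conv_of_real simp del: real_sqrt_mult)
  have "char std_normal_distribution t = (LINT r|lborel. std_normal_density r *\<^sub>R exp (\<i> * of_real (t * r)))"
    unfolding char_def by (subst integral_density) auto
  then have "(LINT r|lborel. std_normal_density r *\<^sub>R exp (\<i> * of_real (t * r))) = of_real (exp (- (t\<^sup>2) / 2))"
    by (simp add: char_std_normal_distribution)
  then show ?B
    unfolding eq integral_mult_right_zero by (simp only: of_real_mult)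
qed

text \<open>The exponential factors over the coordinates. What matters later is that the value is
  real and positive, so that integrals of it have no cancellation of their own.\<close>

lemma fourier_gaussian:
  fixes \<xi> :: "real^'n::finite"
  shows "fourier (gaussian 1 (\<chi> j. \<i> * of_real L)) \<xi> =
    of_real (sqrt (2 * pi) ^ CARD('n) * exp (- (norm (\<xi> - (\<chi> j. L)))\<^sup>2 / 2))"
proof -
  have eq: "exp (- \<i> * of_real (x \<bullet> \<xi>)) * gaussian 1 (\<chi> j. \<i> * of_real L) x =
     (\<Prod>j\<in>UNIV. exp (\<i> * of_real ((L - \<xi> $ j) * x $ j)) * of_real (exp (- ((x $ j)\<^sup>2) / 2)))" for x
  proof -
    have "exp (- \<i> * of_real (x \<bullet> \<xi>)) * gaussian 1 (\<chi> j. \<i> * of_real L) x =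
      exp (\<Sum>j\<in>UNIV. (- \<i> * of_real (x $ j * \<xi> $ j)) + (\<i> * of_real L * of_real (x $ j) - of_real (1 / 2 * (x $ j)\<^sup>2)))"
      unfolding gaussian_def sum.distrib exp_add inner_vec_def
      by (simp add: sum_distrib_left)
    also have "\<dots> = exp (\<Sum>j\<in>UNIV. \<i> * of_real ((L - \<xi> $ j) * x $ j) + of_real (- ((x $ j)\<^sup>2) / 2))"
      by (intro arg_cong[of _ _ exp] sum.cong) (auto simp: algebra_simps)
    finally show ?thesis
      by (simp only: exp_sum[OF finite] exp_add exp_of_real)
  qed
  have "fourier (gaussian 1 (\<chi> j. \<i> * of_real L)) \<xi> =
      (\<Prod>j\<in>UNIV. of_real (sqrt (2 * pi) * exp (- ((L - \<xi> $ j)\<^sup>2) / 2)))"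
    unfolding fourier_def eq
    by (subst integral_prod_vec) (simp_all only: integral_gaussian_char)
  also have "\<dots> = of_real (sqrt (2 * pi) ^ CARD('n) * exp (\<Sum>j\<in>UNIV. - ((L - \<xi> $ j)\<^sup>2) / 2))"
    by (simp add: prod.distrib exp_sum del: real_sqrt_mult)
  also have "(\<Sum>j\<in>UNIV. - ((L - \<xi> $ j)\<^sup>2) / 2) = - (norm (\<xi> - (\<chi> j. L)))\<^sup>2 / 2"
    by (simp add: norm_vec_power2 sum_negf sum_divide_distrib power2_commute)
  finally show ?thesis .
qed

section \<open>The Fourier transform under sums, translations and dilations\<close>

lemma integrable_fourier_kernel:
  fixes f :: "real^'n::finite \<Rightarrow> complex"
  assumes f: "integrable lborel f"
  shows "integrable lborel (\<lambda>x. exp (- \<i> * of_real (x \<bullet> \<xi>)) * f x)"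
proof -
  have [measurable]: "f \<in> borel_measurable borel"
    using borel_measurable_integrable[OF f] by simp
  show ?thesis
    by (rule Bochner_Integration.integrable_bound[OF f]) (auto simp: norm_mult)
qed

lemma fourier_add:
  assumes "integrable lborel f" "integrable lborel g"
  shows "fourier (\<lambda>x. f x + g x) \<xi> = fourier f \<xi> + fourier g \<xi>"
  unfolding fourier_def ring_distribs
  by (intro Bochner_Integration.integral_add integrable_fourier_kernel assms)

lemma fourier_cmult: "fourier (\<lambda>x. k * f x) \<xi> = k * fourier f \<xi>"
  unfolding fourier_def mult.left_commute[of _ k]  by (rule integral_mult_right_zero)

lemma fourier_sum:
  assumes "\<And>k. k \<in> K \<Longrightarrow> integrable lborel (f k)"
  shows "fourier (\<lambda>x. \<Sum>k\<in>K. f k x) \<xi> = (\<Sum>k\<in>K. fourier (f k) \<xi>)"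
  unfolding fourier_def sum_distrib_left
  by (intro Bochner_Integration.integral_sum integrable_fourier_kernel assms)

lemma fourier_translate:
  assumes "integrable lborel f"
  shows "fourier (\<lambda>x. f (b + x)) \<xi> = exp (\<i> * of_real (b \<bullet> \<xi>)) * fourier f \<xi>"
proof -
  have "fourier f \<xi> = (LINT x|lborel. exp (- \<i> * of_real ((b + x) \<bullet> \<xi>)) * f (b + x))"
    unfolding fourier_def
    using integral_affine[OF _ integrable_fourier_kernel[OF assms], of 1 \<xi> b] by simp
  also have "\<dots> = (LINT x|lborel. exp (- \<i> * of_real (b \<bullet> \<xi>)) * (exp (- \<i> * of_real (x \<bullet> \<xi>)) * f (b + x)))"
    unfolding mult.assoc[symmetric] exp_add[symmetric]
    by (simp add: inner_add_left algebra_simps)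
  also have "\<dots> = exp (- \<i> * of_real (b \<bullet> \<xi>)) * fourier (\<lambda>x. f (b + x)) \<xi>"
    unfolding fourier_def by (rule integral_mult_right_zero)
  finally show ?thesis
    by (simp add: mult.assoc[symmetric] exp_add[symmetric])
qed

lemma fourier_dilate:
  fixes f :: "real^'n::finite \<Rightarrow> complex"
  assumes "integrable lborel f" "0 < l"
  shows "fourier (\<lambda>x. f (l *\<^sub>R x)) \<xi> = of_real (1 / l ^ CARD('n)) * fourier f (\<xi> /\<^sub>R l)"
proof -
  have "fourier f (\<xi> /\<^sub>R l) = l ^ CARD('n) *\<^sub>R (LINT x|lborel. exp (- \<i> * of_real ((l *\<^sub>R x) \<bullet> (\<xi> /\<^sub>R l))) * f (l *\<^sub>R x))"
    unfolding fourier_def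
    using integral_affine[OF _ integrable_fourier_kernel[OF assms(1)], of l "\<xi> /\<^sub>R l" 0] assms(2) by simp
  also have "\<dots> = l ^ CARD('n) *\<^sub>R fourier (\<lambda>x. f (l *\<^sub>R x)) \<xi>"
    unfolding fourier_def using assms(2)
    by (simp only: inner_scaleR_left inner_scaleR_right mult.assoc[symmetric]) simp
  finally show ?thesis
    using assms(2) by (simp add: scaleR_conv_of_real)
qed

text \<open>Multiplies the Fourier transform by \<open>1 - cos (\<xi> $ i)\<close>; iterating it makes the transform vanish at
  the origin to any order, which keeps Sobolev norms with very negative exponent finite.\<close>

definition second_difference :: "'n::finite \<Rightarrow> (real^'n \<Rightarrow> complex) \<Rightarrow> real^'n \<Rightarrow> complex" where
  "second_difference i f x = f x + (- 1 / 2) * (f (axis i 1 + x) + f (- axis i 1 + x))"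

lemma gauss_poly_second_difference:
  assumes "f \<in> gauss_poly"
  shows "(second_difference i ^^ m) f \<in> gauss_poly"
proof -
  have "second_difference i g \<in> gauss_poly" if "g \<in> gauss_poly" for g
    unfolding second_difference_def[abs_def]
    by (intro gauss_poly.intros gauss_poly_translate that)
  then show ?thesis by (induction m) (simp_all add: assms)
qed

lemma fourier_second_difference:
  assumes "f \<in> gauss_poly"
  shows "fourier ((second_difference i ^^ m) f) \<xi> = of_real ((1 - cos (\<xi> $ i)) ^ m) * fourier f \<xi>"
proof (induction m)
  case (Suc m)
  define g where "g = (second_difference i ^^ m) f"
  have g: "g \<in> gauss_poly"
    unfolding g_def by (rule gauss_poly_second_difference[OF assms])
  have i: "integrable lborel h" if "h \<in> gauss_poly" for h :: "real^'a \<Rightarrow> complex"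
    using that by (rule gauss_poly_integrable)
  have "fourier (second_difference i g) \<xi> = fourier g \<xi> + (- 1 / 2) *
     (exp (\<i> * of_real (\<xi> $ i)) * fourier g \<xi> + exp (- \<i> * of_real (\<xi> $ i)) * fourier g \<xi>)"
    unfolding second_difference_def[abs_def]
    by (subst fourier_add fourier_cmult fourier_translate;
        (intro i gauss_poly.intros gauss_poly_translate g)?)+
       (simp add: inner_commute[of "axis _ _"] inner_axis)
  also have "\<dots> = of_real (1 - cos (\<xi> $ i)) * fourier g \<xi>"
    by (simp add: cos_exp_eq cos_of_real[symmetric] field_simps)
  finally show ?case
    using Suc by (simp add: g_def)
qed simp

subsection \<open>Necessity: scaling and wave packets\<close>

text \<open>The left side equals \<open>2 * \<bar>sin (t / 2)\<bar>\<close>. The linear bound serves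
  frequencies near the centre, the constant 2 those where the phase cannot be expanded.\<close>

lemma norm_exp_i_minus_one: "norm (exp (\<i> * of_real t) - 1) \<le> min 2 \<bar>t\<bar>"
  using abs_sin_x_le_abs_x[of "t / 2"] abs_sin_le_one[of "t / 2"] by (simp add: dist_exp_i_1)

text \<open>Taylor's formula with Lagrange remainder. For \<open>\<bar>w\<bar> \<le> 1 / 2\<close>
  the intermediate base lies between 1/2 and 2, so its power \<open>a - 2\<close> is at most
  \<open>2 powr \<bar>a - 2\<bar>\<close> whatever the sign of \<open>a - 2\<close>.\<close>

lemma powr_second_order:
  fixes a w :: real
  assumes "1 < a" "\<bar>w\<bar> \<le> 1 / 2"
  shows "\<bar>(1 + w) powr a - 1 - a * w\<bar> \<le> a * (a - 1) * 2 powr \<bar>a - 2\<bar> * w\<^sup>2"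
proof -
  \<comment> \<open>Only orders 0 and 1 have to be differentiated, so a single formula may serve for
    all indices from 2 on.\<close>
  define diff where "diff = (\<lambda>m::nat. if m = 0 then (\<lambda>w. (1 + w) powr a)
     else if m = 1 then (\<lambda>w. a * (1 + w) powr (a - 1)) else (\<lambda>w. a * (a - 1) * (1 + w) powr (a - 2)))"
  have "\<forall>m t. m < 2 \<and> \<bar>t\<bar> \<le> \<bar>w\<bar> \<longrightarrow> DERIV (diff m) t :> diff (Suc m) t"
  proof (intro allI impI)
    fix m :: nat and t :: real assume *: "m < 2 \<and> \<bar>t\<bar> \<le> \<bar>w\<bar>"
    then have "0 < 1 + t" using assms by linarith
    then have 1: "((\<lambda>w. (1 + w) powr b) has_real_derivative b * (1 + t) powr (b - 1)) (at t)" for b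
      by (auto intro!: derivative_eq_intros)
    have "m = 0 \<or> m = 1" using * by auto
    then show "DERIV (diff m) t :> diff (Suc m) t"
      using 1[of a] DERIV_cmult[OF 1[of "a - 1"], of a] by (auto simp: diff_def mult.assoc)
  qed
  then obtain t where t: "\<bar>t\<bar> \<le> \<bar>w\<bar>"
    "(1 + w) powr a = (\<Sum>m<2. diff m 0 / fact m * w ^ m) + diff 2 t / fact 2 * w ^ 2"
    using Maclaurin_bi_le[of diff "\<lambda>w. (1 + w) powr a" 2 w] by (auto simp: diff_def)
  have "(1 + w) powr a - 1 - a * w = a * (a - 1) * (1 + t) powr (a - 2) / 2 * w\<^sup>2"
    using t(2) by (simp add: diff_def numeral_2_eq_2)
  then have "\<bar>(1 + w) powr a - 1 - a * w\<bar> = \<bar>a * (a - 1) * (1 + t) powr (a - 2) / 2 * w\<^sup>2\<bar>"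
    by (simp only:)
  also have "\<dots> = (a * (a - 1)) * ((1 + t) powr (a - 2) / 2) * w\<^sup>2"
    using assms by (subst abs_of_nonneg) auto
  finally have "\<bar>(1 + w) powr a - 1 - a * w\<bar> = (a * (a - 1)) * ((1 + t) powr (a - 2) / 2) * w\<^sup>2" .
  moreover have "(1 + t) powr (a - 2) \<le> 2 powr \<bar>a - 2\<bar>"
  proof (cases "a \<ge> 2")
    case True
    then show ?thesis using t(1) assms by (auto intro!: powr_mono2)
  next
    case False
    have "(1 + t) powr (a - 2) \<le> (1 / 2) powr (a - 2)"
      using False t(1) assms by (intro powr_mono2') auto
    also have "\<dots> = 2 powr \<bar>a - 2\<bar>"
      using False by (simp add: powr_divide powr_minus_divide[symmetric])
    finally show ?thesis .
  qed
  moreover have "0 \<le> a * (a - 1)" using assms by simp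
  ultimately have "\<bar>(1 + w) powr a - 1 - a * w\<bar> \<le> (a * (a - 1)) * (2 powr \<bar>a - 2\<bar> / 2) * w\<^sup>2"
    by (simp only:) (intro mult_left_mono mult_right_mono divide_right_mono; simp)
  also have "\<dots> \<le> a * (a - 1) * 2 powr \<bar>a - 2\<bar> * w\<^sup>2"
    using \<open>0 \<le> a * (a - 1)\<close> by (intro mult_right_mono mult_left_mono) auto
  finally show ?thesis .
qed

text \<open>With this choice of \<open>t\<close> the phase is stationary at frequency \<open>L\<close>.\<close>

lemma stationary_phase_bound:
  fixes a L x v :: real
  assumes a: "1 < a" and L: "0 < L" and v: "\<bar>v\<bar> \<le> L / 2"
  defines "t \<equiv> - x / (a * L powr (a - 1))"
  shows "\<bar>x * v + t * (\<bar>v + L\<bar> powr a - L powr a)\<bar> \<le> (a - 1) * 2 powr \<bar>a - 2\<bar> * (\<bar>x\<bar> / L) * v\<^sup>2"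
proof -
  define w where "w = v / L"
  have w: "\<bar>w\<bar> \<le> 1 / 2" using L v by (simp add: w_def field_simps)
  have vw: "v = L * w" using L by (simp add: w_def)
  have "v + L = L * (1 + w)" by (simp add: vw algebra_simps)
  moreover have "0 \<le> L * (1 + w)" using L w by (intro mult_nonneg_nonneg) linarith+
  ultimately have "\<bar>v + L\<bar> = L * (1 + w)" by simp
  then have "\<bar>v + L\<bar> powr a = L powr a * (1 + w) powr a"
    using L w by (simp add: powr_mult)
  \<comment> \<open>The power \<open>L powr a\<close> disappears here; the remaining bound depends
    on \<open>a\<close> only through its constant.\<close>
  moreover have "t * L powr a = - x * L / a"
    using L a by (simp add: t_def powr_diff field_simps)
  moreover have "t * (L powr a * (1 + w) powr a - L powr a) = (t * L powr a) * ((1 + w) powr a - 1)"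
    by (simp add: algebra_simps)
  ultimately have "t * (\<bar>v + L\<bar> powr a - L powr a) = (- x * L / a) * ((1 + w) powr a - 1)"
    by (simp only:)
  then have "x * v + t * (\<bar>v + L\<bar> powr a - L powr a) = - (x * L / a) * ((1 + w) powr a - 1 - a * w)"
    using a by (simp add: vw) (simp add: field_simps)
  then have "\<bar>x * v + t * (\<bar>v + L\<bar> powr a - L powr a)\<bar> = (\<bar>x\<bar> * L / a) * \<bar>(1 + w) powr a - 1 - a * w\<bar>"
    using a L by (simp add: abs_mult)
  also have "\<dots> \<le> (\<bar>x\<bar> * L / a) * (a * (a - 1) * 2 powr \<bar>a - 2\<bar> * w\<^sup>2)"
    using a L by (intro mult_left_mono powr_second_order w) auto
  also have "\<dots> = (a - 1) * 2 powr \<bar>a - 2\<bar> * (\<bar>x\<bar> / L) * v\<^sup>2"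
    using a L by (simp add: vw power2_eq_square field_simps)
  finally show ?thesis .
qed

lemma integrable_S_op_integrand:
  fixes F :: "real^'n::finite \<Rightarrow> complex"
  assumes F: "integrable lborel F"
  shows "integrable lborel (\<lambda>\<xi>. exp (\<i> * of_real (x \<bullet> \<xi>)) *
     exp (\<i> * of_real (\<Sum>j\<in>UNIV. t $ j * \<bar>\<xi> $ j\<bar> powr (a $ j))) * F \<xi>)"
proof -
  have [measurable]: "F \<in> borel_measurable borel"
    using borel_measurable_integrable[OF F] by simp
  show ?thesis
    by (rule Bochner_Integration.integrable_bound[OF F]) (auto simp: norm_mult)
qed

text \<open>Recentred at the frequency \<open>L\<close>, the integrand is a unimodular constant
  times \<open>E u * P u\<close>, with \<open>E u - 1\<close> quadratically small. Replacing
  \<open>E\<close> by 1 costs a multiple of the second moment of \<open>P\<close>, and the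
  nonnegative \<open>P\<close> leaves its full integral as main term.\<close>

lemma S_op_stationary_lower_bound:
  fixes f :: "real^'n::finite \<Rightarrow> complex"
  assumes a: "\<And>j. 1 < a $ j" and L: "0 < L"
    and F: "integrable lborel (fourier f)"
    and P: "\<And>u. fourier f (u + (\<chi> j. L)) = of_real (P u)" "\<And>u. 0 \<le> P u"
    and P2: "integrable lborel (\<lambda>u. (norm u)\<^sup>2 * P u)"
    and K: "\<And>j. (a $ j - 1) * 2 powr \<bar>a $ j - 2\<bar> \<le> K"
    and x: "\<And>j. \<bar>x $ j\<bar> \<le> \<epsilon> * L" and \<epsilon>: "8 / L\<^sup>2 \<le> K * \<epsilon>"
  shows "\<exists>t. norm (S_op a t f x) \<ge> (LINT u|lborel. P u) - K * \<epsilon> * (LINT u|lborel. (norm u)\<^sup>2 * P u)"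
proof -
  define t :: "real^'n" where "t = (\<chi> j. - x $ j / (a $ j * L powr (a $ j - 1)))"
  define \<Phi> where "\<Phi> = (\<lambda>j v. x $ j * v + t $ j * (\<bar>v + L\<bar> powr (a $ j) - L powr (a $ j)))"
  \<comment> \<open>The phase at the centre frequency; it does not depend on \<open>u\<close> and
    disappears with the modulus.\<close>
  define \<theta> where "\<theta> = (\<Sum>j\<in>UNIV. x $ j * L + t $ j * L powr (a $ j))"
  have [measurable]: "fourier f \<in> borel_measurable borel"
    using borel_measurable_integrable[OF F] by simp
  have "integrable lborel (\<lambda>u. fourier f (u + (\<chi> j. L)))"
    using integrable_affine[OF F, of 1 "\<chi> j. L"] by (simp add: add.commute)
  then have iPc: "integrable lborel (\<lambda>u. complex_of_real (P u))"
    by (simp add: P)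
  from integrable_Re[OF this] have iP: "integrable lborel P" by simp
  then have [measurable]: "P \<in> borel_measurable borel"
    using borel_measurable_integrable by auto
  have "0 \<le> (a $ j - 1) * 2 powr \<bar>a $ j - 2\<bar>" for j
    using a[of j] by simp
  then have K0: "0 \<le> K" using K order_trans by blast
  have \<Phi>_bound: "norm (exp (\<i> * of_real (\<Phi> j v)) - 1) \<le> K * \<epsilon> * v\<^sup>2" for j v
  proof (cases "\<bar>v\<bar> \<le> L / 2")
    case True
    have "\<bar>\<Phi> j v\<bar> \<le> (a $ j - 1) * 2 powr \<bar>a $ j - 2\<bar> * (\<bar>x $ j\<bar> / L) * v\<^sup>2"
      unfolding \<Phi>_def t_def using stationary_phase_bound[OF a L True, of "x $ j" j] by simp
    also have "\<dots> \<le> K * \<epsilon> * v\<^sup>2"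
      using K[of j] x[of j] L a[of j] K0 by (intro mult_right_mono mult_mono) (auto simp: pos_divide_le_eq)
    finally show ?thesis using norm_exp_i_minus_one[of "\<Phi> j v"] by linarith
  next
    case False
    have "1 \<le> 4 * v\<^sup>2 / L\<^sup>2"
    proof -
      have "(L / 2)\<^sup>2 \<le> \<bar>v\<bar>\<^sup>2" using False L by (intro power_mono) auto
      then show ?thesis using L by (simp add: field_simps power2_eq_square)
    qed
    then have "2 \<le> 8 / L\<^sup>2 * v\<^sup>2" by simp
    also have "\<dots> \<le> K * \<epsilon> * v\<^sup>2" by (intro mult_right_mono \<epsilon>) auto
    finally show ?thesis using norm_exp_i_minus_one[of "\<Phi> j v"] by linarith
  qed
  define E where "E = (\<lambda>u::real^'n. exp (\<i> * of_real (\<Sum>j\<in>UNIV. \<Phi> j (u $ j))))"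
  have E_bound: "norm (E u - 1) \<le> K * \<epsilon> * (norm u)\<^sup>2" for u
  proof -
    have "norm (E u - 1) = norm ((\<Prod>j\<in>UNIV. exp (\<i> * of_real (\<Phi> j (u $ j)))) - (\<Prod>j\<in>(UNIV::'n set). 1))"
      by (simp add: E_def sum_distrib_left exp_sum)
    also have "\<dots> \<le> (\<Sum>j\<in>UNIV. norm (exp (\<i> * of_real (\<Phi> j (u $ j))) - 1))"
      by (rule norm_prod_diff) auto
    also have "\<dots> \<le> (\<Sum>j\<in>UNIV. K * \<epsilon> * (u $ j)\<^sup>2)"
      by (intro sum_mono \<Phi>_bound)
    finally show ?thesis by (simp add: norm_vec_power2 sum_distrib_left)
  qed
  have [measurable]: "E \<in> borel_measurable borel"
    unfolding E_def \<Phi>_def by measurable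
  have "S_op a t f x = (LINT u|lborel. exp (\<i> * of_real (x \<bullet> ((\<chi> j. L) + u))) *
     exp (\<i> * of_real (\<Sum>j\<in>UNIV. t $ j * \<bar>((\<chi> j. L) + u) $ j\<bar> powr (a $ j))) * fourier f ((\<chi> j. L) + u))"
    unfolding S_op_def
    using integral_affine[OF _ integrable_S_op_integrand[OF F, of x t a], of 1 "\<chi> j. L"] by simp
  also have "\<dots> = (LINT u|lborel. exp (\<i> * of_real \<theta>) * (E u * of_real (P u)))"
  proof (intro Bochner_Integration.integral_cong refl)
    fix u :: "real^'n"
    have "x \<bullet> ((\<chi> j. L) + u) + (\<Sum>j\<in>UNIV. t $ j * \<bar>((\<chi> j. L) + u) $ j\<bar> powr (a $ j))
       = \<theta> + (\<Sum>j\<in>UNIV. \<Phi> j (u $ j))"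
      unfolding \<theta>_def \<Phi>_def inner_vec_def sum.distrib[symmetric]
      by (intro sum.cong) (auto simp: algebra_simps)
    then show "exp (\<i> * of_real (x \<bullet> ((\<chi> j. L) + u))) *
      exp (\<i> * of_real (\<Sum>j\<in>UNIV. t $ j * \<bar>((\<chi> j. L) + u) $ j\<bar> powr (a $ j))) * fourier f ((\<chi> j. L) + u) =
      exp (\<i> * of_real \<theta>) * (E u * of_real (P u))"
      unfolding E_def mult.assoc[symmetric] exp_add[symmetric] distrib_left[symmetric] of_real_add[symmetric]
      using P(1)[of u] by (simp add: add.commute)
  qed
  also have "\<dots> = exp (\<i> * of_real \<theta>) * (LINT u|lborel. E u * of_real (P u))"
    by (rule integral_mult_right_zero)
  finally have S: "norm (S_op a t f x) = norm (LINT u|lborel. E u * of_real (P u))"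
    by (simp add: norm_mult)
  have nE: "norm (E u) = 1" for u unfolding E_def by simp
  have iE: "integrable lborel (\<lambda>u. E u * of_real (P u))"
    by (rule Bochner_Integration.integrable_bound[OF iP]) (auto simp: norm_mult nE)
  have "norm ((LINT u|lborel. E u * of_real (P u)) - of_real (LINT u|lborel. P u))
     = norm (LINT u|lborel. E u * of_real (P u) - of_real (P u))"
    using iE iPc by (subst Bochner_Integration.integral_diff) auto
  also have "\<dots> \<le> (LINT u|lborel. K * \<epsilon> * ((norm u)\<^sup>2 * P u))"
  proof (rule Bochner_Integration.integral_norm_bound_integral)
    fix u
    have "norm (E u * of_real (P u) - of_real (P u)) = norm (E u - 1) * P u"
      using P(2)[of u] by (metis left_diff_distrib mult_1 norm_mult norm_of_real abs_of_nonneg)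
    also have "\<dots> \<le> K * \<epsilon> * (norm u)\<^sup>2 * P u"
      by (intro mult_right_mono E_bound P)
    finally show "norm (E u * of_real (P u) - of_real (P u)) \<le> K * \<epsilon> * ((norm u)\<^sup>2 * P u)"
      by (simp add: mult.assoc)
  qed (use iE iPc P2 in auto)
  finally have "norm ((LINT u|lborel. E u * of_real (P u)) - of_real (LINT u|lborel. P u))
     \<le> K * \<epsilon> * (LINT u|lborel. (norm u)\<^sup>2 * P u)" by simp
  moreover have "norm (complex_of_real (LINT u|lborel. P u)) = (LINT u|lborel. P u)"
    using P by (simp add: Bochner_Integration.integral_nonneg)
  ultimately have "norm (S_op a t f x) \<ge> (LINT u|lborel. P u) - K * \<epsilon> * (LINT u|lborel. (norm u)\<^sup>2 * P u)"
    unfolding S using norm_triangle_ineq2[of "of_real (LINT u|lborel. P u)" "LINT u|lborel. E u * of_real (P u)"]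
    by (simp add: norm_minus_commute)
  then show ?thesis by blast
qed

text \<open>Each coordinate of time rescales by its own power of \<open>l\<close>. As the supremum
  runs over all coordinates of \<open>t\<close> independently, the maximal function is compatible
  with isotropic dilations even when the \<open>a $ j\<close> differ.\<close>

lemma S_op_dilate:
  fixes f :: "real^'n::finite \<Rightarrow> complex"
  assumes f: "integrable lborel f" and F: "integrable lborel (fourier f)" and l: "0 < l"
  shows "S_op a (\<chi> j. t $ j * l powr (- (a $ j))) (\<lambda>x. f (l *\<^sub>R x)) x = S_op a t f (l *\<^sub>R x)"
proof -
  let ?t = "\<chi> j. t $ j * l powr (- (a $ j))"
  let ?f = "\<lambda>x. f (l *\<^sub>R x)"
  have "integrable lborel (\<lambda>\<xi>. fourier f (\<xi> /\<^sub>R l))"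
    using integrable_affine[OF F, of "inverse l" 0] l by simp
  then have F': "integrable lborel (fourier ?f)"
    unfolding ext[of "fourier ?f", OF fourier_dilate[OF f l]] by simp
  have "S_op a ?t ?f x = of_real (l ^ CARD('n)) * (LINT \<xi>|lborel. exp (\<i> * of_real (x \<bullet> (l *\<^sub>R \<xi>))) *
     exp (\<i> * of_real (\<Sum>j\<in>UNIV. ?t $ j * \<bar>(l *\<^sub>R \<xi>) $ j\<bar> powr (a $ j))) * fourier ?f (l *\<^sub>R \<xi>))"
    unfolding S_op_def
    using integral_affine[OF _ integrable_S_op_integrand[OF F', of x ?t a], of l 0] l
    by (simp add: scaleR_conv_of_real)
  also have "\<dots> = of_real (l ^ CARD('n)) * (LINT \<xi>|lborel. of_real (1 / l ^ CARD('n)) * (exp (\<i> * of_real ((l *\<^sub>R x) \<bullet> \<xi>)) *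
     exp (\<i> * of_real (\<Sum>j\<in>UNIV. t $ j * \<bar>\<xi> $ j\<bar> powr (a $ j))) * fourier f \<xi>))"
  proof (intro arg_cong[of _ _ "(*) _"] Bochner_Integration.integral_cong refl)
    fix \<xi>
    have "?t $ j * \<bar>(l *\<^sub>R \<xi>) $ j\<bar> powr (a $ j) = t $ j * \<bar>\<xi> $ j\<bar> powr (a $ j)" for j
      using l by (simp add: abs_mult powr_mult powr_minus)
    moreover have "x \<bullet> (l *\<^sub>R \<xi>) = (l *\<^sub>R x) \<bullet> \<xi>" by simp
    moreover have "fourier ?f (l *\<^sub>R \<xi>) = of_real (1 / l ^ CARD('n)) * fourier f \<xi>"
      using fourier_dilate[OF f l, of "l *\<^sub>R \<xi>"] l by simp
    ultimately show "exp (\<i> * of_real (x \<bullet> (l *\<^sub>R \<xi>))) *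
     exp (\<i> * of_real (\<Sum>j\<in>UNIV. ?t $ j * \<bar>(l *\<^sub>R \<xi>) $ j\<bar> powr (a $ j))) * fourier ?f (l *\<^sub>R \<xi>) =
       of_real (1 / l ^ CARD('n)) * (exp (\<i> * of_real ((l *\<^sub>R x) \<bullet> \<xi>)) *
     exp (\<i> * of_real (\<Sum>j\<in>UNIV. t $ j * \<bar>\<xi> $ j\<bar> powr (a $ j))) * fourier f \<xi>)"
      by (simp only: mult_ac)
  qed
  also have "\<dots> = S_op a t f (l *\<^sub>R x)"
    unfolding integral_mult_right_zero S_op_def using l by simp
  finally show ?thesis .
qed

section \<open>Powers and norms in the extended nonnegative reals\<close>

lemma ennreal_lt_top_cases: "q < \<infinity> \<Longrightarrow> 1 \<le> q \<Longrightarrow> 1 \<le> enn2real q" for q :: ennreal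
  by (cases q) auto

lemma ennpowr_mono: "x \<le> y \<Longrightarrow> 0 \<le> p \<Longrightarrow> ennpowr x p \<le> ennpowr y p"
  by (cases x; cases y) (auto simp: ennpowr_def powr_mono2 top_unique)

lemma ennpowr_ennreal [simp]: "0 \<le> x \<Longrightarrow> ennpowr (ennreal x) p = ennreal (x powr p)"
  by (simp add: ennpowr_def)

text \<open>One formula covers both branches of the norm: \<open>enn2real \<infinity> = 0\<close>
  and \<open>1 / 0 = 0\<close>, so for \<open>q = \<infinity>\<close> the factor is
  \<open>V powr 0 = 1\<close>, as the essential supremum requires.\<close>

lemma Lq_norm_lower_bound:
  fixes g :: "real^'n::finite \<Rightarrow> ennreal"
  assumes q: "1 \<le> q" and B: "B \<in> sets borel" "emeasure lborel B = ennreal V" "0 < V"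
    and c: "0 \<le> c" "\<And>x. x \<in> B \<Longrightarrow> ennreal c \<le> g x"
  shows "ennreal (c * V powr (1 / enn2real q)) \<le> Lq_norm q g"
proof (cases "q = \<infinity>")
  case True
  have "ennreal c \<le> esssup lborel g"
  proof (rule ccontr)
    assume "\<not> ennreal c \<le> esssup lborel g"
    then have "AE x in lborel. x \<notin> B"
      using esssup_AE[of g lborel] c(2) by (auto elim!: eventually_mono dest: order_trans)
    then have "emeasure lborel B = 0"
      using B(1) by (subst (asm) AE_iff_measurable[of B]) auto
    with B show False by simp
  qed
  then show ?thesis using True B(3) by (simp add: Lq_norm_def)
next
  case False
  define p where "p = enn2real q"
  have p: "1 \<le> p" unfolding p_def using False q by (intro ennreal_lt_top_cases) (auto simp: less_top)
  have "ennreal (c powr p * V) = (\<integral>\<^sup>+x. ennreal (c powr p) * indicator B x \<partial>lborel)"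
    using B by (simp add: nn_integral_cmult_indicator ennreal_mult)
  also have "\<dots> \<le> (\<integral>\<^sup>+x. ennpowr (g x) p \<partial>lborel)"
  proof (intro nn_integral_mono)
    fix x show "ennreal (c powr p) * indicator B x \<le> ennpowr (g x) p"
      using ennpowr_mono[OF c(2)[of x], of p] p c(1) by (auto simp: indicator_def)
  qed
  finally have "ennpowr (ennreal (c powr p * V)) (1 / p) \<le> ennpowr (\<integral>\<^sup>+x. ennpowr (g x) p \<partial>lborel) (1 / p)"
    using p by (intro ennpowr_mono) auto
  then show ?thesis
    using False p B(3) c(1) by (simp add: Lq_norm_def p_def[symmetric] powr_mult powr_powr)
qed

section \<open>Wave packets: large maximal function, controlled Sobolev norm\<close>

definition wave :: "nat \<Rightarrow> 'n::finite \<Rightarrow> real \<Rightarrow> real^'n \<Rightarrow> complex" where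
  "wave m i L = (second_difference i ^^ m) (gaussian 1 (\<chi> j. \<i> * of_real L))"

text \<open>At the frequencies \<open>freq k\<close>, odd multiples of \<open>\<pi>\<close>, the factor \<open>1 - cos\<close> peaks, and the transform
  recentred there is \<open>wave_profile\<close>, independent of \<open>k\<close>.\<close>

definition wave_profile :: "nat \<Rightarrow> 'n::finite \<Rightarrow> real^'n \<Rightarrow> real" where
  "wave_profile m i u = sqrt (2 * pi) ^ CARD('n) * (1 + cos (u $ i)) ^ m * exp (- (norm u)\<^sup>2 / 2)"

definition freq :: "nat \<Rightarrow> real" where
  "freq k = real (2 * k + 1) * pi"

lemma wave_gauss_poly: "wave m i L \<in> gauss_poly"
  unfolding wave_def by (intro gauss_poly_second_difference gauss_poly.gaussian) simp

lemma fourier_wave: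
  fixes \<xi> :: "real^'n::finite"
  shows "fourier (wave m i L) \<xi> =
    of_real (sqrt (2 * pi) ^ CARD('n) * (1 - cos (\<xi> $ i)) ^ m * exp (- (norm (\<xi> - (\<chi> j. L)))\<^sup>2 / 2))"
  unfolding wave_def
  by (subst fourier_second_difference)
     (simp_all add: fourier_gaussian gauss_poly.gaussian del: real_sqrt_mult)

lemma fourier_wave_freq:
  "fourier (wave m i (freq k)) (u + (\<chi> j. freq k)) = of_real (wave_profile m i u)"
proof -
  have "cos (u $ i + freq k) = - cos (u $ i)"
    unfolding freq_def cos_add cos_npi sin_npi by simp
  then show ?thesis
    by (simp add: fourier_wave wave_profile_def del: real_sqrt_mult)
qed

lemma wave_profile_nonneg: "0 \<le> wave_profile m i u"
proof -
  have "0 \<le> 1 + cos (u $ i)" using cos_ge_minus_one[of "u $ i"] by linarith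
  then show ?thesis by (simp add: wave_profile_def)
qed

lemma wave_profile_le:
  "wave_profile m i (u::real^'n::finite) \<le> sqrt (2 * pi) ^ CARD('n) * 2 ^ m * exp (- (norm u)\<^sup>2 / 2)"
proof -
  have "0 \<le> 1 + cos (u $ i)" "1 + cos (u $ i) \<le> 2"
    using cos_ge_minus_one[of "u $ i"] cos_le_one[of "u $ i"] by linarith+
  then have "(1 + cos (u $ i)) ^ m \<le> 2 ^ m" by (intro power_mono)
  then show ?thesis
    unfolding wave_profile_def by (intro mult_right_mono mult_left_mono) auto
qed

lemma wave_profile_continuous: "continuous_on UNIV (wave_profile m i)"
  unfolding wave_profile_def[abs_def] by (intro continuous_intros) auto

lemma square_le_exp: "(norm u)\<^sup>2 \<le> exp 4 * exp (1 / 4 * (norm u)\<^sup>2)"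
proof -
  have "(norm u)\<^sup>2 \<le> (1 + norm u)\<^sup>2" by (intro power_mono) auto
  also have "\<dots> = (1 + norm u) powr 2"
    using norm_ge_zero[of u] by (simp add: powr_numeral add_nonneg_nonneg)
  also have "\<dots> \<le> exp (2\<^sup>2 / (4 * (1 / 4))) * exp (1 / 4 * (norm u)\<^sup>2)"
    by (intro one_plus_powr_le_exp_square) auto
  finally show ?thesis by simp
qed

lemma wave_profile_integrable:
  "integrable lborel (wave_profile m i)"
  "integrable lborel (\<lambda>u. (norm u)\<^sup>2 * wave_profile m (i::'n::finite) u)"
proof -
  have [measurable]: "wave_profile m i \<in> borel_measurable borel"
    by (intro borel_measurable_continuous_onI wave_profile_continuous)
  let ?C = "sqrt (2 * pi) ^ CARD('n) * 2 ^ m"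
  show "integrable lborel (wave_profile m i)"
  proof (rule Bochner_Integration.integrable_bound)
    show "integrable lborel (\<lambda>u::real^'n. ?C * exp (- (1 / 2) * (norm u)\<^sup>2))"
      by (intro integrable_mult_right integrable_exp_neg_norm_square) simp
    show "AE u in lborel. norm (wave_profile m i u) \<le> norm (?C * exp (- (1 / 2) * (norm u)\<^sup>2))"
      using wave_profile_le[of m i] wave_profile_nonneg[of m i] by (simp add: abs_mult)
  qed measurable
  show "integrable lborel (\<lambda>u. (norm u)\<^sup>2 * wave_profile m i u)"
  proof (rule Bochner_Integration.integrable_bound)
    show "integrable lborel (\<lambda>u::real^'n. (exp 4 * ?C) * exp (- (1 / 4) * (norm u)\<^sup>2))"
      by (intro integrable_mult_right integrable_exp_neg_norm_square) simp
    show "AE u in lborel. norm ((norm u)\<^sup>2 * wave_profile m i u) \<le> norm ((exp 4 * ?C) * exp (- (1 / 4) * (norm u)\<^sup>2))"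
    proof (intro AE_I2)
      fix u :: "real^'n"
      have "(norm u)\<^sup>2 * wave_profile m i u \<le> (exp 4 * exp (1 / 4 * (norm u)\<^sup>2)) * (?C * exp (- (norm u)\<^sup>2 / 2))"
        by (intro mult_mono square_le_exp wave_profile_le wave_profile_nonneg) auto
      also have "\<dots> = (exp 4 * ?C) * exp (- (1 / 4) * (norm u)\<^sup>2)"
        by (simp add: mult.assoc mult.left_commute[of "exp _"] flip: exp_add)
      finally show "norm ((norm u)\<^sup>2 * wave_profile m i u) \<le> norm ((exp 4 * ?C) * exp (- (1 / 4) * (norm u)\<^sup>2))"
        using wave_profile_nonneg[of m i u] by (simp add: abs_mult)
    qed
  qed measurable
qed

text \<open>If the integral vanished, the continuous nonnegative profile would be zero on a closed
  set of full measure, hence everywhere; but at the origin it is positive, the factor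
  \<open>1 + cos\<close> being 2 there.\<close>

lemma wave_profile_integral_pos: "0 < (LINT u|lborel. wave_profile m i u)"
proof -
  have "(LINT u|lborel. wave_profile m i u) \<noteq> 0"
  proof
    assume "(LINT u|lborel. wave_profile m i u) = 0"
    then have "AE u in lborel. wave_profile m i u = 0"
      using integral_nonneg_eq_0_iff_AE[OF wave_profile_integrable(1)[of m i]] wave_profile_nonneg by auto
    then have "AE u in lebesgue. u \<in> {u. wave_profile m i u = 0}"
      by (simp add: AE_completion)
    moreover have "closed {u. wave_profile m i u = 0}"
      by (intro closed_Collect_eq wave_profile_continuous continuous_intros)
    ultimately have "0 \<in> {u. wave_profile m i u = 0}"
      using mem_closed_if_AE_lebesgue by blast
    then show False by (simp add: wave_profile_def)
  qed
  then show ?thesis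
    using Bochner_Integration.integral_nonneg[of lborel "wave_profile m i"] wave_profile_nonneg[of m i]
    by (simp add: order_less_le)
qed

lemma fourier_wave_integrable: "integrable lborel (fourier (wave m i (freq k)))"
proof -
  have "integrable lborel (\<lambda>u. complex_of_real (wave_profile m i u))"
    using wave_profile_integrable(1)[of m i] by simp
  from integrable_affine[OF this, of 1 "- (\<chi> j. freq k)"]
  have "integrable lborel (\<lambda>u. complex_of_real (wave_profile m i (- (\<chi> j. freq k) + u)))" by simp
  also have "(\<lambda>u. complex_of_real (wave_profile m i (- (\<chi> j. freq k) + u))) = fourier (wave m i (freq k))"
    using fourier_wave_freq[of m i k "- (\<chi> j. freq k) + \<xi>" for \<xi>] by (simp add: fun_eq_iff)
  finally show ?thesis .
qed

lemma freq_ge: "real k \<le> freq k" "1 \<le> freq k"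
proof -
  have "real (2 * k + 1) * 1 \<le> freq k"
    unfolding freq_def using pi_gt3 by (intro mult_left_mono) auto
  then show "real k \<le> freq k" "1 \<le> freq k" by simp_all
qed

text \<open>The moments \<open>I0\<close> and \<open>I2\<close> belong to the profile and do not
  involve \<open>k\<close>, so one \<open>\<epsilon>\<close> and one \<open>c\<close> serve all
  large \<open>k\<close>. The choice of \<open>\<epsilon>\<close> makes the error at most half of
  \<open>I0\<close>; the added 1 guards against division by zero.\<close>

lemma wave_lower_bound:
  fixes a :: "real^'n::finite"
  assumes a: "\<And>j. 1 < a $ j"
  shows "\<exists>\<epsilon> c k0. 0 < \<epsilon> \<and> 0 < c \<and> (\<forall>k\<ge>k0. \<forall>x. (\<forall>j. \<bar>x $ j\<bar> \<le> \<epsilon> * freq k) \<longrightarrow>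
     (\<exists>t. c \<le> norm (S_op a t (wave m i (freq k)) x)))"
proof -
  define I0 where "I0 = (LINT u|lborel. wave_profile m i u)"
  define I2 where "I2 = (LINT u|lborel. (norm u)\<^sup>2 * wave_profile m i u)"
  define K where "K = (\<Sum>j\<in>UNIV. (a $ j - 1) * 2 powr \<bar>a $ j - 2\<bar>)"
  define \<epsilon> where "\<epsilon> = I0 / (2 * K * (I2 + 1))"
  have I0: "0 < I0" unfolding I0_def by (rule wave_profile_integral_pos)
  have I2: "0 \<le> I2" unfolding I2_def by (intro Bochner_Integration.integral_nonneg mult_nonneg_nonneg wave_profile_nonneg) auto
  have pos: "0 < (a $ j - 1) * 2 powr \<bar>a $ j - 2\<bar>" for j using a[of j] by simp
  have K: "0 < K" unfolding K_def using pos by (intro sum_pos) auto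
  have Kj: "(a $ j - 1) * 2 powr \<bar>a $ j - 2\<bar> \<le> K" for j
    unfolding K_def using pos by (intro member_le_sum) (auto intro: less_imp_le)
  have \<epsilon>: "0 < \<epsilon>" unfolding \<epsilon>_def using I0 I2 K by (intro divide_pos_pos mult_pos_pos) auto
  have "K * \<epsilon> * I2 = I0 / 2 * (I2 / (I2 + 1))"
    unfolding \<epsilon>_def using K by simp
  also have "\<dots> \<le> I0 / 2 * 1"
    using I0 I2 by (intro mult_left_mono) auto
  finally have c: "I0 / 2 \<le> I0 - K * \<epsilon> * I2" by simp
  \<comment> \<open>Far frequencies demand \<open>8 / (freq k)\<^sup>2 \<le> K * \<epsilon>\<close>;
    since \<open>freq k\<close> is at least 1, a bound on its first power is enough.\<close>
  obtain k0 :: nat where k0: "8 / (K * \<epsilon>) \<le> real k0"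
    using real_arch_simple by blast
  have "\<exists>t. I0 / 2 \<le> norm (S_op a t (wave m i (freq k)) x)"
    if k: "k \<ge> k0" and x: "\<And>j. \<bar>x $ j\<bar> \<le> \<epsilon> * freq k" for k x
  proof -
    have "8 / (K * \<epsilon>) \<le> freq k" using k0 k freq_ge(1)[of k] by linarith
    also have "\<dots> \<le> (freq k)\<^sup>2" using freq_ge(2)[of k] by (simp add: power2_eq_square)
    finally have "8 / (freq k)\<^sup>2 \<le> K * \<epsilon>"
      using K \<epsilon> freq_ge(2)[of k] by (simp add: field_simps)
    from S_op_stationary_lower_bound[OF a _ fourier_wave_integrable fourier_wave_freq wave_profile_nonneg
        wave_profile_integrable(2) Kj x this]
    have "\<exists>t. I0 - K * \<epsilon> * I2 \<le> norm (S_op a t (wave m i (freq k)) x)"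
      unfolding I0_def I2_def using freq_ge(2)[of k] by simp
    then show ?thesis using c order_trans by blast
  qed
  then show ?thesis using \<epsilon> I0
    by (intro exI[of _ \<epsilon>] exI[of _ "I0 / 2"] exI[of _ k0]) auto
qed

text \<open>A Peetre-type inequality: moving the weight from \<open>\<xi>\<close> to the centre of
  the packet costs a power of \<open>1 + norm u\<close>. For \<open>s \<ge> 0\<close> this is the
  triangle inequality. For \<open>s < 0\<close> the weight is singular at the origin, and the zeros
  of \<open>1 - cos\<close> pay for it.\<close>

lemma sobolev_weight_bound:
  fixes \<xi> :: "real^'n::finite" and L s :: real
  assumes m: "\<bar>s\<bar> \<le> real m" and L: "1 \<le> L"
  shows "norm \<xi> powr (2 * s) * (1 - cos (\<xi> $ i)) ^ (2 * m) \<le>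
     4 ^ m * sqrt (real CARD('n)) powr (2 * \<bar>s\<bar>) * L powr (2 * s) * (1 + norm (\<xi> - (\<chi> j. L))) powr (2 * \<bar>s\<bar>)"
proof (cases "\<xi> = 0")
  case True
  then show ?thesis by simp
next
  case False
  define d where "d = sqrt (real CARD('n))"
  define u where "u = \<xi> - (\<chi> j. L)"
  define \<mu> where "\<mu> = 1 - cos (\<xi> $ i)"
  have d: "1 \<le> d" unfolding d_def by simp
  have nL: "norm (\<chi> j::'n. L) = d * L"
    using L by (simp add: norm_vec_def L2_set_def d_def real_sqrt_mult)
  have \<mu>: "0 \<le> \<mu>" "\<mu> \<le> 2"
    unfolding \<mu>_def using cos_ge_minus_one[of "\<xi> $ i"] cos_le_one[of "\<xi> $ i"] by linarith+
  have n0: "0 < norm \<xi>" using False by simp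
  show ?thesis
    unfolding d_def[symmetric] u_def[symmetric] \<mu>_def[symmetric]
  proof (cases "0 \<le> s")
    case True
    have "norm \<xi> \<le> norm u + d * L"
      unfolding nL[symmetric] u_def using norm_triangle_ineq[of "\<xi> - (\<chi> j. L)" "\<chi> j. L"] by simp
    also have "\<dots> \<le> norm u * (d * L) + d * L"
      using d L mult_mono[of 1 d 1 L] by (simp add: mult_le_cancel_left1)
    finally have "norm \<xi> \<le> d * L * (1 + norm u)" by (simp add: algebra_simps)
    then have "norm \<xi> powr (2 * s) \<le> (d * L * (1 + norm u)) powr (2 * s)"
      using True by (intro powr_mono2) auto
    also have "\<dots> = d powr (2 * s) * L powr (2 * s) * (1 + norm u) powr (2 * s)"
      using d L by (simp add: powr_mult)
    finally have "norm \<xi> powr (2 * s) * \<mu> ^ (2 * m) \<le> (d powr (2 * s) * L powr (2 * s) * (1 + norm u) powr (2 * s)) * 2 ^ (2 * m)"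
      using \<mu> by (intro mult_mono power_mono) auto
    then show "norm \<xi> powr (2 * s) * \<mu> ^ (2 * m) \<le> 4 ^ m * d powr (2 * \<bar>s\<bar>) * L powr (2 * s) * (1 + norm u) powr (2 * \<bar>s\<bar>)"
      using True power_mult[of "2::real" 2 m] by (simp add: mult_ac)
  next
    case False
    \<comment> \<open>Truncation at 1 has two uses: powers of \<open>\<rho>\<close> decrease with
      the exponent, so \<open>2 * m\<close> may be lowered to \<open>2 * \<bar>s\<bar>\<close>; and
      \<open>\<rho> \<le> 1\<close>, \<open>\<rho> \<le> norm \<xi>\<close> together give
      \<open>\<rho> * L \<le> norm \<xi> * (1 + norm u)\<close>.\<close>
    define \<rho> where "\<rho> = min 1 (norm \<xi>)"
    have \<rho>: "0 < \<rho>" "\<rho> \<le> 1" "\<rho> \<le> norm \<xi>" using n0 by (auto simp: \<rho>_def)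
    have "\<mu> \<le> 2 * \<rho>"
    proof (cases "norm \<xi> \<le> 1")
      case True
      have "\<mu> = 2 * (sin (\<xi> $ i / 2))\<^sup>2"
        unfolding \<mu>_def using cos_double_sin[of "\<xi> $ i / 2"] by simp
      also have "\<dots> \<le> 2 * \<bar>sin (\<xi> $ i / 2)\<bar>"
        using mult_left_le[OF abs_sin_le_one[of "\<xi> $ i / 2"] abs_ge_zero[of "sin (\<xi> $ i / 2)"]]
        by (simp only: power2_abs[symmetric, of "sin _"] power2_eq_square)
      also have "\<dots> \<le> 2 * norm \<xi>"
        using abs_sin_x_le_abs_x[of "\<xi> $ i / 2"] component_le_norm_cart[of \<xi> i] by simp
      finally show ?thesis using True by (simp add: \<rho>_def)
    next
      case False
      then show ?thesis using \<mu> by (simp add: \<rho>_def)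
    qed
    then have "\<mu> ^ (2 * m) \<le> (2 * \<rho>) ^ (2 * m)" using \<mu> by (intro power_mono)
    also have "\<dots> = 4 ^ m * \<rho> powr (real (2 * m))"
      using \<rho> by (subst powr_realpow) (simp_all add: power_mult power_mult_distrib)
    also have "\<dots> \<le> 4 ^ m * \<rho> powr (2 * \<bar>s\<bar>)"
      using \<rho> m by (intro mult_left_mono powr_mono') auto
    finally have 1: "\<mu> ^ (2 * m) \<le> 4 ^ m * \<rho> powr (2 * \<bar>s\<bar>)" .
    have "d * L \<le> norm \<xi> + norm u"
      unfolding nL[symmetric] u_def using norm_triangle_ineq4[of \<xi> "\<xi> - (\<chi> j. L)"] by simp
    then have "L \<le> norm \<xi> + norm u"
      using d L mult_right_mono[of 1 d L] by linarith
    then have "\<rho> * L \<le> \<rho> * norm \<xi> + \<rho> * norm u"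
      using \<rho> by (simp add: distrib_left[symmetric])
    also have "\<dots> \<le> 1 * norm \<xi> + norm \<xi> * norm u"
      using \<rho> by (intro add_mono mult_right_mono) auto
    finally have "\<rho> * L / norm \<xi> \<le> 1 + norm u"
      using n0 by (simp add: pos_divide_le_eq algebra_simps)
    then have 2: "(\<rho> * L / norm \<xi>) powr (2 * \<bar>s\<bar>) \<le> (1 + norm u) powr (2 * \<bar>s\<bar>)"
      using \<rho> L n0 by (intro powr_mono2) auto
    have "norm \<xi> powr (2 * s) * \<mu> ^ (2 * m) \<le> norm \<xi> powr (2 * s) * (4 ^ m * \<rho> powr (2 * \<bar>s\<bar>))"
      by (intro mult_left_mono 1) auto
    also have "\<dots> = 4 ^ m * L powr (2 * s) * (\<rho> * L / norm \<xi>) powr (2 * \<bar>s\<bar>)"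
      using False \<rho> L n0 by (simp add: powr_divide powr_mult powr_minus field_simps)
    also have "\<dots> \<le> 4 ^ m * L powr (2 * s) * (1 + norm u) powr (2 * \<bar>s\<bar>)"
      by (intro mult_left_mono 2) auto
    also have "\<dots> \<le> 4 ^ m * d powr (2 * \<bar>s\<bar>) * L powr (2 * s) * (1 + norm u) powr (2 * \<bar>s\<bar>)"
      using d ge_one_powr_ge_zero[of d "2 * \<bar>s\<bar>"] by (intro mult_right_mono) auto
    finally show "norm \<xi> powr (2 * s) * \<mu> ^ (2 * m) \<le> 4 ^ m * d powr (2 * \<bar>s\<bar>) * L powr (2 * s) * (1 + norm u) powr (2 * \<bar>s\<bar>)" .
  qed
qed

lemma wave_sobolev_bound:
  assumes m: "\<bar>s\<bar> \<le> real m"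
  shows "\<exists>C>0. \<forall>k. (\<integral>\<^sup>+\<xi>. ennreal (norm \<xi> powr (2 * s) * (norm (fourier (wave m (i::'n::finite) (freq k)) \<xi>))\<^sup>2) \<partial>lborel)
     \<le> ennreal (C * freq k powr (2 * s))"
proof -
  define \<kappa> where "\<kappa> = sqrt (2 * pi) ^ CARD('n)"
  define d where "d = sqrt (real CARD('n))"
  define A where "A = \<kappa>\<^sup>2 * (4 ^ m * d powr (2 * \<bar>s\<bar>)) * exp ((2 * \<bar>s\<bar>)\<^sup>2 / (4 * (1 / 2)))"
  define J where "J = (LINT u::(real^'n)|lborel. exp (- (1 / 2) * (norm u)\<^sup>2))"
  have A: "0 \<le> A" unfolding A_def by simp
  have iJ: "integrable lborel (\<lambda>u::real^'n. exp (- (1 / 2) * (norm u)\<^sup>2))"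
    by (rule integrable_exp_neg_norm_square) simp
  have J: "0 \<le> J" unfolding J_def by (intro Bochner_Integration.integral_nonneg) auto
  \<comment> \<open>The summand 1 merely makes the constant strictly positive when only
    \<open>0 \<le> A * J\<close> is known.\<close>
  have "(\<integral>\<^sup>+\<xi>. ennreal (norm \<xi> powr (2 * s) * (norm (fourier (wave m i (freq k)) \<xi>))\<^sup>2) \<partial>lborel)
     \<le> ennreal ((A * J + 1) * freq k powr (2 * s))" for k
  proof -
    let ?L = "freq k"
    let ?w = "(\<chi> j. ?L) :: real^'n"
    have pt: "norm \<xi> powr (2 * s) * (norm (fourier (wave m i ?L) \<xi>))\<^sup>2 \<le>
       A * ?L powr (2 * s) * exp (- (1 / 2) * (norm (\<xi> - ?w))\<^sup>2)" for \<xi>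
    proof -
      define u where "u = \<xi> - ?w"
      have "0 \<le> 1 - cos (\<xi> $ i)" using cos_le_one[of "\<xi> $ i"] by linarith
      then have nf: "norm (fourier (wave m i ?L) \<xi>) = \<kappa> * (1 - cos (\<xi> $ i)) ^ m * exp (- (norm u)\<^sup>2 / 2)"
        unfolding fourier_wave norm_of_real \<kappa>_def u_def by (subst abs_of_nonneg) auto
      have "norm \<xi> powr (2 * s) * (norm (fourier (wave m i ?L) \<xi>))\<^sup>2 =
         (\<kappa>\<^sup>2 * exp (- (norm u)\<^sup>2)) * (norm \<xi> powr (2 * s) * (1 - cos (\<xi> $ i)) ^ (2 * m))"
      proof -
        have "(exp (- (norm u)\<^sup>2 / 2))\<^sup>2 = exp (- (norm u)\<^sup>2)"
          unfolding power2_eq_square[of "exp _"] exp_add[symmetric] by simp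
        then show ?thesis
          unfolding nf power_mult_distrib power_even_eq by (simp only: mult_ac)
      qed
      also have "\<dots> \<le> (\<kappa>\<^sup>2 * exp (- (norm u)\<^sup>2)) *
         (4 ^ m * d powr (2 * \<bar>s\<bar>) * ?L powr (2 * s) * (1 + norm u) powr (2 * \<bar>s\<bar>))"
        unfolding d_def u_def by (intro mult_left_mono sobolev_weight_bound m freq_ge) auto
      also have "\<dots> \<le> (\<kappa>\<^sup>2 * exp (- (norm u)\<^sup>2)) *
         (4 ^ m * d powr (2 * \<bar>s\<bar>) * ?L powr (2 * s) * (exp ((2 * \<bar>s\<bar>)\<^sup>2 / (4 * (1 / 2))) * exp (1 / 2 * (norm u)\<^sup>2)))"
        by (intro mult_left_mono one_plus_powr_le_exp_square) auto
      also have "\<dots> = A * ?L powr (2 * s) * (exp (- (norm u)\<^sup>2) * exp (1 / 2 * (norm u)\<^sup>2))"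
        unfolding A_def by (simp only: mult_ac)
      also have "exp (- (norm u)\<^sup>2) * exp (1 / 2 * (norm u)\<^sup>2) = exp (- (1 / 2) * (norm u)\<^sup>2)"
        by (simp flip: exp_add)
      finally show ?thesis unfolding u_def .
    qed
    have "(\<integral>\<^sup>+\<xi>. ennreal (norm \<xi> powr (2 * s) * (norm (fourier (wave m i ?L) \<xi>))\<^sup>2) \<partial>lborel)
       \<le> (\<integral>\<^sup>+\<xi>. ennreal (A * ?L powr (2 * s)) * ennreal (exp (- (1 / 2) * (norm (\<xi> - ?w))\<^sup>2)) \<partial>lborel)"
      using pt A by (intro nn_integral_mono) (simp add: ennreal_mult[symmetric] ennreal_leI)
    also have "\<dots> = ennreal (A * ?L powr (2 * s)) * (\<integral>\<^sup>+\<xi>. ennreal (exp (- (1 / 2) * (norm (\<xi> - ?w))\<^sup>2)) \<partial>lborel)"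
      by (intro nn_integral_cmult) measurable
    also have "(\<integral>\<^sup>+\<xi>. ennreal (exp (- (1 / 2) * (norm (\<xi> - ?w))\<^sup>2)) \<partial>lborel) =
        (\<integral>\<^sup>+\<xi>. ennreal (exp (- (1 / 2) * (norm (\<xi>::real^'n))\<^sup>2)) \<partial>lborel)"
      by (subst nn_integral_affine[of _ 1 ?w]) (simp_all add: algebra_simps)
    also have "\<dots> = ennreal J"
      unfolding J_def by (intro nn_integral_eq_integral iJ) auto
    also have "ennreal (A * ?L powr (2 * s)) * ennreal J = ennreal (A * J * ?L powr (2 * s))"
      using A J by (simp add: ennreal_mult[symmetric] mult_ac)
    also have "\<dots> \<le> ennreal ((A * J + 1) * ?L powr (2 * s))"
      by (intro ennreal_leI mult_right_mono) auto
    finally show ?thesis .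
  qed
  moreover have "0 < A * J + 1" using A J by (simp add: add_nonneg_pos)
  ultimately show ?thesis by blast
qed

section \<open>Dilations and comparison of exponents\<close>

lemma fourier_measurable:
  assumes [measurable]: "f \<in> borel_measurable borel"
  shows "fourier f \<in> borel_measurable borel"
  unfolding fourier_def[abs_def] by measurable

text \<open>The exponent collects \<open>2 * s\<close> from the weight, \<open>- 2 * n\<close> from
  the square of the dilated transform and \<open>n\<close> from the substitution.\<close>

lemma sobolev_dilate:
  fixes f :: "real^'n::finite \<Rightarrow> complex"
  assumes f: "integrable lborel f" and l: "0 < l"
  shows "(\<integral>\<^sup>+\<xi>. ennreal (norm \<xi> powr (2 * s) * (norm (fourier (\<lambda>x. f (l *\<^sub>R x)) \<xi>))\<^sup>2) \<partial>lborel) =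
     ennreal (l powr (2 * s - real CARD('n))) *
     (\<integral>\<^sup>+\<xi>. ennreal (norm \<xi> powr (2 * s) * (norm (fourier f \<xi>))\<^sup>2) \<partial>lborel)"
proof -
  have [measurable]: "f \<in> borel_measurable borel"
    using borel_measurable_integrable[OF f] by simp
  have [measurable]: "fourier f \<in> borel_measurable borel"
    by (rule fourier_measurable) measurable
  let ?F = "fourier (\<lambda>x. f (l *\<^sub>R x))"
  have [measurable]: "?F \<in> borel_measurable borel"
    by (rule fourier_measurable) measurable
  have F: "?F (l *\<^sub>R \<xi>) = of_real (1 / l ^ CARD('n)) * fourier f \<xi>" for \<xi>
    using fourier_dilate[OF f l, of "l *\<^sub>R \<xi>"] l by simp
  have "(\<integral>\<^sup>+\<xi>. ennreal (norm \<xi> powr (2 * s) * (norm (?F \<xi>))\<^sup>2) \<partial>lborel)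
     = ennreal (l ^ CARD('n)) * (\<integral>\<^sup>+\<xi>. ennreal (norm (l *\<^sub>R \<xi>) powr (2 * s) * (norm (?F (l *\<^sub>R \<xi>)))\<^sup>2) \<partial>lborel)"
    using l by (subst nn_integral_affine[of _ l 0]) simp_all
  also have "\<dots> = ennreal (l ^ CARD('n)) * (\<integral>\<^sup>+\<xi>. ennreal (l powr (2 * s) / (l ^ CARD('n))\<^sup>2) *
     ennreal (norm \<xi> powr (2 * s) * (norm (fourier f \<xi>))\<^sup>2) \<partial>lborel)"
  proof (intro arg_cong[of _ _ "(*) _"] nn_integral_cong)
    fix \<xi> :: "real^'n"
    have "norm (l *\<^sub>R \<xi>) powr (2 * s) * (norm (?F (l *\<^sub>R \<xi>)))\<^sup>2 =
      (l powr (2 * s) / (l ^ CARD('n))\<^sup>2) * (norm \<xi> powr (2 * s) * (norm (fourier f \<xi>))\<^sup>2)"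
      unfolding F using l by (simp add: norm_mult norm_divide powr_mult power_mult_distrib power_divide norm_power)
    then show "ennreal (norm (l *\<^sub>R \<xi>) powr (2 * s) * (norm (?F (l *\<^sub>R \<xi>)))\<^sup>2) =
      ennreal (l powr (2 * s) / (l ^ CARD('n))\<^sup>2) * ennreal (norm \<xi> powr (2 * s) * (norm (fourier f \<xi>))\<^sup>2)"
      by (simp only:) (rule ennreal_mult; simp)
  qed
  also have "\<dots> = ennreal (l ^ CARD('n) * (l powr (2 * s) / (l ^ CARD('n))\<^sup>2)) *
      (\<integral>\<^sup>+\<xi>. ennreal (norm \<xi> powr (2 * s) * (norm (fourier f \<xi>))\<^sup>2) \<partial>lborel)"
  proof -
    have "ennreal (l ^ CARD('n) * (l powr (2 * s) / (l ^ CARD('n))\<^sup>2)) =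
       ennreal (l ^ CARD('n)) * ennreal (l powr (2 * s) / (l ^ CARD('n))\<^sup>2)"
      using l by (intro ennreal_mult) auto
    then show ?thesis
      by (simp only: mult.assoc) (subst nn_integral_cmult, measurable)
  qed
  also have "l ^ CARD('n) * (l powr (2 * s) / (l ^ CARD('n))\<^sup>2) = l powr (2 * s - real CARD('n))"
    using l by (simp add: powr_diff powr_realpow power2_eq_square)
  finally show ?thesis .
qed

text \<open>A nonzero power takes arbitrarily small values on the positive reals, whichever its
  sign; the witness \<open>y powr (1 / e)\<close> makes the right side \<open>D / 2\<close>.\<close>

lemma powr_exponent_zero:
  fixes A D e :: real
  assumes D: "0 < D" and A: "0 < A" and le: "\<And>l. 0 < l \<Longrightarrow> D \<le> A * l powr e"
  shows "e = 0"
proof (rule ccontr)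
  assume e: "e \<noteq> 0"
  define y where "y = D / (2 * A)"
  have y: "0 < y" using A D by (simp add: y_def)
  have "D \<le> A * (y powr (1 / e)) powr e" using y by (intro le) simp
  also have "\<dots> = A * y" using e y by (simp add: powr_powr)
  also have "\<dots> = D / 2" using A by (simp add: y_def)
  finally show False using D by simp
qed

lemma powr_exponent_nonneg:
  fixes A D e :: real
  assumes D: "0 < D" and le: "\<And>k. k \<ge> k0 \<Longrightarrow> D \<le> A * freq k powr e"
  shows "0 \<le> e"
proof (rule ccontr)
  assume "\<not> 0 \<le> e"
  then have e: "e < 0" by simp
  have "filterlim freq at_top sequentially"
    by (rule filterlim_at_top_mono[OF filterlim_real_sequentially]) (intro always_eventually allI freq_ge)
  then have "(\<lambda>k. A * freq k powr e) \<longlonglongrightarrow> A * 0"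
    by (intro tendsto_intros tendsto_neg_powr e)
  then have "eventually (\<lambda>k. A * freq k powr e < D) sequentially"
    using D by (intro order_tendstoD) auto
  moreover have "eventually (\<lambda>k. k \<ge> k0) sequentially" by (rule eventually_ge_at_top)
  ultimately have "eventually (\<lambda>k::nat. False) sequentially"
    by eventually_elim (use le in force)
  then show False by simp
qed

text \<open>A dilated packet gives an inequality with two free parameters, \<open>D \<le> A * l powr
  (s - n / 2 + n * r) * freq k powr (s - n * r)\<close>. For fixed \<open>k\<close> the exponent of
  \<open>l\<close> must vanish; for \<open>l = 1\<close> and \<open>k\<close> tending to infinity
  the other exponent cannot be negative. With \<open>q = \<infinity>\<close> one has
  \<open>r = 0\<close> and nothing is excluded yet.\<close>

lemma maximal_estimate_scaling:
  fixes a :: "real^'n::finite" and q :: ennreal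
  assumes a: "\<And>j. 1 < a $ j" and q: "1 \<le> q" and C0: "0 < C0"
    and bound: "\<And>f. f \<in> schwartz \<Longrightarrow> Lq_norm q (maximal a f) \<le> ennreal C0 * sobolev_norm s f"
  defines "r \<equiv> 1 / enn2real q" and "n \<equiv> real CARD('n)"
  shows "s = n * (1 / 2 - r)" "n * r \<le> s"
proof -
  obtain m :: nat where m: "\<bar>s\<bar> \<le> real m" using real_arch_simple by blast
  fix i :: 'n
  obtain \<epsilon> c k0 where \<epsilon>: "0 < \<epsilon>" and c: "0 < c" and
    low: "\<And>k x. k \<ge> k0 \<Longrightarrow> (\<And>j. \<bar>x $ j\<bar> \<le> \<epsilon> * freq k) \<Longrightarrow> \<exists>t. c \<le> norm (S_op a t (wave m i (freq k)) x)"
    using wave_lower_bound[OF a, of m i] by blast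
  obtain C where C: "0 < C" and up: "\<And>k. (\<integral>\<^sup>+\<xi>. ennreal (norm \<xi> powr (2 * s) * (norm (fourier (wave m i (freq k)) \<xi>))\<^sup>2) \<partial>lborel)
     \<le> ennreal (C * freq k powr (2 * s))"
    using wave_sobolev_bound[OF m, of i] by blast
  define D where "D = c * (2 * \<epsilon>) powr (n * r)"
  define A where "A = C0 * C powr (1 / 2)"
  have D: "0 < D" unfolding D_def using c \<epsilon> by simp
  have A: "0 < A" unfolding A_def using C0 C by simp
  have r: "0 \<le> r" by (simp add: r_def)
  have main: "D \<le> A * l powr (s - n / 2 + n * r) * freq k powr (s - n * r)" if k: "k \<ge> k0" and l: "0 < l" for k l
  proof -
    let ?L = "freq k"
    define f where "f = wave m i ?L"
    define g where "g = (\<lambda>x. f (l *\<^sub>R x))"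
    \<comment> \<open>The preimage under dilation by \<open>l\<close> of the cube on which the
      undilated packet is large.\<close>
    define B where "B = cbox (\<chi> j. - (\<epsilon> * ?L / l)) (\<chi> j::'n. \<epsilon> * ?L / l)"
    define V where "V = (2 * \<epsilon> * ?L / l) powr n"
    have L: "1 \<le> ?L" by (rule freq_ge)
    have fg: "f \<in> gauss_poly" "g \<in> gauss_poly"
      unfolding f_def g_def using l by (auto intro!: wave_gauss_poly gauss_poly_dilate)
    have fi: "integrable lborel f" by (rule gauss_poly_integrable[OF fg(1)])
    have V: "0 < V" unfolding V_def using \<epsilon> L l by simp
    have "emeasure lborel B = ennreal (\<Prod>b\<in>Basis. ((\<chi> j. \<epsilon> * ?L / l) - (\<chi> j::'n. - (\<epsilon> * ?L / l))) \<bullet> b)"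
      unfolding B_def using \<epsilon> L l by (intro emeasure_lborel_cbox) (auto simp: Basis_vec_def inner_axis)
    also have "(\<Prod>b\<in>Basis. ((\<chi> j. \<epsilon> * ?L / l) - (\<chi> j::'n. - (\<epsilon> * ?L / l))) \<bullet> b) = (\<Prod>b\<in>(Basis::(real^'n) set). 2 * \<epsilon> * ?L / l)"
      by (intro prod.cong) (auto simp: Basis_vec_def inner_axis)
    also have "\<dots> = V"
      using \<epsilon> L l by (simp add: V_def n_def powr_realpow)
    finally have emB: "emeasure lborel B = ennreal V" .
    have "ennreal c \<le> maximal a g x" if x: "x \<in> B" for x
    proof -
      have "\<bar>x $ j\<bar> \<le> \<epsilon> * ?L / l" for j
        using x unfolding B_def mem_box_cart by (auto simp: abs_le_iff) (metis minus_le_iff)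
      then have "\<bar>(l *\<^sub>R x) $ j\<bar> \<le> \<epsilon> * ?L" for j
        using l by (simp add: abs_mult field_simps)
      then obtain t where t: "c \<le> norm (S_op a t f (l *\<^sub>R x))"
        using low[OF k] unfolding f_def by blast
      also have "S_op a t f (l *\<^sub>R x) = S_op a (\<chi> j. t $ j * l powr (- (a $ j))) g x"
        unfolding g_def
        by (rule S_op_dilate[symmetric]) (use fi l in \<open>auto simp: f_def fourier_wave_integrable\<close>)
      finally have "ennreal c \<le> ennreal (norm (S_op a (\<chi> j. t $ j * l powr (- (a $ j))) g x))"
        by (rule ennreal_leI)
      also have "\<dots> \<le> maximal a g x"
        unfolding maximal_def by (rule SUP_upper) simp
      finally show ?thesis .
    qed
    then have "ennreal (c * V powr r) \<le> Lq_norm q (maximal a g)"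
      unfolding r_def using q emB V c by (intro Lq_norm_lower_bound[where B=B]) (auto simp: B_def)
    also have "\<dots> \<le> ennreal C0 * sobolev_norm s g"
      by (intro bound gauss_poly_schwartz fg)
    also have "sobolev_norm s g \<le> ennreal ((C * l powr (2 * s - n) * ?L powr (2 * s)) powr (1 / 2))"
    proof -
      have "(\<integral>\<^sup>+\<xi>. ennreal (norm \<xi> powr (2 * s) * (norm (fourier g \<xi>))\<^sup>2) \<partial>lborel)
         \<le> ennreal (l powr (2 * s - n)) * ennreal (C * ?L powr (2 * s))"
        unfolding g_def n_def sobolev_dilate[OF fi l] using up unfolding f_def by (intro mult_left_mono) auto
      also have "\<dots> = ennreal (C * l powr (2 * s - n) * ?L powr (2 * s))"
        using C by (simp add: ennreal_mult[symmetric] mult_ac)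
      finally have "sobolev_norm s g \<le> ennpowr (ennreal (C * l powr (2 * s - n) * ?L powr (2 * s))) (1 / 2)"
        unfolding sobolev_norm_def by (intro ennpowr_mono) auto
      then show ?thesis using C by simp
    qed
    finally have "ennreal (c * V powr r) \<le> ennreal (C0 * (C * l powr (2 * s - n) * ?L powr (2 * s)) powr (1 / 2))"
      using C0 by (simp add: ennreal_mult mult_left_mono)
    then have "c * V powr r \<le> C0 * (C * l powr (2 * s - n) * ?L powr (2 * s)) powr (1 / 2)"
      using C0 by (subst (asm) ennreal_le_iff) auto
    moreover have "(C * l powr (2 * s - n) * ?L powr (2 * s)) powr (1 / 2) = C powr (1 / 2) * l powr (s - n / 2) * ?L powr s"
      using C l L by (simp add: powr_mult powr_powr diff_divide_distrib)
    moreover have "V powr r = (2 * \<epsilon>) powr (n * r) * (?L powr (n * r) * l powr (- (n * r)))"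
      unfolding V_def using \<epsilon> l L by (simp add: powr_powr powr_divide powr_mult powr_minus field_simps)
    ultimately have "D * (?L powr (n * r) * l powr (- (n * r))) \<le> A * (l powr (s - n / 2) * ?L powr s)"
      unfolding D_def A_def by (simp add: mult_ac)
    then have "D * (?L powr (n * r) * l powr (- (n * r))) * (?L powr (- (n * r)) * l powr (n * r)) \<le>
       A * (l powr (s - n / 2) * ?L powr s) * (?L powr (- (n * r)) * l powr (n * r))"
      by (rule mult_right_mono) simp
    moreover have "D * (?L powr (n * r) * l powr (- (n * r))) * (?L powr (- (n * r)) * l powr (n * r)) = D"
      using l L by (simp add: powr_minus field_simps)
    moreover have "A * (l powr (s - n / 2) * ?L powr s) * (?L powr (- (n * r)) * l powr (n * r)) =
       A * l powr (s - n / 2 + n * r) * ?L powr (s - n * r)"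
      by (simp only: powr_add powr_diff powr_minus) (simp add: field_simps)
    ultimately show ?thesis by simp
  qed
  have "s - n / 2 + n * r = 0"
  proof (rule powr_exponent_zero[OF D])
    show "0 < A * freq k0 powr (s - n * r)" using A freq_ge(2)[of k0] by simp
  qed (use main[of k0] in \<open>simp add: mult_ac\<close>)
  then show "s = n * (1 / 2 - r)" by (simp add: algebra_simps)
  have "0 \<le> s - n * r"
    by (rule powr_exponent_nonneg[OF D, of k0 A]) (use main[of _ 1] in simp)
  then show "n * r \<le> s" by simp
qed

subsection \<open>Necessity: the endpoint \<open>q = \<infinity>\<close>\<close>

text \<open>Dominated convergence with majorant \<open>norm (F \<xi>)\<close>. Continuity in space
  turns a value at a point into a bound on a ball; continuity in time lets countably many times
  exhaust the supremum.\<close>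

lemma isCont_integral_multiplier:
  fixes W :: "'b::metric_space \<Rightarrow> 'a::euclidean_space \<Rightarrow> complex"
  assumes F: "integrable lborel F"
    and [measurable]: "\<And>y. W y \<in> borel_measurable borel"
    and W1: "\<And>y \<xi>. norm (W y \<xi>) \<le> 1" and cont: "\<And>\<xi>. isCont (\<lambda>y. W y \<xi>) y0"
  shows "isCont (\<lambda>y. LINT \<xi>|lborel. W y \<xi> * F \<xi>) y0"
  unfolding continuous_at_sequentially comp_def
proof (intro allI impI)
  fix Y :: "nat \<Rightarrow> 'b" assume Y: "Y \<longlonglongrightarrow> y0"
  have [measurable]: "F \<in> borel_measurable borel"
    using borel_measurable_integrable[OF F] by simp
  show "(\<lambda>n. LINT \<xi>|lborel. W (Y n) \<xi> * F \<xi>) \<longlonglongrightarrow> (LINT \<xi>|lborel. W y0 \<xi> * F \<xi>)"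
  proof (rule integral_dominated_convergence[where w="\<lambda>\<xi>. norm (F \<xi>)"])
    show "AE \<xi> in lborel. (\<lambda>n. W (Y n) \<xi> * F \<xi>) \<longlonglongrightarrow> W y0 \<xi> * F \<xi>"
      using isCont_tendsto_compose[OF cont Y] by (intro AE_I2 tendsto_intros)
    show "AE \<xi> in lborel. norm (W (Y n) \<xi> * F \<xi>) \<le> norm (F \<xi>)" for n
      using W1 by (intro AE_I2) (simp add: norm_mult mult_left_le_one_le)
  qed (use F in auto)
qed

lemma isCont_S_op_space:
  assumes "integrable lborel (fourier f)"
  shows "isCont (\<lambda>x. S_op a t f x) x0"
  unfolding S_op_def
  by (rule isCont_integral_multiplier[OF assms]) (auto simp: norm_mult intro!: continuous_intros)

text \<open>The second term on the left makes the induction close.\<close>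

lemma dyadic_sum_square_le:
  fixes g b :: "nat \<Rightarrow> real"
  assumes g: "\<And>k. 0 \<le> g k" "\<And>k. g k \<le> b k" and b: "\<And>k. b (Suc k) \<le> b k / 2"
  shows "(\<Sum>k<K. g k)\<^sup>2 + 4 * b K * (\<Sum>k<K. g k) \<le> 4 * (\<Sum>k<K. g k * b k)"
proof (induction K)
  case (Suc K)
  define S where "S = (\<Sum>k<K. g k)"
  have S: "0 \<le> S" unfolding S_def by (intro sum_nonneg g)
  have b0: "0 \<le> b K" using g order_trans by blast
  have "(S + g K)\<^sup>2 + 4 * b (Suc K) * (S + g K) \<le> (S + g K)\<^sup>2 + 2 * b K * (S + g K)"
    using b[of K] S g[of K] by (intro add_left_mono mult_right_mono) auto
  also have "\<dots> = S\<^sup>2 + (2 * S * g K + 2 * b K * S) + (g K * g K + 2 * b K * g K)"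
    by (simp add: power2_eq_square algebra_simps)
  also have "\<dots> \<le> S\<^sup>2 + (2 * S * b K + 2 * b K * S) + (b K * g K + 3 * b K * g K)"
    using g[of K] S b0 by (intro add_mono mult_left_mono mult_right_mono) auto
  also have "\<dots> = (S\<^sup>2 + 4 * b K * S) + 4 * (g K * b K)"
    by (simp add: algebra_simps)
  also have "\<dots> \<le> 4 * (\<Sum>k<K. g k * b k) + 4 * (g K * b K)"
    using Suc by (simp add: S_def)
  finally show ?case by (simp add: S_def)
qed simp

text \<open>A sum of \<open>K\<close> dyadic dilates of a Gaussian has size comparable to \<open>K\<close> at the origin, but norm only \<open>sqrt K\<close>.\<close>

lemma no_sup_norm_bound:
  fixes a :: "real^'n::finite"
  assumes C0: "0 < C0"
    and bound: "\<And>f. f \<in> schwartz \<Longrightarrow>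
      Lq_norm \<infinity> (maximal a f) \<le> ennreal C0 * sobolev_norm (real CARD('n) / 2) f"
  shows False
proof -
  define n where "n = CARD('n)"
  define \<kappa> where "\<kappa> = sqrt (2 * pi) ^ n"
  define G where "G = (\<lambda>\<xi>::real^'n. exp (- (1 / 2) * (norm \<xi>)\<^sup>2))"
  define g0 where "g0 = gaussian 1 ((\<chi> j. \<i> * of_real 0) :: complex^'n)"
  define I0 where "I0 = (LINT \<xi>|lborel. G \<xi>)"
  define J where "J = (LINT \<xi>|lborel. exp ((real n)\<^sup>2 / (4 * (1 / 4))) * exp (- (1 / 4) * (norm (\<xi>::real^'n))\<^sup>2))"
  have n: "1 \<le> n" unfolding n_def by (simp add: Suc_le_eq)
  have \<kappa>: "0 < \<kappa>" unfolding \<kappa>_def by simp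
  have g0: "g0 \<in> gauss_poly" unfolding g0_def by (rule gauss_poly.gaussian) simp
  have g0k: "(\<lambda>x. g0 (2 ^ k *\<^sub>R x)) \<in> gauss_poly" for k
    by (rule gauss_poly_dilate[OF g0]) simp
  have iG: "integrable lborel G"
    unfolding G_def by (rule integrable_exp_neg_norm_square) simp
  have [measurable]: "G \<in> borel_measurable borel" unfolding G_def by measurable
  have I0: "0 < I0"
    using wave_profile_integral_pos[of 0 "undefined::'n"] \<kappa>
    unfolding wave_profile_def I0_def G_def \<kappa>_def n_def by (simp add: zero_less_mult_iff)
  have J: "0 \<le> J" unfolding J_def by (intro Bochner_Integration.integral_nonneg) auto
  have F0: "fourier g0 \<xi> = of_real (\<kappa> * G \<xi>)" for \<xi>
  proof -
    have "(\<chi> j. 0) = (0 :: real^'n)" by (simp add: vec_eq_iff)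
    then show ?thesis
      unfolding g0_def fourier_gaussian \<kappa>_def G_def n_def by simp
  qed
  \<comment> \<open>Normalized so that every \<open>gk k\<close> has the same integral
    \<open>I0\<close>, while its maximum is \<open>1 / (2 ^ k) ^ n\<close>.\<close>
  define gk where "gk = (\<lambda>k \<xi>. G (\<xi> /\<^sub>R 2 ^ k) / (2 ^ k) ^ n)"
  have Fk: "fourier (\<lambda>x. g0 (2 ^ k *\<^sub>R x)) \<xi> = of_real (\<kappa> * gk k \<xi>)" for k \<xi>
    using fourier_dilate[OF gauss_poly_integrable[OF g0], of "2 ^ k" \<xi>]
    by (simp add: F0 gk_def n_def)
  have igk: "integrable lborel (gk k)" for k
    unfolding gk_def using integrable_affine[OF iG, of "inverse (2 ^ k)" 0] by simp
  have intgk: "(LINT \<xi>|lborel. gk k \<xi>) = I0" for k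
    unfolding gk_def I0_def
    using integral_affine[OF _ iG, of "inverse (2 ^ k)" 0] by (simp add: n_def power_inverse field_simps)
  have "real K * I0 / 2 \<le> 2 * C0 * sqrt (real K * J)" if K: "1 \<le> K" for K
  proof -
    define h where "h = (\<lambda>x. \<Sum>k<K. g0 (2 ^ k *\<^sub>R x))"
    have h: "h \<in> gauss_poly"
      unfolding h_def using K by (intro gauss_poly_sum g0k) (auto simp: lessThan_empty_iff)
    have Fh: "fourier h \<xi> = of_real (\<kappa> * (\<Sum>k<K. gk k \<xi>))" for \<xi>
      unfolding h_def by (subst fourier_sum) (auto intro!: gauss_poly_integrable g0k simp: Fk sum_distrib_left)
    have iFh: "integrable lborel (fourier h)"
    proof -
      have "integrable lborel (\<lambda>\<xi>. complex_of_real (\<kappa> * (\<Sum>k<K. gk k \<xi>)))"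
        using igk by (intro integrable_of_real integrable_mult_right Bochner_Integration.integrable_sum)
      then show ?thesis using Fh by (simp add: fun_eq_iff[of "fourier h"] cong: Bochner_Integration.integrable_cong)
    qed
    \<comment> \<open>At zero time and position all exponentials are 1 and the positive transforms
      of the \<open>K\<close> dilates add up coherently.\<close>
    have "S_op a 0 h 0 = (LINT \<xi>|lborel. complex_of_real (\<kappa> * (\<Sum>k<K. gk k \<xi>)))"
      unfolding S_op_def Fh by simp
    also have "\<dots> = of_real (\<kappa> * (real K * I0))"
      unfolding integral_complex_of_real using igk by (simp add: intgk)
    finally have S0: "norm (S_op a 0 h 0) = \<kappa> * real K * I0"
      using \<kappa> I0 by (simp add: norm_mult)
    have "0 < \<kappa> * real K * I0" using \<kappa> I0 K by simp
    then have "0 < \<kappa> * real K * I0 / 2" by simp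
    \<comment> \<open>A value at one point is invisible to the essential supremum; continuity keeps
      half of it on a ball of positive measure.\<close>
    moreover have "isCont (\<lambda>x. norm (S_op a 0 h x)) 0"
      by (intro continuous_norm isCont_S_op_space iFh)
    ultimately obtain \<delta> where \<delta>: "0 < \<delta>"
      "\<And>x. dist x 0 < \<delta> \<Longrightarrow> dist (norm (S_op a 0 h x)) (norm (S_op a 0 h 0)) < \<kappa> * real K * I0 / 2"
      unfolding continuous_at_eps_delta by blast
    have \<delta>2: "\<kappa> * real K * I0 / 2 < norm (S_op a 0 h x)" if "x \<in> ball 0 \<delta>" for x
    proof -
      have "dist x 0 < \<delta>" using that by simp
      from \<delta>(2)[OF this] show ?thesis using S0 unfolding dist_real_def by linarith
    qed
    have "ennreal (\<kappa> * real K * I0 / 2) \<le> maximal a h x" if "x \<in> ball 0 \<delta>" for x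
    proof -
      have "ennreal (\<kappa> * real K * I0 / 2) \<le> ennreal (norm (S_op a 0 h x))"
        using \<delta>2[OF that] by (intro ennreal_leI) simp
      also have "\<dots> \<le> maximal a h x" unfolding maximal_def by (rule SUP_upper) simp
      finally show ?thesis .
    qed
    moreover have "emeasure lborel (ball (0::real^'n) \<delta>) = ennreal (measure lborel (ball (0::real^'n) \<delta>))"
      using emeasure_lborel_ball_finite[of "0::real^'n" \<delta>] by (intro emeasure_eq_ennreal_measure) auto
    moreover have "0 < measure lborel (ball (0::real^'n) \<delta>)"
      using content_ball_pos[OF \<delta>(1), of "0::real^'n"] by simp
    ultimately have "ennreal (\<kappa> * real K * I0 / 2 * measure lborel (ball (0::real^'n) \<delta>) powr (1 / enn2real \<infinity>)) \<le> Lq_norm \<infinity> (maximal a h)"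
      using \<kappa> I0 by (intro Lq_norm_lower_bound[where B="ball 0 \<delta>"]) auto
    then have "ennreal (\<kappa> * real K * I0 / 2) \<le> Lq_norm \<infinity> (maximal a h)"
      using \<open>0 < measure lborel (ball (0::real^'n) \<delta>)\<close> by simp
    also have "\<dots> \<le> ennreal C0 * sobolev_norm (real n / 2) h"
      unfolding n_def by (intro bound gauss_poly_schwartz h)
    also have "sobolev_norm (real n / 2) h \<le> ennreal ((4 * \<kappa>\<^sup>2 * (real K * J)) powr (1 / 2))"
    proof -
      have pt: "norm \<xi> powr (2 * (real n / 2)) * (norm (fourier h \<xi>))\<^sup>2 \<le>
          (\<Sum>k<K. (4 * \<kappa>\<^sup>2) * (norm \<xi> ^ n * (gk k \<xi> / (2 ^ k) ^ n)))" for \<xi>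
      proof -
        have "(\<Sum>k<K. gk k \<xi>)\<^sup>2 + 4 * (1 / (2 ^ K) ^ n) * (\<Sum>k<K. gk k \<xi>) \<le> 4 * (\<Sum>k<K. gk k \<xi> * (1 / (2 ^ k) ^ n))"
        \<comment> \<open>This plays the role of almost orthogonality: the off-diagonal products are
          summed against the suprema \<open>b k = 1 / (2 ^ k) ^ n\<close>, which at least halve at
          each step because \<open>1 \<le> n\<close>.\<close>
        proof (rule dyadic_sum_square_le)
          show "0 \<le> gk k \<xi>" "gk k \<xi> \<le> 1 / (2 ^ k) ^ n" for k
            unfolding gk_def G_def by (auto intro!: divide_right_mono)
          have "(2::real) ^ 1 \<le> 2 ^ n" using n by (intro power_increasing) auto
          then show "1 / (2 ^ Suc k) ^ n \<le> (1 / (2 ^ k) ^ n :: real) / 2" for k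
            by (simp add: power_mult_distrib divide_simps)
        qed
        moreover have gk0: "0 \<le> (\<Sum>k<K. gk k \<xi>)"
          unfolding gk_def G_def by (intro sum_nonneg) auto
        moreover from gk0 have "0 \<le> 4 * (1 / (2 ^ K) ^ n) * (\<Sum>k<K. gk k \<xi>)"
          by (intro mult_nonneg_nonneg) auto
        ultimately have sq: "(\<Sum>k<K. gk k \<xi>)\<^sup>2 \<le> 4 * (\<Sum>k<K. gk k \<xi> * (1 / (2 ^ k) ^ n))"
          by linarith
        have "norm \<xi> powr (2 * (real n / 2)) * (norm (fourier h \<xi>))\<^sup>2 = norm \<xi> ^ n * (\<kappa>\<^sup>2 * (\<Sum>k<K. gk k \<xi>)\<^sup>2)"
          using n unfolding Fh norm_of_real power2_abs power_mult_distrib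
          by (cases "\<xi> = 0") (simp_all add: powr_realpow power_0_left)
        also have "\<dots> \<le> norm \<xi> ^ n * (\<kappa>\<^sup>2 * (4 * (\<Sum>k<K. gk k \<xi> * (1 / (2 ^ k) ^ n))))"
          using sq by (intro mult_left_mono) auto
        also have "\<dots> = (\<Sum>k<K. (4 * \<kappa>\<^sup>2) * (norm \<xi> ^ n * (gk k \<xi> / (2 ^ k) ^ n)))"
          by (simp add: sum_distrib_left mult_ac)
        finally show ?thesis .
      qed
      \<comment> \<open>The exponent is critical: since \<open>2 * s = n\<close>, rescaling by
        \<open>2 ^ k\<close> turns each diagonal term into \<open>norm \<xi> ^ n * G \<xi>\<close>,
        the same for all \<open>k\<close>. The squared norm therefore grows only linearly in
        \<open>K\<close>.\<close>
      have Jk: "(\<integral>\<^sup>+\<xi>. ennreal (norm \<xi> ^ n * (gk k \<xi> / (2 ^ k) ^ n)) \<partial>lborel) \<le> ennreal J" for k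
      proof -
        have [measurable]: "gk k \<in> borel_measurable borel"
          using borel_measurable_integrable[OF igk] by simp
        have "(\<integral>\<^sup>+\<xi>. ennreal (norm \<xi> ^ n * (gk k \<xi> / (2 ^ k) ^ n)) \<partial>lborel) =
          ennreal ((2 ^ k) ^ n) * (\<integral>\<^sup>+\<xi>. ennreal (norm (2 ^ k *\<^sub>R \<xi>) ^ n * (gk k (2 ^ k *\<^sub>R \<xi>) / (2 ^ k) ^ n)) \<partial>lborel)"
          by (subst nn_integral_affine[of _ "2 ^ k" 0]) (auto simp: n_def)
        also have "\<dots> = (\<integral>\<^sup>+\<xi>. ennreal ((2 ^ k) ^ n * (norm (2 ^ k *\<^sub>R \<xi>) ^ n * (gk k (2 ^ k *\<^sub>R \<xi>) / (2 ^ k) ^ n))) \<partial>lborel)"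
          by (subst nn_integral_cmult[symmetric]) (auto simp: ennreal_mult'[symmetric])
        also have "\<dots> \<le> (\<integral>\<^sup>+\<xi>. ennreal (exp ((real n)\<^sup>2 / (4 * (1 / 4))) * exp (- (1 / 4) * (norm (\<xi>::real^'n))\<^sup>2)) \<partial>lborel)"
        proof (intro nn_integral_mono ennreal_leI)
          fix \<xi> :: "real^'n"
          have "(2 ^ k) ^ n * (norm (2 ^ k *\<^sub>R \<xi>) ^ n * (gk k (2 ^ k *\<^sub>R \<xi>) / (2 ^ k) ^ n)) = norm \<xi> ^ n * G \<xi>"
            by (simp add: gk_def power_mult_distrib)
          also have "\<dots> \<le> (1 + norm \<xi>) ^ n * G \<xi>"
            by (intro mult_right_mono power_mono) (auto simp: G_def)
          also have "(1 + norm \<xi>) ^ n = (1 + norm \<xi>) powr (real n)"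
            by (subst powr_realpow) (auto simp: add_pos_nonneg)
          also have "\<dots> * G \<xi> \<le> exp ((real n)\<^sup>2 / (4 * (1 / 4))) * exp (1 / 4 * (norm \<xi>)\<^sup>2) * G \<xi>"
            by (intro mult_right_mono one_plus_powr_le_exp_square) (auto simp: G_def)
          also have "\<dots> = exp ((real n)\<^sup>2 / (4 * (1 / 4))) * exp (- (1 / 4) * (norm \<xi>)\<^sup>2)"
            unfolding G_def mult.assoc exp_add[symmetric] by simp
          finally show "(2 ^ k) ^ n * (norm (2 ^ k *\<^sub>R \<xi>) ^ n * (gk k (2 ^ k *\<^sub>R \<xi>) / (2 ^ k) ^ n)) \<le>
            exp ((real n)\<^sup>2 / (4 * (1 / 4))) * exp (- (1 / 4) * (norm \<xi>)\<^sup>2)" .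
        qed
        also have "\<dots> = ennreal J"
          unfolding J_def by (intro nn_integral_eq_integral integrable_mult_right integrable_exp_neg_norm_square) auto
        finally show ?thesis .
      qed
      have [measurable]: "gk k \<in> borel_measurable borel" for k
        using borel_measurable_integrable[OF igk] by simp
      have gkn: "0 \<le> gk k \<xi>" for k \<xi> unfolding gk_def G_def by simp
      have "(\<integral>\<^sup>+\<xi>. ennreal (norm \<xi> powr (2 * (real n / 2)) * (norm (fourier h \<xi>))\<^sup>2) \<partial>lborel)
        \<le> (\<integral>\<^sup>+\<xi>. (\<Sum>k<K. ennreal (4 * \<kappa>\<^sup>2) * ennreal (norm \<xi> ^ n * (gk k \<xi> / (2 ^ k) ^ n))) \<partial>lborel)"
      proof (intro nn_integral_mono)
        fix \<xi> :: "real^'n"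
        have "(\<Sum>k<K. ennreal (4 * \<kappa>\<^sup>2) * ennreal (norm \<xi> ^ n * (gk k \<xi> / (2 ^ k) ^ n))) =
          ennreal (\<Sum>k<K. (4 * \<kappa>\<^sup>2) * (norm \<xi> ^ n * (gk k \<xi> / (2 ^ k) ^ n)))"
        proof -
          have "ennreal (4 * \<kappa>\<^sup>2) * ennreal (norm \<xi> ^ n * (gk k \<xi> / (2 ^ k) ^ n)) =
            ennreal ((4 * \<kappa>\<^sup>2) * (norm \<xi> ^ n * (gk k \<xi> / (2 ^ k) ^ n)))" for k
            using gkn by (intro ennreal_mult[symmetric]) simp_all
          then show ?thesis using gkn by (simp only:) (intro sum_ennreal; simp)
        qed
        then show "ennreal (norm \<xi> powr (2 * (real n / 2)) * (norm (fourier h \<xi>))\<^sup>2) \<le>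
          (\<Sum>k<K. ennreal (4 * \<kappa>\<^sup>2) * ennreal (norm \<xi> ^ n * (gk k \<xi> / (2 ^ k) ^ n)))"
          using pt by (simp only:) (intro ennreal_leI)
      qed
      also have "\<dots> = (\<Sum>k<K. ennreal (4 * \<kappa>\<^sup>2) * (\<integral>\<^sup>+\<xi>. ennreal (norm \<xi> ^ n * (gk k \<xi> / (2 ^ k) ^ n)) \<partial>lborel))"
        by (subst nn_integral_sum; (subst nn_integral_cmult)?) auto
      also have "\<dots> \<le> (\<Sum>k<K. ennreal (4 * \<kappa>\<^sup>2) * ennreal J)"
        by (intro sum_mono mult_left_mono Jk) auto
      also have "\<dots> = ennreal (4 * \<kappa>\<^sup>2 * (real K * J))"
        using J by (simp add: ennreal_mult[symmetric] ennreal_of_nat_eq_real_of_nat mult_ac)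
      finally have "sobolev_norm (real n / 2) h \<le> ennpowr (ennreal (4 * \<kappa>\<^sup>2 * (real K * J))) (1 / 2)"
        unfolding sobolev_norm_def by (intro ennpowr_mono) auto
      then show ?thesis using J by simp
    qed
    finally have "ennreal (\<kappa> * real K * I0 / 2) \<le> ennreal (C0 * (4 * \<kappa>\<^sup>2 * (real K * J)) powr (1 / 2))"
      using C0 by (simp add: ennreal_mult mult_left_mono)
    then have "\<kappa> * real K * I0 / 2 \<le> C0 * (4 * \<kappa>\<^sup>2 * (real K * J)) powr (1 / 2)"
      using C0 by (subst (asm) ennreal_le_iff) auto
    also have "(4 * \<kappa>\<^sup>2 * (real K * J)) powr (1 / 2) = 2 * \<kappa> * sqrt (real K * J)"
      using \<kappa> J by (simp add: powr_half_sqrt real_sqrt_mult)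
    finally have "\<kappa> * (real K * I0 / 2) \<le> \<kappa> * (2 * C0 * sqrt (real K * J))" by (simp add: mult_ac)
    then show ?thesis using \<kappa> by (simp only: mult_le_cancel_left_pos)
  qed
  then have le: "(real K * I0)\<^sup>2 \<le> 16 * C0\<^sup>2 * (real K * J)" if "1 \<le> K" for K
  proof -
    have "real K * I0 \<le> 4 * C0 * sqrt (real K * J)"
      using \<open>\<And>K. 1 \<le> K \<Longrightarrow> real K * I0 / 2 \<le> 2 * C0 * sqrt (real K * J)\<close>[OF that] by simp
    then have "(real K * I0)\<^sup>2 \<le> (4 * C0 * sqrt (real K * J))\<^sup>2"
      using I0 by (intro power_mono) auto
    then show ?thesis using J by (simp add: power_mult_distrib)
  qed
  \<comment> \<open>Dividing the inequality by \<open>K\<close> would leave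
    \<open>K * I0\<^sup>2 \<le> 16 * C0\<^sup>2 * J\<close> for all \<open>K\<close>.\<close>
  obtain K :: nat where K: "16 * C0\<^sup>2 * J / I0\<^sup>2 < real K" using reals_Archimedean2 by blast
  have "0 \<le> 16 * C0\<^sup>2 * J / I0\<^sup>2" using J by simp
  then have K1: "0 < real K" using K by linarith
  have "16 * C0\<^sup>2 * J < real K * I0\<^sup>2" using K I0 by (simp add: pos_divide_less_eq)
  then have "real K * (16 * C0\<^sup>2 * J) < real K * (real K * I0\<^sup>2)" using K1 by (intro mult_strict_left_mono)
  moreover have "(real K * I0)\<^sup>2 \<le> 16 * C0\<^sup>2 * (real K * J)" using K1 by (intro le) simp
  ultimately show False by (simp add: power2_eq_square mult_ac)
qed

subsection \<open>Sufficiency: the oscillatory kernel\<close>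

text \<open>Van der Corput's first derivative test, with \<open>g = 1 / \<phi>'\<close>.\<close>

lemma van_der_corput_first:
  fixes \<phi> \<phi>' g g' \<psi> \<psi>' :: "real \<Rightarrow> real"
  assumes AB: "A \<le> B"
    and \<phi>: "\<And>x. x \<in> {A..B} \<Longrightarrow> (\<phi> has_real_derivative \<phi>' x) (at x)"
    and g: "\<And>x. x \<in> {A..B} \<Longrightarrow> (g has_real_derivative g' x) (at x)" "continuous_on {A..B} g'"
      "\<And>x. x \<in> {A..B} \<Longrightarrow> g x * \<phi>' x = 1" "\<And>x. x \<in> {A..B} \<Longrightarrow> \<bar>g x\<bar> \<le> M"
    and sgn: "\<bar>\<sigma>\<bar> = 1" "\<And>x. x \<in> {A..B} \<Longrightarrow> 0 \<le> \<sigma> * g' x"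
    and \<psi>: "\<And>x. x \<in> {A..B} \<Longrightarrow> (\<psi> has_real_derivative \<psi>' x) (at x)" "continuous_on {A..B} \<psi>'"
      "\<And>x. x \<in> {A..B} \<Longrightarrow> \<psi>' x \<le> 0" "\<And>x. x \<in> {A..B} \<Longrightarrow> 0 \<le> \<psi> x" "\<And>x. x \<in> {A..B} \<Longrightarrow> \<psi> x \<le> \<Psi>"
  shows "norm (integral {A..B} (\<lambda>x. \<psi> x *\<^sub>R cis (\<phi> x))) \<le> 5 * \<Psi> * M"
proof -
  define H where "H = (\<lambda>x. (\<psi> x * g x) *\<^sub>R cis (\<phi> x))"
  define R where "R = (\<lambda>x. (\<psi>' x * g x + \<psi> x * g' x) *\<^sub>R cis (\<phi> x))"
  define F where "F = (\<lambda>x. \<psi> x *\<^sub>R cis (\<phi> x))"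
  have c\<phi>: "continuous_on {A..B} \<phi>" and cg: "continuous_on {A..B} g" and c\<psi>: "continuous_on {A..B} \<psi>"
    using DERIV_isCont[OF \<phi>] DERIV_isCont[OF g(1)] DERIV_isCont[OF \<psi>(1)]
    by (auto intro!: continuous_at_imp_continuous_on)
  \<comment> \<open>Integration by parts in differential form: because
    \<open>g * \<phi>' = 1\<close>, differentiating \<open>H\<close> reproduces
    \<open>\<i> * F\<close> and leaves only the remainder \<open>R\<close>, in which the amplitude
    is differentiated.\<close>
  have dH: "(H has_vector_derivative R x + \<i> * F x) (at x within {A..B})" if x: "x \<in> {A..B}" for x
  proof -
    have dcis: "((\<lambda>x. cis (\<phi> x)) has_vector_derivative \<phi>' x *\<^sub>R (\<i> * cis (\<phi> x))) (at x)"
    proof -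
      have "((\<lambda>x. exp (\<i> * of_real (\<phi> x))) has_vector_derivative (\<i> * of_real (\<phi>' x)) * exp (\<i> * of_real (\<phi> x))) (at x)"
      proof -
        have 1: "((\<lambda>x. complex_of_real (\<phi> x)) has_vector_derivative of_real (\<phi>' x)) (at x)"
          by (rule has_vector_derivative_of_real[OF \<phi>[OF x]])
        have 2: "((\<lambda>z. exp (\<i> * z)) has_field_derivative \<i> * exp (\<i> * of_real (\<phi> x))) (at (of_real (\<phi> x)))"
          by (auto intro!: derivative_eq_intros)
        show ?thesis
          using field_vector_diff_chain_at[OF 1 2] by (simp add: comp_def mult_ac)
      qed
      then show ?thesis by (simp add: cis_conv_exp scaleR_conv_of_real mult_ac)
    qed
    have "((\<lambda>x. \<psi> x * g x) has_real_derivative (\<psi>' x * g x + \<psi> x * g' x)) (at x)"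
      using \<psi>(1)[OF x] g(1)[OF x] by (auto intro!: derivative_eq_intros)
    from has_vector_derivative_scaleR[OF this dcis]
    have "(H has_vector_derivative (\<psi> x * g x) *\<^sub>R (\<phi>' x *\<^sub>R (\<i> * cis (\<phi> x))) + R x) (at x)"
      unfolding H_def R_def by simp
    moreover have "(\<psi> x * g x) *\<^sub>R (\<phi>' x *\<^sub>R (\<i> * cis (\<phi> x))) = \<i> * F x"
      using g(3)[OF x] by (simp add: F_def mult.assoc)
    ultimately have "(H has_vector_derivative R x + \<i> * F x) (at x)"
      by (simp add: add.commute)
    then show ?thesis by (rule has_vector_derivative_at_within)
  qed
  have "((\<lambda>x. R x + \<i> * F x) has_integral H B - H A) {A..B}"
    by (rule fundamental_theorem_of_calculus[OF AB dH])
  moreover have Rint: "R integrable_on {A..B}"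
    unfolding R_def by (intro integrable_continuous_real continuous_intros cg c\<psi> g(2) \<psi>(2) continuous_on_compose2[OF continuous_on_cis[OF continuous_on_id] c\<phi>]) auto
  ultimately have "((\<lambda>x. (R x + \<i> * F x) - R x) has_integral (H B - H A - integral {A..B} R)) {A..B}"
    by (intro has_integral_diff) auto
  then have "((\<lambda>x. - \<i> * (\<i> * F x)) has_integral - \<i> * (H B - H A - integral {A..B} R)) {A..B}"
    by (intro has_integral_mult_right) simp
  then have I: "integral {A..B} F = - \<i> * (H B - H A - integral {A..B} R)"
    by (intro integral_unique) (simp add: mult.assoc[symmetric])
  have M0: "0 \<le> M" and P0: "0 \<le> \<Psi>" using g(4)[of A] \<psi>(4,5)[of A] AB by fastforce+
  have nH: "norm (H x) \<le> \<Psi> * M" if "x \<in> {A..B}" for x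
    unfolding H_def using g(4)[OF that] \<psi>(4,5)[OF that] P0 by (simp add: abs_mult mult_mono)
  \<comment> \<open>Both \<open>\<psi>\<close> and \<open>g\<close> are monotone, so the absolute
    value of the remainder has a majorant with an explicit antiderivative. Its integral needs only
    boundary values.\<close>
  have dom: "((\<lambda>x. - \<psi>' x * M + \<Psi> * (\<sigma> * g' x)) has_integral
     ((- \<psi> B * M + \<Psi> * (\<sigma> * g B)) - (- \<psi> A * M + \<Psi> * (\<sigma> * g A)))) {A..B}"
  proof (rule fundamental_theorem_of_calculus[OF AB])
    fix x assume x: "x \<in> {A..B}"
    have "((\<lambda>x. - \<psi> x * M + \<Psi> * (\<sigma> * g x)) has_real_derivative - \<psi>' x * M + \<Psi> * (\<sigma> * g' x)) (at x)"
      using \<psi>(1)[OF x] g(1)[OF x] by (auto intro!: derivative_eq_intros)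
    then show "((\<lambda>x. - \<psi> x * M + \<Psi> * (\<sigma> * g x)) has_vector_derivative - \<psi>' x * M + \<Psi> * (\<sigma> * g' x)) (at x within {A..B})"
      unfolding has_real_derivative_iff_has_vector_derivative by (rule has_vector_derivative_at_within)
  qed
  have "norm (integral {A..B} R) \<le> integral {A..B} (\<lambda>x. - \<psi>' x * M + \<Psi> * (\<sigma> * g' x))"
  proof (rule Henstock_Kurzweil_Integration.integral_norm_bound_integral[OF Rint])
    fix x assume x: "x \<in> {A..B}"
    have "norm (R x) \<le> \<bar>\<psi>' x\<bar> * \<bar>g x\<bar> + \<bar>\<psi> x\<bar> * \<bar>g' x\<bar>"
      unfolding R_def using abs_triangle_ineq[of "\<psi>' x * g x" "\<psi> x * g' x"] by (simp add: abs_mult)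
    also have "\<bar>g' x\<bar> = \<sigma> * g' x"
      using sgn(2)[OF x] sgn(1) by (metis abs_mult abs_of_nonneg mult_1)
    also have "\<bar>\<psi>' x\<bar> = - \<psi>' x" using \<psi>(3)[OF x] by simp
    also have "- \<psi>' x * \<bar>g x\<bar> + \<bar>\<psi> x\<bar> * (\<sigma> * g' x) \<le> - \<psi>' x * M + \<Psi> * (\<sigma> * g' x)"
      using \<psi>(3,4,5)[OF x] g(4)[OF x] sgn(2)[OF x] by (intro add_mono mult_left_mono mult_right_mono) auto
    finally show "norm (R x) \<le> - \<psi>' x * M + \<Psi> * (\<sigma> * g' x)" .
  qed (use dom in blast)
  also have "\<dots> = (\<psi> A - \<psi> B) * M + \<Psi> * (\<sigma> * g B - \<sigma> * g A)"
    using dom by (simp add: integral_unique algebra_simps)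
  also have "\<dots> \<le> \<Psi> * M + \<Psi> * (M + M)"
  proof (intro add_mono mult_right_mono mult_left_mono)
    show "\<psi> A - \<psi> B \<le> \<Psi>" using \<psi>(4)[of B] \<psi>(5)[of A] AB by simp
    have "\<bar>\<sigma> * g B\<bar> \<le> M" "\<bar>\<sigma> * g A\<bar> \<le> M"
      using g(4)[of A] g(4)[of B] AB sgn(1) by (simp_all add: abs_mult)
    then show "\<sigma> * g B - \<sigma> * g A \<le> M + M" by linarith
  qed (use M0 P0 in auto)
  finally have nR: "norm (integral {A..B} R) \<le> 3 * (\<Psi> * M)" by (simp add: mult.commute)
  have "norm (integral {A..B} F) \<le> norm (H B) + norm (H A) + norm (integral {A..B} R)"
    unfolding I using norm_triangle_ineq4[of "H B - H A" "integral {A..B} R"] norm_triangle_ineq4[of "H B" "H A"]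
    by (simp add: norm_mult)
  \<comment> \<open>Two boundary terms, one unit for the variation of \<open>\<psi>\<close> and two
    for that of \<open>g\<close>.\<close>
  also have "\<dots> \<le> 5 * \<Psi> * M"
    using nR nH[of A] nH[of B] AB by simp
  finally show ?thesis unfolding F_def .
qed

text \<open>The second derivative of the phase has the sign of \<open>t\<close> on the whole
  half-line, so \<open>1 / \<phi>'\<close> is monotone wherever \<open>\<phi>'\<close> does not
  vanish, with the sign recorded by \<open>\<sigma>\<close>. No further subdivision of the interval
  is required.\<close>

lemma oscillatory_piece:
  fixes A B a \<alpha> t m :: real
  assumes A: "0 < A" "A \<le> B" and a: "1 < a" and \<alpha>: "0 < \<alpha>" and m: "0 < m"
    and low: "\<And>x. x \<in> {A..B} \<Longrightarrow> m \<le> \<bar>1 + t * a * x powr (a - 1)\<bar>"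
  shows "norm (integral {A..B} (\<lambda>x. x powr (- \<alpha>) *\<^sub>R cis (x + t * x powr a))) \<le> 5 * A powr (- \<alpha>) / m"
proof -
  define \<phi>' where "\<phi>' = (\<lambda>x. 1 + t * a * x powr (a - 1))"
  define g' where "g' = (\<lambda>x. - (t * a * (a - 1) * x powr (a - 2)) / (\<phi>' x)\<^sup>2)"
  define \<sigma> :: real where "\<sigma> = (if 0 \<le> t then -1 else 1)"
  have nz: "\<phi>' x \<noteq> 0" if "x \<in> {A..B}" for x using low[OF that] m unfolding \<phi>'_def by auto
  have pos: "0 < x" if "x \<in> {A..B}" for x using that A by auto
  have "norm (integral {A..B} (\<lambda>x. x powr (- \<alpha>) *\<^sub>R cis (x + t * x powr a))) \<le> 5 * A powr (- \<alpha>) * (1 / m)"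
  proof (rule van_der_corput_first[OF A(2), where \<phi>'=\<phi>' and g="\<lambda>x. 1 / \<phi>' x" and g'=g' and \<sigma>=\<sigma> and \<psi>'="\<lambda>x. - \<alpha> * x powr (- \<alpha> - 1)"])
    fix x assume x: "x \<in> {A..B}"
    note p = pos[OF x]
    show "((\<lambda>x. x + t * x powr a) has_real_derivative \<phi>' x) (at x)"
      unfolding \<phi>'_def using p by (auto intro!: derivative_eq_intros)
    have "(\<phi>' has_real_derivative t * a * ((a - 1) * x powr (a - 2))) (at x)"
      unfolding \<phi>'_def using p by (auto intro!: derivative_eq_intros)
    then show "((\<lambda>x. 1 / \<phi>' x) has_real_derivative g' x) (at x)"
      unfolding g'_def using nz[OF x] by (auto intro!: derivative_eq_intros simp: power2_eq_square)
    show "1 / \<phi>' x * \<phi>' x = 1" using nz[OF x] by simp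
    show "\<bar>1 / \<phi>' x\<bar> \<le> 1 / m"
      using low[OF x] m unfolding \<phi>'_def by (simp add: frac_le)
    show "0 \<le> \<sigma> * g' x"
    proof -
      define k where "k = a * (a - 1) * x powr (a - 2) / (\<phi>' x)\<^sup>2"
      have "0 \<le> k" unfolding k_def using a by simp
      moreover have "g' x = - (t * k)" unfolding g'_def k_def by simp
      ultimately show ?thesis unfolding \<sigma>_def by (auto simp: mult_le_0_iff)
    qed
    show "((\<lambda>x. x powr (- \<alpha>)) has_real_derivative - \<alpha> * x powr (- \<alpha> - 1)) (at x)"
      using p by (auto intro!: derivative_eq_intros)
    show "- \<alpha> * x powr (- \<alpha> - 1) \<le> 0" using \<alpha> by simp
    show "x powr (- \<alpha>) \<le> A powr (- \<alpha>)" using x A \<alpha> by (intro powr_mono2') auto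
  next
    have ne: "\<forall>x\<in>{A..B}. x \<noteq> 0" using pos by force
    have pw: "continuous_on {A..B} (\<lambda>x. x powr e)" for e
      by (intro continuous_on_powr continuous_on_id continuous_on_const ne)
    have "continuous_on {A..B} \<phi>'" unfolding \<phi>'_def by (intro continuous_intros pw)
    then show "continuous_on {A..B} g'"
      unfolding g'_def using nz by (intro continuous_on_divide continuous_intros pw) auto
    show "continuous_on {A..B} (\<lambda>x. - \<alpha> * x powr (- \<alpha> - 1))"
      by (intro continuous_intros pw)
  qed (auto simp: \<sigma>_def)
  then show ?thesis by simp
qed

lemma continuous_oscillatory:
  fixes A B a \<alpha> t :: real
  assumes "0 < A"
  shows "continuous_on {A..B} (\<lambda>x. x powr (- \<alpha>) *\<^sub>R cis (x + t * x powr a))"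
proof -
  have "continuous_on {A..B} (\<lambda>x. x + t * x powr a)"
    using assms by (intro continuous_intros) auto
  then show ?thesis
    using assms by (intro continuous_intros continuous_on_compose2[OF continuous_on_cis[OF continuous_on_id]]) auto
qed

lemma oscillatory_trivial:
  fixes A B a \<alpha> t :: real
  assumes A: "0 < A" "A \<le> B" and \<alpha>: "0 < \<alpha>"
  shows "norm (integral {A..B} (\<lambda>x. x powr (- \<alpha>) *\<^sub>R cis (x + t * x powr a))) \<le> A powr (- \<alpha>) * (B - A)"
proof (rule integral_bound[OF A(2) continuous_oscillatory[OF A(1)]])
  fix x assume "x \<in> {A..B}"
  then show "norm (x powr (- \<alpha>) *\<^sub>R cis (x + t * x powr a)) \<le> A powr (- \<alpha>)"
    using A \<alpha> by (simp add: powr_mono2')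
qed

text \<open>For \<open>b \<ge> 1\<close> the power only decreases the base; for \<open>b < 1\<close>
  it is weighted AM-GM. This bounds the phase derivative \<open>1 - (x / p) powr b\<close> from
  below by the relative distance to its zero \<open>p\<close>.\<close>

lemma powr_lower_left:
  fixes b v :: real
  assumes "0 < b" "0 \<le> v" "v < 1"
  shows "min 1 b * v \<le> 1 - (1 - v) powr b"
proof (cases "1 \<le> b")
  case True
  have "(1 - v) powr b \<le> (1 - v) powr 1" using assms True by (intro powr_mono') auto
  then show ?thesis using assms True by simp
next
  case False
  have "(1 - v) powr b * 1 powr (1 - b) \<le> b * (1 - v) + (1 - b) * 1"
    using assms False by (intro Youngs_inequality_0) auto
  then show ?thesis using False by (simp add: algebra_simps)
qed

text \<open>Inversion reduces this to the left side: \<open>1 / (1 + v) = 1 - w\<close> and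
  \<open>1 - 1 / y \<le> y - 1\<close>. The factor 1/2 is the loss in
  \<open>v \<le> 2 * w\<close>.\<close>

lemma powr_lower_right:
  fixes b v :: real
  assumes "0 < b" "0 \<le> v" "v \<le> 1"
  shows "min 1 b / 2 * v \<le> (1 + v) powr b - 1"
proof -
  define w where "w = v / (1 + v)"
  have w: "0 \<le> w" "w < 1" "1 - w = 1 / (1 + v)" "v \<le> 2 * w"
    using assms by (auto simp: w_def field_simps mult_left_le)
  define y where "y = (1 + v) powr b"
  have y: "1 \<le> y" unfolding y_def using assms by (intro ge_one_powr_ge_zero) auto
  have "min 1 b * w \<le> 1 - 1 / y"
    using powr_lower_left[OF assms(1) w(1,2)] assms unfolding w(3) y_def by (simp add: powr_divide)
  also have "\<dots> \<le> y - 1"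
  proof -
    have "0 \<le> (y - 1)\<^sup>2 / y" using y by simp
    also have "\<dots> = y - 1 - (1 - 1 / y)" using y by (simp add: power2_eq_square field_simps)
    finally show ?thesis by simp
  qed
  finally have "min 1 b * w \<le> y - 1" .
  moreover have "min 1 b / 2 * v \<le> min 1 b * w"
    using mult_left_mono[OF w(4), of "min 1 b / 2"] assms(1) by simp
  ultimately show ?thesis unfolding y_def by linarith
qed

text \<open>For \<open>t < 0\<close> the phase is stationary at \<open>p\<close>. The window of half-width \<open>sqrt p\<close> around \<open>p\<close> is estimated
  trivially, using \<open>1 / 2 \<le> \<alpha>\<close>, and the rest by the first derivative test.\<close>

lemma oscillatory_bound_from_one:
  fixes a \<alpha> :: real
  assumes a: "1 < a" and \<alpha>: "1 / 2 \<le> \<alpha>"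
  shows "\<exists>C\<ge>0. \<forall>t N. 1 \<le> N \<longrightarrow> norm (integral {1..N} (\<lambda>x. x powr (- \<alpha>) *\<^sub>R cis (x + t * x powr a))) \<le> C"
proof -
  define b where "b = a - 1"
  define c where "c = min 1 b / 2"
  have b: "0 < b" unfolding b_def using a by simp
  have c: "0 < c" "c \<le> 1 / 2" "min 1 b = 2 * c" unfolding c_def using b by auto
  have \<alpha>0: "0 < \<alpha>" using \<alpha> by simp
  \<comment> \<open>The constant covers all cases: 5 for \<open>t \<ge> 0\<close>,
    \<open>7 + 5 / c\<close> for a stationary point up to 4, and \<open>4 + 30 / c\<close>
    beyond.\<close>
  have main: "norm (integral {1..N} (\<lambda>x. x powr (- \<alpha>) *\<^sub>R cis (x + t * x powr a))) \<le> 12 + 30 / c" if N: "1 \<le> N" for t N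
  proof (cases "0 \<le> t")
    case True
    have "norm (integral {1..N} (\<lambda>x. x powr (- \<alpha>) *\<^sub>R cis (x + t * x powr a))) \<le> 5 * 1 powr (- \<alpha>) / 1"
    proof (rule oscillatory_piece[OF _ N a \<alpha>0])
      fix x :: real
      have "0 \<le> t * a * x powr (a - 1)" using True a by simp
      then show "1 \<le> \<bar>1 + t * a * x powr (a - 1)\<bar>" by simp
    qed simp_all
    also have "\<dots> \<le> 12 + 30 / c" using c by simp
    finally show ?thesis .
  next
    case False
    \<comment> \<open>The zero of the phase derivative, that is the solution of
      \<open>1 + t * a * p powr b = 0\<close>.\<close>
    define p where "p = (1 / (- t * a)) powr (1 / b)"
    define I where "I = (\<lambda>A B. integral {A..B} (\<lambda>x. x powr (- \<alpha>) *\<^sub>R cis (x + t * x powr a)))"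
    have ta: "0 < - t * a" using False a by (simp add: mult_neg_pos)
    have p: "0 < p" unfolding p_def using a False by simp
    have pb: "p powr b = 1 / (- t * a)"
    proof -
      define y where "y = 1 / (- t * a)"
      have "0 < y" unfolding y_def using ta by (intro divide_pos_pos zero_less_one)
      then have "(y powr (1 / b)) powr b = y" using b by (simp add: powr_powr)
      then show ?thesis unfolding p_def y_def .
    qed
    have tab: "t * a = - (1 / p powr b)" unfolding pb using a False by simp
    have phase: "1 + t * a * x powr (a - 1) = 1 - (x / p) powr b" if "0 < x" for x
      using that p unfolding tab b_def[symmetric] by (simp add: powr_divide)
    have split: "I A C = I A B + I B C" if "0 < A" "A \<le> B" "B \<le> C" for A B C
      unfolding I_def
      using Henstock_Kurzweil_Integration.integral_combine[OF that(2,3) integrable_continuous_real[OF continuous_oscillatory[OF that(1)]]]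
      by simp
    \<comment> \<open>Here \<open>v\<close> is the relative distance to the stationary point at the
      near end of the interval, and \<open>c * v\<close> bounds the phase derivative from there on;
      \<open>before\<close> is the mirror image.\<close>
    have after: "norm (I A B) \<le> 5 * A powr (- \<alpha>) / m"
      if "0 < A" "A \<le> B" "0 < m" "0 \<le> v" "v \<le> 1" "A = p * (1 + v)" "m \<le> c * v" for A B m v
      unfolding I_def
    proof (rule oscillatory_piece[OF that(1,2) a \<alpha>0 that(3)])
      fix x assume x: "x \<in> {A..B}"
      have "m \<le> (1 + v) powr b - 1"
        using powr_lower_right[OF b that(4,5)] that(7) unfolding c_def by linarith
      also have "(1 + v) powr b \<le> (x / p) powr b"
        using x that(1,4,6) p b by (intro powr_mono2) (auto simp: pos_le_divide_eq mult.commute)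
      finally show "m \<le> \<bar>1 + t * a * x powr (a - 1)\<bar>"
        using x that(1) by (subst phase) auto
    qed
    have before: "norm (I A B) \<le> 5 * A powr (- \<alpha>) / m"
      if "0 < A" "A \<le> B" "0 < m" "0 \<le> v" "v < 1" "B \<le> p * (1 - v)" "m \<le> c * v" for A B m v
      unfolding I_def
    proof (rule oscillatory_piece[OF that(1,2) a \<alpha>0 that(3)])
      fix x assume x: "x \<in> {A..B}"
      have "c * v \<le> min 1 b * v" using c that(4) by (intro mult_right_mono) auto
      then have "m \<le> 1 - (1 - v) powr b"
        using powr_lower_left[OF b that(4,5)] that(7) by linarith
      moreover have "(x / p) powr b \<le> (1 - v) powr b"
        using x that(1,6) p b by (intro powr_mono2) (auto simp: pos_divide_le_eq mult.commute)
      ultimately show "m \<le> \<bar>1 + t * a * x powr (a - 1)\<bar>"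
        using x that(1) by (subst phase) auto
    qed
    have triv: "norm (I A B) \<le> A powr (- \<alpha>) * (B - A)" if "0 < A" "A \<le> B" for A B
      unfolding I_def by (rule oscillatory_trivial[OF that \<alpha>0])
    have I0: "I A A = 0" for A unfolding I_def by simp
    \<comment> \<open>All breakpoints are cut at \<open>N\<close>, so one decomposition works
      wherever \<open>N\<close> falls among them, at the price of estimates uniform in the right
      endpoint.\<close>
    have clip: "norm (I (min A N) (min B N)) \<le> K"
      if "A \<le> B" "0 \<le> K" "\<And>B'. A \<le> B' \<Longrightarrow> B' \<le> B \<Longrightarrow> norm (I A B') \<le> K" for A B K
      using that(1,2) that(3)[of "min B N"] by (cases "N \<le> A") (auto simp: I0 min_absorb1 min_absorb2)
    have decay: "A powr (- \<alpha>) \<le> 1" if "1 \<le> A" for A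
      using powr_mono'[of "- \<alpha>" 0 A] powr_mono[of "- \<alpha>" 0 A] that \<alpha>0 by simp
    have "norm (I 1 N) \<le> 12 + 30 / c"
    \<comment> \<open>A small stationary point is harmless: the trivial bound handles
      \<open>{1..8}\<close>, and from \<open>8 \<ge> 2 * p\<close> on the derivative is at least
      \<open>c\<close>.\<close>
    proof (cases "p \<le> 4")
      case True
      have "norm (I (min 1 N) (min 8 N)) \<le> 7"
      proof (rule clip)
        show "norm (I 1 B') \<le> 7" if "1 \<le> B'" "B' \<le> 8" for B'
          using triv[of 1 B'] that by simp
      qed auto
      moreover have "norm (I (min 8 N) (min (max 8 N) N)) \<le> 5 / c"
      proof (rule clip)
        show "norm (I 8 B') \<le> 5 / c" if "8 \<le> B'" for B'
        proof -
          have "norm (I 8 B') \<le> 5 * 8 powr (- \<alpha>) / c"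
            unfolding I_def
          proof (rule oscillatory_piece[OF _ that a \<alpha>0 c(1)])
            fix x assume x: "x \<in> {8..B'}"
            have "c * 1 \<le> (1 + 1) powr b - 1"
              using powr_lower_right[OF b, of 1] unfolding c_def by simp
            moreover have "(1 + 1) powr b \<le> (x / p) powr b"
              using x True p b by (intro powr_mono2) (auto simp: pos_le_divide_eq)
            ultimately show "c \<le> \<bar>1 + t * a * x powr (a - 1)\<bar>"
              using x by (subst phase) auto
          qed simp
          also have "\<dots> \<le> 5 * 1 / c"
            using c by (intro divide_right_mono mult_left_mono decay) auto
          finally show ?thesis by simp
        qed
      qed (use c in auto)
      moreover have "I 1 N = I (min 1 N) (min 8 N) + I (min 8 N) (min (max 8 N) N)"
        using split[of 1 "min 8 N" N] N by (auto simp: min_absorb1 min_absorb2)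
      ultimately have "norm (I 1 N) \<le> 7 + 5 / c"
        using norm_triangle_ineq[of "I (min 1 N) (min 8 N)" "I (min 8 N) (min (max 8 N) N)"] by simp
      also have "\<dots> \<le> 12 + 30 / c" using c by (intro add_mono divide_right_mono) auto
      finally show ?thesis .
    next
      case False
      define r where "r = sqrt p"
      have r: "2 \<le> r" "p = r * r" unfolding r_def using False p by (auto intro: real_le_rsqrt)
      \<comment> \<open>At distance \<open>r = sqrt p\<close> from \<open>p\<close> the derivative
        is at least \<open>c / r\<close>, against an amplitude \<open>2 / r\<close>, so the quotient
        is bounded. Left of \<open>p / 2\<close> the derivative alone is at least
        \<open>c / 2\<close>, and \<open>2 \<le> r\<close> keeps the breakpoints in order.\<close>
      define p1 p2 p3 where "p1 = p / 2" and "p2 = p - r" and "p3 = p + r"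
      have ord: "1 \<le> p1" "p1 \<le> p2" "p2 \<le> p3" "p1 \<le> p3"
        using r mult_mono[of 2 r 2 r] mult_right_mono[of 2 r r] unfolding p1_def p2_def p3_def by simp_all
      \<comment> \<open>The hypothesis \<open>1 / 2 \<le> \<alpha>\<close> is spent here: the
        amplitude past \<open>p / 2\<close> is at most the reciprocal of the square root of
        \<open>p / 4\<close>.\<close>
      have amp: "A powr (- \<alpha>) \<le> 2 / r" if "p1 \<le> A" for A
      proof -
        have "A powr (- \<alpha>) \<le> A powr (- (1 / 2))" using \<alpha> that ord by (intro powr_mono) auto
        also have "\<dots> \<le> ((r / 2) * (r / 2)) powr (- (1 / 2))"
        proof (rule powr_mono2')
          have "0 < r * r" using r(1) by simp
          then show "0 < r / 2 * (r / 2)" "r / 2 * (r / 2) \<le> A"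
            using that r(2) unfolding p1_def by (simp, linarith)
        qed simp
        also have "\<dots> = 2 / r"
        proof -
          have "(r / 2 * (r / 2)) powr (1 / 2) = \<bar>r / 2\<bar>"
            by (subst powr_half_sqrt) (simp_all only: real_sqrt_abs2 zero_le_square)
          then show ?thesis using r(1) by (simp only: powr_minus) simp
        qed
        finally show ?thesis .
      qed
      have 1: "norm (I (min 1 N) (min p1 N)) \<le> 10 / c"
      proof (rule clip)
        fix B' assume B': "1 \<le> B'" "B' \<le> p1"
        have "norm (I 1 B') \<le> 5 * 1 powr (- \<alpha>) / (c / 2)"
          using B' c by (intro before[of _ _ _ "1 / 2"]) (auto simp: p1_def)
        then show "norm (I 1 B') \<le> 10 / c" by simp
      qed (use c ord in auto)
      have 2: "norm (I (min p1 N) (min p2 N)) \<le> 10 / c"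
      proof (rule clip)
        fix B' assume B': "p1 \<le> B'" "B' \<le> p2"
        have "norm (I p1 B') \<le> 5 * p1 powr (- \<alpha>) / (c / r)"
          using B' c ord r by (intro before[of _ _ _ "1 / r"]) (auto simp: p2_def algebra_simps)
        also have "\<dots> \<le> 5 * (2 / r) / (c / r)"
          using c r by (intro divide_right_mono mult_left_mono amp) auto
        finally show "norm (I p1 B') \<le> 10 / c" using r by simp
      qed (use c ord in auto)
      have 3: "norm (I (min p2 N) (min p3 N)) \<le> 4"
      proof (rule clip)
        fix B' assume B': "p2 \<le> B'" "B' \<le> p3"
        have "norm (I p2 B') \<le> p2 powr (- \<alpha>) * (B' - p2)"
          using B' ord by (intro triv) auto
        also have "\<dots> \<le> (2 / r) * (2 * r)"
          using B' ord r by (intro mult_mono amp) (auto simp: p2_def p3_def)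
        finally show "norm (I p2 B') \<le> 4" using r by simp
      qed (use ord in auto)
      have 4: "norm (I (min p3 N) (min (max p3 N) N)) \<le> 10 / c"
      proof (rule clip)
        fix B' assume B': "p3 \<le> B'"
        have "norm (I p3 B') \<le> 5 * p3 powr (- \<alpha>) / (c / r)"
          using B' c ord r by (intro after[of _ _ _ "1 / r"]) (auto simp: p3_def algebra_simps)
        also have "\<dots> \<le> 5 * (2 / r) / (c / r)"
          using c r ord by (intro divide_right_mono mult_left_mono amp) auto
        finally show "norm (I p3 B') \<le> 10 / c" using r by simp
      qed (use c in auto)
      have "I 1 N = I (min 1 N) (min p1 N) + I (min p1 N) (min p2 N) + I (min p2 N) (min p3 N) + I (min p3 N) (min (max p3 N) N)"
        using split[of 1 "min p1 N" "min p2 N"] split[of 1 "min p2 N" "min p3 N"] split[of 1 "min p3 N" N] N ord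
        by (auto simp: min_absorb1)
      then have "norm (I 1 N) \<le> 10 / c + 10 / c + 4 + 10 / c"
        by (simp only:) (intro norm_triangle_mono 1 2 3 4)
      then show ?thesis using c by (simp add: field_simps)
    qed
    then show ?thesis unfolding I_def .
  qed
  then show ?thesis using c by (intro exI[of _ "12 + 30 / c"]) auto
qed

section \<open>The one-dimensional kernel and its homogeneity\<close>

lemma weight_unit_interval:
  fixes \<alpha> :: real
  assumes "\<alpha> < 1"
  shows "integrable lborel (\<lambda>r. indicator {0..c} r * r powr (- \<alpha>))" "0 \<le> c \<Longrightarrow>
    (LINT r|lborel. indicator {0..c} r * r powr (- \<alpha>)) = c powr (1 - \<alpha>) / (1 - \<alpha>)"
proof -
  have I: "(\<integral>\<^sup>+r. ennreal (indicator {0..c} r * r powr (- \<alpha>)) \<partial>lborel) = ennreal (c powr (1 - \<alpha>) / (1 - \<alpha>))" if "0 \<le> c"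
    using nn_integral_has_integral_lebesgue'[OF _ has_integral_powr_from_0[of "- \<alpha>" c]] assms that
    by (simp add: ennreal_mult'' ennreal_indicator mult.commute)
  show 1: "integrable lborel (\<lambda>r. indicator {0..c} r * r powr (- \<alpha>))"
  proof (cases "0 \<le> c")
    case True
    then show ?thesis
      by (intro integrableI_nonneg) (auto simp: I)
  qed simp
  show "(LINT r|lborel. indicator {0..c} r * r powr (- \<alpha>)) = c powr (1 - \<alpha>) / (1 - \<alpha>)" if "0 \<le> c"
    using I[OF that] assms by (intro integral_eq_nn_integral[THEN trans]) auto
qed

lemma half_line_oscillatory_bound:
  fixes a \<alpha> :: real
  assumes a: "1 < a" and \<alpha>: "1 / 2 \<le> \<alpha>" "\<alpha> < 1"
  shows "\<exists>C\<ge>0. \<forall>t N. norm (LINT r|lborel. (indicator {0..N} r * r powr (- \<alpha>)) *\<^sub>R cis (r + t * r powr a)) \<le> C"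
proof -
  obtain C where C: "0 \<le> C" "\<And>t N. 1 \<le> N \<Longrightarrow> norm (integral {1..N} (\<lambda>x. x powr (- \<alpha>) *\<^sub>R cis (x + t * x powr a))) \<le> C"
    using oscillatory_bound_from_one[OF a \<alpha>(1)] by blast
  have "norm (LINT r|lborel. (indicator {0..N} r * r powr (- \<alpha>)) *\<^sub>R cis (r + t * r powr a)) \<le> 1 / (1 - \<alpha>) + C" for t N
  proof -
    define w where "w = (\<lambda>r::real. indicator {0..1} r * r powr (- \<alpha>))"
    define f where "f = (\<lambda>r. r powr (- \<alpha>) *\<^sub>R cis (r + t * r powr a))"
    have [measurable]: "cis \<in> borel_measurable borel"
      by (intro borel_measurable_continuous_onI continuous_intros)
    have [measurable]: "f \<in> borel_measurable borel" unfolding f_def by measurable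
    have w: "integrable lborel w" "(LINT r|lborel. w r) = 1 / (1 - \<alpha>)"
      unfolding w_def using weight_unit_interval[OF \<alpha>(2), of 1] by simp_all
    \<comment> \<open>The weight is integrable on this set because \<open>\<alpha> < 1\<close>, so
      no oscillation is used there. \<open>N\<close> may lie below 1, and then the other piece
      \<open>{1..N}\<close> contributes nothing.\<close>
    define S where "S = {0..N} \<inter> {..<1}"
    have i1: "integrable lborel (\<lambda>r. indicator S r *\<^sub>R f r)"
      by (rule Bochner_Integration.integrable_bound[OF w(1)]) (auto simp: S_def w_def f_def indicator_def)
    have i2: "integrable lborel (\<lambda>r. indicator {1..N} r *\<^sub>R f r)"
      using borel_integrable_atLeastAtMost'[OF continuous_oscillatory[of 1 N \<alpha> t a]]
      unfolding set_integrable_def f_def by simp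
    have eq: "(\<lambda>r. (indicator {0..N} r * r powr (- \<alpha>)) *\<^sub>R cis (r + t * r powr a)) =
       (\<lambda>r. indicator S r *\<^sub>R f r + indicator {1..N} r *\<^sub>R f r)"
      by (auto simp: S_def f_def indicator_def fun_eq_iff)
    have n1: "norm (LINT r|lborel. indicator S r *\<^sub>R f r) \<le> 1 / (1 - \<alpha>)"
      unfolding w(2)[symmetric]
      by (rule Bochner_Integration.integral_norm_bound_integral[OF i1 w(1)]) (auto simp: S_def w_def f_def indicator_def)
    have "(LINT r|lborel. indicator {1..N} r *\<^sub>R f r) = integral {1..N} f"
      using set_borel_integral_eq_integral(2)[of "{1..N}" f] i2
      unfolding set_integrable_def set_lebesgue_integral_def by simp
    then have n2: "norm (LINT r|lborel. indicator {1..N} r *\<^sub>R f r) \<le> C"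
      using C(2)[of N t] C(1) unfolding f_def by (cases "1 \<le> N") auto
    show ?thesis
      unfolding eq by (subst Bochner_Integration.integral_add[OF i1 i2]) (intro norm_triangle_mono n1 n2)
  qed
  then show ?thesis using C \<alpha> by (intro exI[of _ "1 / (1 - \<alpha>) + C"]) auto
qed

text \<open>One coordinate of the T T* kernel. The weight is not integrable at infinity, so the
  cutoff \<open>N\<close> makes the integral absolutely convergent; every bound is uniform in
  it.\<close>

definition osc_kernel :: "real \<Rightarrow> real \<Rightarrow> real \<Rightarrow> real \<Rightarrow> real \<Rightarrow> complex" where
  "osc_kernel a \<alpha> N u t =
     (LINT r|lborel. (indicator {-N..N} r * \<bar>r\<bar> powr (- \<alpha>)) *\<^sub>R cis (u * r + t * \<bar>r\<bar> powr a))"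

lemma integrable_osc_weight:
  assumes "\<alpha> < 1"
  shows "integrable lborel (\<lambda>r::real. indicator {-N..N} r * \<bar>r\<bar> powr (- \<alpha>))"
proof -
  let ?w = "\<lambda>r::real. indicator {0..N} r * r powr (- \<alpha>)"
  have w: "integrable lborel ?w" by (rule weight_unit_interval[OF assms])
  have "integrable lborel (\<lambda>r. ?w r + ?w (0 + (- 1) * r))"
    by (intro Bochner_Integration.integrable_add w lborel_integrable_real_affine) simp_all
  then show ?thesis
    by (rule Bochner_Integration.integrable_cong[THEN iffD1, rotated -1]) (auto simp: indicator_def)
qed

text \<open>Reflection turns the negative half-line into the complex conjugate of the positive one
  with time \<open>- t\<close>, and the half-line bound is uniform in time of either sign.\<close>

lemma osc_kernel_unit_bound:
  fixes a \<alpha> :: real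
  assumes a: "1 < a" and \<alpha>: "1 / 2 \<le> \<alpha>" "\<alpha> < 1"
  shows "\<exists>C\<ge>0. \<forall>t N. norm (osc_kernel a \<alpha> N 1 t) \<le> C"
proof -
  obtain C where C: "0 \<le> C"
    "\<And>t N. norm (LINT r|lborel. (indicator {0..N} r * r powr (- \<alpha>)) *\<^sub>R cis (r + t * r powr a)) \<le> C"
    using half_line_oscillatory_bound[OF a \<alpha>] by blast
  have "norm (osc_kernel a \<alpha> N 1 t) \<le> C + C" for t N
  proof -
    define f where "f = (\<lambda>s r. (indicator {0..N} r * r powr (- \<alpha>)) *\<^sub>R cis (r + s * r powr a))"
    have [measurable]: "cis \<in> borel_measurable borel"
      by (intro borel_measurable_continuous_onI continuous_intros)
    have fi: "integrable lborel (f s)" for s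
      by (rule Bochner_Integration.integrable_bound[OF weight_unit_interval(1)[OF \<alpha>(2), of N]])
         (auto simp: f_def)
    then have gi: "integrable lborel (\<lambda>r. cnj (f (- t) r))" by simp
    \<comment> \<open>The origin lies in both halves but is not counted twice, because
      \<open>0 powr (- \<alpha>) = 0\<close>.\<close>
    have eq: "(indicator {-N..N} r * \<bar>r\<bar> powr (- \<alpha>)) *\<^sub>R cis (1 * r + t * \<bar>r\<bar> powr a) =
        f t r + cnj (f (- t) (0 + (- 1) * r))" for r
      by (cases "r < 0"; cases "r = 0") (auto simp: f_def indicator_def cis_cnj add.commute)
    have "osc_kernel a \<alpha> N 1 t = (LINT r|lborel. f t r) + (LINT r|lborel. cnj (f (- t) (0 + (- 1) * r)))"
      unfolding osc_kernel_def eq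
      by (intro Bochner_Integration.integral_add fi lborel_integrable_real_affine[OF gi]) simp
    also have "(LINT r|lborel. cnj (f (- t) (0 + (- 1) * r))) = (LINT r|lborel. cnj (f (- t) r))"
      using lborel_integral_real_affine[of "-1" "\<lambda>r. cnj (f (- t) r)" 0] by simp
    also have "\<dots> = cnj (LINT r|lborel. f (- t) r)" by simp
    finally show ?thesis
      using C(2)[of N t] C(2)[of N "- t"] unfolding f_def
      by (simp only:) (intro norm_triangle_mono; simp)
  qed
  then show ?thesis using C by (intro exI[of _ "C + C"]) auto
qed

text \<open>Rescaling by \<open>u\<close> changes the parameters to
  \<open>N * \<bar>u\<bar>\<close>, 1 and \<open>t * \<bar>u\<bar> powr (- a)\<close>. Uniformity in
  cutoff and time makes these changes invisible, and only the homogeneity factor remains.\<close>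

lemma osc_kernel_bound:
  fixes a \<alpha> :: real
  assumes a: "1 < a" and \<alpha>: "1 / 2 \<le> \<alpha>" "\<alpha> < 1"
  shows "\<exists>C\<ge>0. \<forall>N u t. u \<noteq> 0 \<longrightarrow> norm (osc_kernel a \<alpha> N u t) \<le> C * \<bar>u\<bar> powr (\<alpha> - 1)"
proof -
  obtain C where C: "0 \<le> C" "\<And>t N. norm (osc_kernel a \<alpha> N 1 t) \<le> C"
    using osc_kernel_unit_bound[OF a \<alpha>] by blast
  have "norm (osc_kernel a \<alpha> N u t) \<le> C * \<bar>u\<bar> powr (\<alpha> - 1)" if u: "u \<noteq> 0" for N u t
  proof -
    have eq: "(indicator {-N..N} (0 + (1 / u) * r) * \<bar>0 + (1 / u) * r\<bar> powr (- \<alpha>)) *\<^sub>R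
         cis (u * (0 + (1 / u) * r) + t * \<bar>0 + (1 / u) * r\<bar> powr a) =
       (\<bar>u\<bar> powr \<alpha>) *\<^sub>R ((indicator {-(N * \<bar>u\<bar>)..N * \<bar>u\<bar>} r * \<bar>r\<bar> powr (- \<alpha>)) *\<^sub>R
         cis (1 * r + (t * \<bar>u\<bar> powr (- a)) * \<bar>r\<bar> powr a))" for r
    proof -
      have "\<bar>r / u\<bar> \<le> N \<longleftrightarrow> \<bar>r\<bar> \<le> N * \<bar>u\<bar>" using u by (simp add: abs_divide pos_divide_le_eq)
      then have "r / u \<in> {-N..N} \<longleftrightarrow> r \<in> {-(N * \<bar>u\<bar>)..N * \<bar>u\<bar>}"
        unfolding atLeastAtMost_iff abs_le_iff by linarith
      then have "indicator {-N..N} (r / u) = (indicator {-(N * \<bar>u\<bar>)..N * \<bar>u\<bar>} r :: real)"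
        by (simp add: indicator_def)
      then show ?thesis
        using u by (simp add: abs_divide powr_divide powr_minus field_simps)
    qed
    have "osc_kernel a \<alpha> N u t = \<bar>1 / u\<bar> *\<^sub>R (\<bar>u\<bar> powr \<alpha> *\<^sub>R osc_kernel a \<alpha> (N * \<bar>u\<bar>) 1 (t * \<bar>u\<bar> powr (- a)))"
      unfolding osc_kernel_def
      using u by (subst lborel_integral_real_affine[of "1 / u" _ 0]) (simp_all only: eq integral_scaleR_right, simp)
    then have "norm (osc_kernel a \<alpha> N u t) = \<bar>u\<bar> powr (\<alpha> - 1) * norm (osc_kernel a \<alpha> (N * \<bar>u\<bar>) 1 (t * \<bar>u\<bar> powr (- a)))"
      using u by (simp add: powr_diff)
    also have "\<dots> \<le> \<bar>u\<bar> powr (\<alpha> - 1) * C" by (intro mult_left_mono C) auto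
    finally show ?thesis by (simp add: mult.commute)
  qed
  then show ?thesis using C by blast
qed

subsection \<open>Sufficiency: the Hardy-Littlewood-Sobolev inequality for product kernels\<close>

text \<open>With the value \<open>\<infinity>\<close> at \<open>0\<close>, kernel bounds in terms of \<open>riesz\<close> hold everywhere, not just almost everywhere.\<close>

definition riesz :: "real \<Rightarrow> real \<Rightarrow> ennreal" where
  "riesz \<gamma> u = (if u = 0 then \<infinity> else ennreal (\<bar>u\<bar> powr (- \<gamma>)))"

lemma riesz_measurable [measurable (raw)]:
  assumes [measurable]: "u \<in> borel_measurable M"
  shows "(\<lambda>x. riesz \<gamma> (u x)) \<in> borel_measurable M"
  unfolding riesz_def by measurable

lemma riesz_commute: "riesz \<gamma> (x - y) = riesz \<gamma> (y - x)"
  by (simp add: riesz_def abs_minus_commute)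

lemma nn_integral_even:
  fixes h :: "real \<Rightarrow> ennreal"
  assumes [measurable]: "h \<in> borel_measurable borel"
  shows "(\<integral>\<^sup>+u. h \<bar>u\<bar> \<partial>lborel) \<le> 2 * (\<integral>\<^sup>+u. h u * indicator {0..} u \<partial>lborel)"
proof -
  have "(\<integral>\<^sup>+u. h \<bar>u\<bar> \<partial>lborel) \<le> (\<integral>\<^sup>+u. h u * indicator {0..} u + h (0 + (- 1) * u) * indicator {0..} (0 + (- 1) * u) \<partial>lborel)"
    by (intro nn_integral_mono) (auto simp: indicator_def)
  also have "\<dots> = (\<integral>\<^sup>+u. h u * indicator {0..} u \<partial>lborel) + (\<integral>\<^sup>+u. h (0 + (- 1) * u) * indicator {0..} (0 + (- 1) * u) \<partial>lborel)"
    by (rule nn_integral_add) measurable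
  also have "(\<integral>\<^sup>+u. h (0 + (- 1) * u) * indicator {0..} (0 + (- 1) * u) \<partial>lborel) = (\<integral>\<^sup>+u. h u * indicator {0..} u \<partial>lborel)"
    by (subst (2) nn_integral_real_affine[of _ "- 1" 0]) simp_all
  finally show ?thesis by (simp add: mult_2)
qed

lemma riesz_near:
  assumes "\<gamma> < 1" "0 < R"
  shows "(\<integral>\<^sup>+u. ennreal (indicator {..R} \<bar>u\<bar> * \<bar>u\<bar> powr (- \<gamma>)) \<partial>lborel) \<le> ennreal (2 / (1 - \<gamma>) * R powr (1 - \<gamma>))"
proof -
  have "(\<integral>\<^sup>+u. ennreal (indicator {..R} \<bar>u\<bar> * \<bar>u\<bar> powr (- \<gamma>)) \<partial>lborel) \<le>
     2 * (\<integral>\<^sup>+u. ennreal (indicator {..R} u * u powr (- \<gamma>)) * indicator {0..} u \<partial>lborel)"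
    by (rule nn_integral_even[of "\<lambda>u. ennreal (indicator {..R} u * u powr (- \<gamma>))"]) measurable
  also have "(\<integral>\<^sup>+u. ennreal (indicator {..R} u * u powr (- \<gamma>)) * indicator {0..} u \<partial>lborel) =
     (\<integral>\<^sup>+u. ennreal (u powr (- \<gamma>)) * indicator {0..R} u \<partial>lborel)"
    by (intro nn_integral_cong) (auto simp: indicator_def)
  also have "\<dots> = ennreal (R powr (- \<gamma> + 1) / (- \<gamma> + 1))"
    using assms by (intro nn_integral_has_integral_lebesgue' has_integral_powr_from_0) auto
  also have "2 * ennreal (R powr (- \<gamma> + 1) / (- \<gamma> + 1)) = ennreal (2 * (R powr (- \<gamma> + 1) / (- \<gamma> + 1)))"
    using assms by (subst ennreal_mult) auto
  also have "2 * (R powr (- \<gamma> + 1) / (- \<gamma> + 1)) = 2 / (1 - \<gamma>) * R powr (1 - \<gamma>)"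
    by (simp add: add.commute)
  finally show ?thesis .
qed

lemma inverse_square_far:
  assumes "0 < R"
  shows "(\<integral>\<^sup>+u. ennreal (indicator {R<..} \<bar>u\<bar> * \<bar>u\<bar> powr (- 2)) \<partial>lborel) \<le> ennreal (2 / R)"
proof -
  have "(\<integral>\<^sup>+u. ennreal (indicator {R<..} \<bar>u\<bar> * \<bar>u\<bar> powr (- 2)) \<partial>lborel) \<le>
     2 * (\<integral>\<^sup>+u. ennreal (indicator {R<..} u * u powr (- 2)) * indicator {0..} u \<partial>lborel)"
    by (rule nn_integral_even[of "\<lambda>u. ennreal (indicator {R<..} u * u powr (- 2))"]) measurable
  also have "(\<integral>\<^sup>+u. ennreal (indicator {R<..} u * u powr (- 2)) * indicator {0..} u \<partial>lborel) \<le>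
     (\<integral>\<^sup>+u. ennreal (u powr (- 2)) * indicator {R..} u \<partial>lborel)"
    by (intro nn_integral_mono) (auto simp: indicator_def)
  also have "\<dots> = ennreal (- (R powr (- 2 + 1)) / (- 2 + 1))"
    using assms by (intro nn_integral_has_integral_lebesgue' has_integral_powr_to_inf) auto
  also have "- (R powr (- 2 + 1)) / (- 2 + 1) = 1 / R"
    using assms by (simp add: powr_minus_divide)
  also have "2 * ennreal (1 / R) = ennreal (2 / R)"
    using assms by (subst ennreal_numeral[symmetric], subst ennreal_mult[symmetric]) auto
  finally show ?thesis by (auto simp: mult_left_mono)
qed

text \<open>On the region \<open>g y \<le> f x\<close> one bounds \<open>g y\<close> by \<open>f x\<close> when \<open>\<bar>x - y\<bar> \<le> f x powr (- p)\<close> and uses Young's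
  inequality otherwise.\<close>

lemma hls_half:
  fixes f g :: "real \<Rightarrow> real" and \<gamma> :: real
  assumes [measurable]: "f \<in> borel_measurable borel" "g \<in> borel_measurable borel"
    and f0: "\<And>x. 0 \<le> f x" and g0: "\<And>x. 0 \<le> g x" and \<gamma>: "0 < \<gamma>" "\<gamma> < 1"
  defines "p \<equiv> 2 / (2 - \<gamma>)"
  assumes g1: "(\<integral>\<^sup>+y. ennreal (g y powr p) \<partial>lborel) \<le> 1"
  shows "(\<integral>\<^sup>+x. \<integral>\<^sup>+y. (if g y \<le> f x then ennreal (f x) * ennreal (g y) * riesz \<gamma> (x - y) else 0) \<partial>lborel \<partial>lborel)
     \<le> ennreal (2 / (1 - \<gamma>) + 3) * (\<integral>\<^sup>+x. ennreal (f x powr p) \<partial>lborel)"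
proof -
  have p: "1 < p" unfolding p_def using \<gamma> by (simp add: pos_less_divide_eq)
  have p1: "1 / p = 1 - \<gamma> / 2" unfolding p_def using \<gamma> by (simp add: field_simps)
  have p2: "2 - p * (1 - \<gamma>) = p" unfolding p_def using \<gamma> by (simp add: field_simps)
  have inner: "(\<integral>\<^sup>+y. (if g y \<le> f x then ennreal (f x) * ennreal (g y) * riesz \<gamma> (x - y) else 0) \<partial>lborel)
     \<le> ennreal (2 / (1 - \<gamma>) + 3) * ennreal (f x powr p)" for x
  proof (cases "f x = 0")
    case True
    then show ?thesis by (simp cong: if_cong)
  next
    case False
    define F where "F = f x"
    have F: "0 < F" unfolding F_def using False f0[of x] by simp
    \<comment> \<open>The radius that balances the two regions:
      \<open>F\<^sup>2 * R powr (1 - \<gamma>)\<close> and \<open>1 / R\<close> both equal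
      \<open>F powr p\<close>.\<close>
    define R where "R = F powr (- p)"
    have R: "0 < R" unfolding R_def using F by simp
    have pt: "(if g y \<le> F then ennreal F * ennreal (g y) * riesz \<gamma> (x - y) else 0) \<le>
       ennreal (F\<^sup>2) * ennreal (indicator {..R} \<bar>x - y\<bar> * \<bar>x - y\<bar> powr (- \<gamma>)) +
       (ennreal (F powr p) * ennreal (g y powr p) + ennreal (indicator {R<..} \<bar>x - y\<bar> * \<bar>x - y\<bar> powr (- 2)))"
      if "y \<noteq> x" for y
    proof (cases "g y \<le> F")
      case gF: True
      define u where "u = \<bar>x - y\<bar>"
      have u: "0 < u" unfolding u_def using that by simp
      have lhs: "(if g y \<le> F then ennreal F * ennreal (g y) * riesz \<gamma> (x - y) else 0) = ennreal (F * g y * u powr (- \<gamma>))"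
        using gF F g0[of y] that by (simp add: riesz_def u_def ennreal_mult)
      have young: "F * g y * u powr (- \<gamma>) \<le> F powr p * g y powr p + u powr (- 2)"
      proof (cases "g y = 0")
        case False
        then have gy: "0 < g y" using g0[of y] by simp
        \<comment> \<open>The weights \<open>1 / p\<close> and \<open>\<gamma> / 2\<close> add up to
          1. The exponent \<open>- 2\<close> restores \<open>u powr (- \<gamma>)\<close> and is
          integrable away from the origin.\<close>
        have "(F powr p * g y powr p) powr (1 / p) * (u powr (- 2)) powr (\<gamma> / 2) \<le>
            (1 / p) * (F powr p * g y powr p) + (\<gamma> / 2) * u powr (- 2)"
          using p1 p \<gamma> gy F u by (intro Youngs_inequality_0) auto
        also have "\<dots> \<le> 1 * (F powr p * g y powr p) + 1 * u powr (- 2)"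
          using p \<gamma> by (intro add_mono mult_right_mono) auto
        also have "(F powr p * g y powr p) powr (1 / p) * (u powr (- 2)) powr (\<gamma> / 2) = F * g y * u powr (- \<gamma>)"
          using p F gy by (simp add: powr_mult powr_powr)
        finally show ?thesis by simp
      qed auto
      show ?thesis
      proof (cases "u \<le> R")
        case True
        have "F * g y * u powr (- \<gamma>) \<le> F * F * u powr (- \<gamma>)"
          using gF F by (intro mult_right_mono mult_left_mono) auto
        then have "ennreal (F * g y * u powr (- \<gamma>)) \<le> ennreal (F\<^sup>2) * ennreal (indicator {..R} u * u powr (- \<gamma>))"
          using True F by (simp add: ennreal_mult[symmetric] power2_eq_square ennreal_leI)
        then show ?thesis unfolding lhs u_def[symmetric] by (rule order_trans) simp
      next
        case False
        have "ennreal (F * g y * u powr (- \<gamma>)) \<le> ennreal (F powr p * g y powr p + u powr (- 2))"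
          by (intro ennreal_leI young)
        also have "\<dots> = ennreal (F powr p) * ennreal (g y powr p) + ennreal (indicator {R<..} u * u powr (- 2))"
          using False by (simp add: ennreal_mult)
        finally show ?thesis unfolding lhs u_def[symmetric] by (rule order_trans) simp
      qed
    qed simp
    have shift: "(\<integral>\<^sup>+y. h \<bar>x - y\<bar> \<partial>lborel) = (\<integral>\<^sup>+u. h \<bar>u\<bar> \<partial>lborel)" if [measurable]: "h \<in> borel_measurable borel" for h :: "real \<Rightarrow> ennreal"
      by (subst (2) nn_integral_real_affine[of _ "- 1" x]) simp_all
    have "(\<integral>\<^sup>+y. (if g y \<le> F then ennreal F * ennreal (g y) * riesz \<gamma> (x - y) else 0) \<partial>lborel) \<le>
      (\<integral>\<^sup>+y. ennreal (F\<^sup>2) * ennreal (indicator {..R} \<bar>x - y\<bar> * \<bar>x - y\<bar> powr (- \<gamma>)) +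
       (ennreal (F powr p) * ennreal (g y powr p) + ennreal (indicator {R<..} \<bar>x - y\<bar> * \<bar>x - y\<bar> powr (- 2))) \<partial>lborel)"
      by (rule nn_integral_mono_AE, rule eventually_mono[OF AE_lborel_singleton[of x]], rule pt)
    also have "\<dots> = ennreal (F\<^sup>2) * (\<integral>\<^sup>+y. ennreal (indicator {..R} \<bar>x - y\<bar> * \<bar>x - y\<bar> powr (- \<gamma>)) \<partial>lborel) +
       (ennreal (F powr p) * (\<integral>\<^sup>+y. ennreal (g y powr p) \<partial>lborel) + (\<integral>\<^sup>+y. ennreal (indicator {R<..} \<bar>x - y\<bar> * \<bar>x - y\<bar> powr (- 2)) \<partial>lborel))"
      by (simp add: nn_integral_add nn_integral_cmult)
    also have "\<dots> \<le> ennreal (F\<^sup>2) * ennreal (2 / (1 - \<gamma>) * R powr (1 - \<gamma>)) + (ennreal (F powr p) * 1 + ennreal (2 / R))"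
    proof (intro add_mono mult_left_mono g1)
      show "(\<integral>\<^sup>+y. ennreal (indicator {..R} \<bar>x - y\<bar> * \<bar>x - y\<bar> powr (- \<gamma>)) \<partial>lborel) \<le> ennreal (2 / (1 - \<gamma>) * R powr (1 - \<gamma>))"
        by (subst shift[of "\<lambda>u. ennreal (indicator {..R} u * u powr (- \<gamma>))"]) (measurable, rule riesz_near[OF \<gamma>(2) R])
      show "(\<integral>\<^sup>+y. ennreal (indicator {R<..} \<bar>x - y\<bar> * \<bar>x - y\<bar> powr (- 2)) \<partial>lborel) \<le> ennreal (2 / R)"
        by (subst shift[of "\<lambda>u. ennreal (indicator {R<..} u * u powr (- 2))"]) (measurable, rule inverse_square_far[OF R])
    qed auto
    also have "\<dots> = ennreal (F\<^sup>2 * (2 / (1 - \<gamma>) * R powr (1 - \<gamma>)) + (F powr p + 2 / R))"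
    proof -
      have comb: "ennreal A * ennreal B + (ennreal C * 1 + ennreal D) = ennreal (A * B + (C + D))"
        if "0 \<le> A" "0 \<le> B" "0 \<le> C" "0 \<le> D" for A B C D
        using that by (simp add: ennreal_mult)
      show ?thesis by (rule comb) (use \<gamma> R in simp_all)
    qed
    \<comment> \<open>The 3 is one unit from the normalized integral of \<open>g powr p\<close> plus
      2 from the tail of the inverse square.\<close>
    also have "F\<^sup>2 * (2 / (1 - \<gamma>) * R powr (1 - \<gamma>)) + (F powr p + 2 / R) = (2 / (1 - \<gamma>) + 3) * F powr p"
    proof -
      have "F\<^sup>2 * R powr (1 - \<gamma>) = F powr (2 - p * (1 - \<gamma>))"
      proof -
        have "R powr (1 - \<gamma>) = F powr (- p * (1 - \<gamma>))"
          unfolding R_def by (rule powr_powr)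
        moreover have "F\<^sup>2 = F powr 2" using F by (simp add: powr_numeral)
        moreover have "2 - p * (1 - \<gamma>) = 2 + - p * (1 - \<gamma>)" by simp
        ultimately show ?thesis by (simp only: powr_add)
      qed
      moreover have "1 / R = F powr p" unfolding R_def using F by (simp add: powr_minus divide_inverse)
      ultimately show ?thesis using \<gamma> unfolding p2 by (simp add: algebra_simps)
    qed
    also have "ennreal ((2 / (1 - \<gamma>) + 3) * F powr p) = ennreal (2 / (1 - \<gamma>) + 3) * ennreal (F powr p)"
      using \<gamma> by (intro ennreal_mult) auto
    finally show ?thesis unfolding F_def .
  qed
  have "(\<integral>\<^sup>+x. \<integral>\<^sup>+y. (if g y \<le> f x then ennreal (f x) * ennreal (g y) * riesz \<gamma> (x - y) else 0) \<partial>lborel \<partial>lborel)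
     \<le> (\<integral>\<^sup>+x. ennreal (2 / (1 - \<gamma>) + 3) * ennreal (f x powr p) \<partial>lborel)"
    by (intro nn_integral_mono inner)
  also have "\<dots> = ennreal (2 / (1 - \<gamma>) + 3) * (\<integral>\<^sup>+x. ennreal (f x powr p) \<partial>lborel)"
    by (rule nn_integral_cmult) measurable
  finally show ?thesis .
qed

text \<open>The regions \<open>g y \<le> f x\<close> and \<open>f x \<le> g y\<close> exchange under
  the symmetry of the kernel, so the one-sided estimate is applied twice; counting the overlap twice
  only increases the bound.\<close>

lemma hls_normalized:
  fixes f g :: "real \<Rightarrow> real" and \<gamma> :: real
  assumes [measurable]: "f \<in> borel_measurable borel" "g \<in> borel_measurable borel"
    and f0: "\<And>x. 0 \<le> f x" and g0: "\<And>x. 0 \<le> g x" and \<gamma>: "0 < \<gamma>" "\<gamma> < 1"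
  defines "p \<equiv> 2 / (2 - \<gamma>)"
  assumes f1: "(\<integral>\<^sup>+y. ennreal (f y powr p) \<partial>lborel) \<le> 1" and g1: "(\<integral>\<^sup>+y. ennreal (g y powr p) \<partial>lborel) \<le> 1"
  shows "(\<integral>\<^sup>+x. \<integral>\<^sup>+y. ennreal (f x) * ennreal (g y) * riesz \<gamma> (x - y) \<partial>lborel \<partial>lborel) \<le> ennreal (4 / (1 - \<gamma>) + 6)"
proof -
  let ?c = "2 / (1 - \<gamma>) + 3"
  let ?A = "\<lambda>x y. (if g y \<le> f x then ennreal (f x) * ennreal (g y) * riesz \<gamma> (x - y) else 0)"
  let ?B = "\<lambda>x y. (if f x \<le> g y then ennreal (g y) * ennreal (f x) * riesz \<gamma> (y - x) else 0)"
  have "(\<integral>\<^sup>+x. \<integral>\<^sup>+y. ennreal (f x) * ennreal (g y) * riesz \<gamma> (x - y) \<partial>lborel \<partial>lborel) \<le>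
     (\<integral>\<^sup>+x. \<integral>\<^sup>+y. ?A x y + ?B x y \<partial>lborel \<partial>lborel)"
  proof (intro nn_integral_mono)
    fix x y
    show "ennreal (f x) * ennreal (g y) * riesz \<gamma> (x - y) \<le> ?A x y + ?B x y"
      using riesz_commute[of \<gamma> x y] by (cases "g y \<le> f x") (auto simp: mult.commute[of "ennreal (g y)"])
  qed
  also have "\<dots> = (\<integral>\<^sup>+x. \<integral>\<^sup>+y. ?A x y \<partial>lborel \<partial>lborel) + (\<integral>\<^sup>+x. \<integral>\<^sup>+y. ?B x y \<partial>lborel \<partial>lborel)"
  proof -
    have "(\<integral>\<^sup>+y. ?A x y + ?B x y \<partial>lborel) = (\<integral>\<^sup>+y. ?A x y \<partial>lborel) + (\<integral>\<^sup>+y. ?B x y \<partial>lborel)" for x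
      by (rule nn_integral_add) measurable
    then show ?thesis
      by (simp only:) (rule nn_integral_add; measurable)
  qed
  also have "(\<integral>\<^sup>+x. \<integral>\<^sup>+y. ?B x y \<partial>lborel \<partial>lborel) = (\<integral>\<^sup>+y. \<integral>\<^sup>+x. ?B x y \<partial>lborel \<partial>lborel)"
    by (rule lborel_pair.Fubini'[symmetric]) measurable
  also have "(\<integral>\<^sup>+x. \<integral>\<^sup>+y. ?A x y \<partial>lborel \<partial>lborel) + (\<integral>\<^sup>+y. \<integral>\<^sup>+x. ?B x y \<partial>lborel \<partial>lborel) \<le>
      ennreal ?c * (\<integral>\<^sup>+x. ennreal (f x powr p) \<partial>lborel) + ennreal ?c * (\<integral>\<^sup>+x. ennreal (g x powr p) \<partial>lborel)"
    using f1 g1 unfolding p_def by (intro add_mono hls_half f0 g0 \<gamma>) measurable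
  also have "\<dots> \<le> ennreal ?c * 1 + ennreal ?c * 1"
    by (intro add_mono mult_left_mono f1 g1) auto
  also have "\<dots> = ennreal (4 / (1 - \<gamma>) + 6)"
    using \<gamma> by (simp add: ennreal_plus[symmetric] del: ennreal_plus)
  finally show ?thesis .
qed

section \<open>Homogeneity: from normalized functions to arbitrary ones\<close>

lemma ennpowr_simps [simp]: "ennpowr 0 p = 0" "ennpowr \<infinity> p = \<infinity>" "ennpowr top p = top"
  by (simp_all add: ennpowr_def)

lemma ennpowr_eq_0_iff [simp]: "ennpowr x p = 0 \<longleftrightarrow> x = 0"
  by (cases x) auto

lemma ennpowr_mult: "ennpowr (x * y) p = ennpowr x p * ennpowr y p"
proof (cases "x = \<infinity> \<or> y = \<infinity>")
  case True
  then show ?thesis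
    by (cases "x = 0"; cases "y = 0") (auto simp: ennreal_top_mult ennreal_mult_top)
next
  case False
  then show ?thesis
    by (cases x; cases y) (auto simp: ennreal_mult[symmetric] powr_mult)
qed

lemma ennpowr_ennpowr: "ennpowr (ennpowr x p) r = ennpowr x (p * r)"
  by (cases x) (auto simp: powr_powr)

lemma ennpowr_one: "ennpowr x 1 = x"
  by (cases x) auto

lemma ennpowr_inverse: "p \<noteq> 0 \<Longrightarrow> ennpowr (ennpowr x p) (1 / p) = x" "p \<noteq> 0 \<Longrightarrow> ennpowr (ennpowr x (1 / p)) p = x"
  by (simp_all add: ennpowr_ennpowr ennpowr_one)

lemma ennpowr_measurable [measurable (raw)]:
  assumes [measurable]: "f \<in> borel_measurable M"
  shows "(\<lambda>x. ennpowr (f x) p) \<in> borel_measurable M"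
  unfolding ennpowr_def by measurable

lemma hls_real_line:
  fixes f g :: "real \<Rightarrow> ennreal" and \<gamma> :: real
  assumes [measurable]: "f \<in> borel_measurable borel" "g \<in> borel_measurable borel"
    and \<gamma>: "0 < \<gamma>" "\<gamma> < 1"
  defines "p \<equiv> 2 / (2 - \<gamma>)"
  shows "(\<integral>\<^sup>+x. \<integral>\<^sup>+y. f x * g y * riesz \<gamma> (x - y) \<partial>lborel \<partial>lborel) \<le> ennreal (4 / (1 - \<gamma>) + 6) *
     (ennpowr (\<integral>\<^sup>+x. ennpowr (f x) p \<partial>lborel) (1 / p) * ennpowr (\<integral>\<^sup>+x. ennpowr (g x) p \<partial>lborel) (1 / p))"
proof -
  define A where "A = (\<integral>\<^sup>+x. ennpowr (f x) p \<partial>lborel)"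
  define B where "B = (\<integral>\<^sup>+x. ennpowr (g x) p \<partial>lborel)"
  define C where "C = 4 / (1 - \<gamma>) + 6"
  have p: "0 < p" unfolding p_def using \<gamma> by simp
  have C: "0 < C" unfolding C_def using \<gamma> by (simp add: add_pos_pos)
  \<comment> \<open>Normalization requires both norms to be positive and finite. A zero norm
    annihilates the left side, and an infinite one beside a nonzero one makes the right side
    infinite.\<close>
  consider "A = 0" | "B = 0" | "A \<noteq> 0" "B \<noteq> 0" "A = \<infinity> \<or> B = \<infinity>" | "A \<noteq> 0" "B \<noteq> 0" "A \<noteq> \<infinity>" "B \<noteq> \<infinity>" by blast
  then show ?thesis
    unfolding A_def[symmetric] B_def[symmetric] C_def[symmetric]
  proof cases
    case 1
    then have "AE x in lborel. f x = 0"
      unfolding A_def by (simp add: nn_integral_0_iff_AE)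
    then have "AE x in lborel. (\<integral>\<^sup>+y. f x * g y * riesz \<gamma> (x - y) \<partial>lborel) = 0"
      by eventually_elim simp
    then have "(\<integral>\<^sup>+x. \<integral>\<^sup>+y. f x * g y * riesz \<gamma> (x - y) \<partial>lborel \<partial>lborel) = 0"
      by (subst nn_integral_0_iff_AE) auto
    then show "(\<integral>\<^sup>+x. \<integral>\<^sup>+y. f x * g y * riesz \<gamma> (x - y) \<partial>lborel \<partial>lborel) \<le> ennreal C * (ennpowr A (1 / p) * ennpowr B (1 / p))" by simp
  next
    case 2
    then have "AE y in lborel. g y = 0"
      unfolding B_def by (simp add: nn_integral_0_iff_AE)
    then have "AE y in lborel. f x * g y * riesz \<gamma> (x - y) = 0" for x
      by eventually_elim simp
    then have "(\<integral>\<^sup>+y. f x * g y * riesz \<gamma> (x - y) \<partial>lborel) = (\<integral>\<^sup>+y. 0 \<partial>(lborel :: real measure))" for x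
      by (rule nn_integral_cong_AE)
    then show "(\<integral>\<^sup>+x. \<integral>\<^sup>+y. f x * g y * riesz \<gamma> (x - y) \<partial>lborel \<partial>lborel) \<le> ennreal C * (ennpowr A (1 / p) * ennpowr B (1 / p))" by simp
  next
    case 3
    then have "ennreal C * (ennpowr A (1 / p) * ennpowr B (1 / p)) = \<infinity>"
      using C by (auto simp: ennreal_top_mult ennreal_mult_top)
    then show "(\<integral>\<^sup>+x. \<integral>\<^sup>+y. f x * g y * riesz \<gamma> (x - y) \<partial>lborel \<partial>lborel) \<le> ennreal C * (ennpowr A (1 / p) * ennpowr B (1 / p))" by simp
  next
    case 4
    \<comment> \<open>A finite norm forces finite values almost everywhere, so the function is a
      constant times a real one; \<open>enn2real\<close> sends the exceptional values to 0.\<close>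
    have normalize: "\<exists>c h. 0 < c \<and> h \<in> borel_measurable borel \<and> (\<forall>x. 0 \<le> h x) \<and>
        (AE x in lborel. u x = ennreal c * ennreal (h x)) \<and> (\<integral>\<^sup>+x. ennreal (h x powr p) \<partial>lborel) \<le> 1 \<and>
        ennpowr (\<integral>\<^sup>+x. ennpowr (u x) p \<partial>lborel) (1 / p) = ennreal c"
      if [measurable]: "u \<in> borel_measurable borel" and U0: "(\<integral>\<^sup>+x. ennpowr (u x) p \<partial>lborel) \<noteq> 0"
        and U1: "(\<integral>\<^sup>+x. ennpowr (u x) p \<partial>lborel) \<noteq> \<infinity>" for u :: "real \<Rightarrow> ennreal"
    proof -
      obtain v where v: "(\<integral>\<^sup>+x. ennpowr (u x) p \<partial>lborel) = ennreal v" "0 < v"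
        using U0 U1 by (cases "(\<integral>\<^sup>+x. ennpowr (u x) p \<partial>lborel)") (auto simp: less_le)
      define c where "c = v powr (1 / p)"
      have c: "0 < c" "c powr p = v" unfolding c_def using v p by (auto simp: powr_powr)
      define h where "h = (\<lambda>x. enn2real (u x) / c)"
      have [measurable]: "h \<in> borel_measurable borel" unfolding h_def by measurable
      have "AE x in lborel. ennpowr (u x) p \<noteq> \<infinity>"
        by (rule nn_integral_PInf_AE) (use U1 in auto)
      then have "AE x in lborel. u x = ennreal c * ennreal (h x)"
      proof eventually_elim
        case (elim x)
        then show ?case using c by (cases "u x") (auto simp: h_def ennreal_mult[symmetric])
      qed
      moreover have "(\<integral>\<^sup>+x. ennreal (h x powr p) \<partial>lborel) \<le> 1"
      proof -
        have "ennreal (h x powr p) \<le> ennreal (1 / v) * ennpowr (u x) p" for x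
        proof (cases "u x")
          case (real r)
          then show ?thesis using c v by (simp add: h_def powr_divide ennreal_mult[symmetric])
        next
          case top
          then show ?thesis by (simp add: h_def)
        qed
        then have "(\<integral>\<^sup>+x. ennreal (h x powr p) \<partial>lborel) \<le> (\<integral>\<^sup>+x. ennreal (1 / v) * ennpowr (u x) p \<partial>lborel)"
          by (intro nn_integral_mono)
        also have "\<dots> = ennreal (1 / v) * ennreal v"
          by (subst nn_integral_cmult) (auto simp: v)
        also have "\<dots> = 1" using v by (simp add: ennreal_mult[symmetric])
        finally show ?thesis .
      qed
      moreover have "ennpowr (\<integral>\<^sup>+x. ennpowr (u x) p \<partial>lborel) (1 / p) = ennreal c"
        unfolding v(1) c_def using v(2) by simp
      moreover have "\<forall>x. 0 \<le> h x" unfolding h_def using c by simp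
      ultimately show ?thesis using c(1) \<open>h \<in> borel_measurable borel\<close> by blast
    qed
    obtain c h where h[measurable]: "h \<in> borel_measurable borel" and c: "0 < c" "\<And>x. 0 \<le> h x"
        "AE x in lborel. f x = ennreal c * ennreal (h x)" "(\<integral>\<^sup>+x. ennreal (h x powr p) \<partial>lborel) \<le> 1"
        "ennpowr A (1 / p) = ennreal c"
      using normalize[of f] 4 unfolding A_def B_def by auto
    obtain d k where k[measurable]: "k \<in> borel_measurable borel" and d: "0 < d" "\<And>x. 0 \<le> k x"
        "AE x in lborel. g x = ennreal d * ennreal (k x)" "(\<integral>\<^sup>+x. ennreal (k x powr p) \<partial>lborel) \<le> 1"
        "ennpowr B (1 / p) = ennreal d"
      using normalize[of g] 4 unfolding A_def B_def by auto
    have "(\<integral>\<^sup>+y. f x * g y * riesz \<gamma> (x - y) \<partial>lborel) = (\<integral>\<^sup>+y. f x * (ennreal d * ennreal (k y)) * riesz \<gamma> (x - y) \<partial>lborel)" for x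
      using d(3) by (intro nn_integral_cong_AE) (auto elim!: eventually_mono)
    then have "(\<integral>\<^sup>+x. \<integral>\<^sup>+y. f x * g y * riesz \<gamma> (x - y) \<partial>lborel \<partial>lborel) =
        (\<integral>\<^sup>+x. \<integral>\<^sup>+y. f x * (ennreal d * ennreal (k y)) * riesz \<gamma> (x - y) \<partial>lborel \<partial>lborel)" by simp
    also have "\<dots> = (\<integral>\<^sup>+x. \<integral>\<^sup>+y. (ennreal c * ennreal (h x)) * (ennreal d * ennreal (k y)) * riesz \<gamma> (x - y) \<partial>lborel \<partial>lborel)"
      using c(3) by (intro nn_integral_cong_AE) (auto elim!: eventually_mono)
    also have "\<dots> = (\<integral>\<^sup>+x. \<integral>\<^sup>+y. (ennreal c * ennreal d) * (ennreal (h x) * ennreal (k y) * riesz \<gamma> (x - y)) \<partial>lborel \<partial>lborel)"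
      by (simp only: mult_ac)
    also have "\<dots> = (ennreal c * ennreal d) * (\<integral>\<^sup>+x. \<integral>\<^sup>+y. ennreal (h x) * ennreal (k y) * riesz \<gamma> (x - y) \<partial>lborel \<partial>lborel)"
      by (subst nn_integral_cmult[symmetric], measurable) (intro nn_integral_cong nn_integral_cmult; measurable)
    also have "\<dots> \<le> (ennreal c * ennreal d) * ennreal C"
      unfolding C_def using c(2,4) d(2,4) unfolding p_def by (intro mult_left_mono hls_normalized \<gamma>) auto
    also have "\<dots> = ennreal C * (ennpowr A (1 / p) * ennpowr B (1 / p))"
      unfolding c(5) d(5) by (simp only: mult_ac)
    finally show "(\<integral>\<^sup>+x. \<integral>\<^sup>+y. f x * g y * riesz \<gamma> (x - y) \<partial>lborel \<partial>lborel) \<le> ennreal C * (ennpowr A (1 / p) * ennpowr B (1 / p))" .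
  qed
qed

text \<open>The diagonal bilinear form tensorizes: apply the one-dimensional inequality to the norms of the slices.\<close>

lemma hls_PiM:
  fixes f g :: "('i \<Rightarrow> real) \<Rightarrow> ennreal" and \<gamma> :: real
  assumes "finite I" and \<gamma>: "0 < \<gamma>" "\<gamma> < 1"
    and "f \<in> borel_measurable (Pi\<^sub>M I (\<lambda>_. lborel))" "g \<in> borel_measurable (Pi\<^sub>M I (\<lambda>_. lborel))"
  defines "p \<equiv> 2 / (2 - \<gamma>)"
  shows "(\<integral>\<^sup>+x. \<integral>\<^sup>+y. f x * g y * (\<Prod>i\<in>I. riesz \<gamma> (x i - y i)) \<partial>Pi\<^sub>M I (\<lambda>_. lborel) \<partial>Pi\<^sub>M I (\<lambda>_. lborel)) \<le>
     ennreal (4 / (1 - \<gamma>) + 6) ^ card I *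
     (ennpowr (\<integral>\<^sup>+x. ennpowr (f x) p \<partial>Pi\<^sub>M I (\<lambda>_. lborel)) (1 / p) * ennpowr (\<integral>\<^sup>+x. ennpowr (g x) p \<partial>Pi\<^sub>M I (\<lambda>_. lborel)) (1 / p))"
  using assms(1,4,5)
proof (induction I arbitrary: f g rule: finite_induct)
  case empty
  interpret product_sigma_finite "\<lambda>_::'i. lborel :: real measure" by standard
  have p: "p \<noteq> 0" unfolding p_def using \<gamma> by simp
  show ?case by (simp add: nn_integral_empty ennpowr_inverse p)
next
  case (insert i I)
  interpret product_sigma_finite "\<lambda>_::'i. lborel :: real measure" by standard
  interpret I: finite_product_sigma_finite "\<lambda>_::'i. lborel :: real measure" I by standard fact
  interpret P: pair_sigma_finite "Pi\<^sub>M I (\<lambda>_. lborel :: real measure)" "lborel :: real measure" ..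
  let ?P = "Pi\<^sub>M I (\<lambda>_::'i. lborel :: real measure)"
  let ?Q = "Pi\<^sub>M (insert i I) (\<lambda>_::'i. lborel :: real measure)"
  let ?C = "ennreal (4 / (1 - \<gamma>) + 6)"
  have p: "p \<noteq> 0" unfolding p_def using \<gamma> by simp
  note [measurable] = insert.prems
  have upd: "(\<Prod>j\<in>insert i I. riesz \<gamma> ((x(i := r)) j - (y(i := s)) j)) = riesz \<gamma> (r - s) * (\<Prod>j\<in>I. riesz \<gamma> (x j - y j))" for x y r s
    using insert.hyps by (simp add: prod.insert) (auto intro!: prod.cong arg_cong2[of _ _ _ _ "(*)"])
  define \<Phi> where "\<Phi> = (\<lambda>r. \<integral>\<^sup>+x. ennpowr (f (x(i := r))) p \<partial>?P)"
  define \<Psi> where "\<Psi> = (\<lambda>s. \<integral>\<^sup>+y. ennpowr (g (y(i := s))) p \<partial>?P)"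
  have [measurable]: "\<Phi> \<in> borel_measurable borel" "\<Psi> \<in> borel_measurable borel"
    unfolding \<Phi>_def \<Psi>_def by measurable
  have ins: "(\<integral>\<^sup>+x. h x \<partial>?Q) = (\<integral>\<^sup>+r. \<integral>\<^sup>+x. h (x(i := r)) \<partial>?P \<partial>lborel)" if "h \<in> borel_measurable ?Q" for h
    using insert.hyps that by (intro product_nn_integral_insert_rev) auto
  have "(\<integral>\<^sup>+x. \<integral>\<^sup>+y. f x * g y * (\<Prod>i\<in>insert i I. riesz \<gamma> (x i - y i)) \<partial>?Q \<partial>?Q) =
     (\<integral>\<^sup>+x. \<integral>\<^sup>+s. \<integral>\<^sup>+y. f x * g (y(i := s)) * (\<Prod>j\<in>insert i I. riesz \<gamma> (x j - (y(i := s)) j)) \<partial>?P \<partial>lborel \<partial>?Q)"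
    by (intro nn_integral_cong ins) measurable
  also have "\<dots> = (\<integral>\<^sup>+r. \<integral>\<^sup>+x. \<integral>\<^sup>+s. \<integral>\<^sup>+y. f (x(i := r)) * g (y(i := s)) *
      (\<Prod>j\<in>insert i I. riesz \<gamma> ((x(i := r)) j - (y(i := s)) j)) \<partial>?P \<partial>lborel \<partial>?P \<partial>lborel)"
    by (rule ins) measurable
  also have "\<dots> = (\<integral>\<^sup>+r. \<integral>\<^sup>+x. \<integral>\<^sup>+s. \<integral>\<^sup>+y. f (x(i := r)) * g (y(i := s)) *
      (riesz \<gamma> (r - s) * (\<Prod>j\<in>I. riesz \<gamma> (x j - y j))) \<partial>?P \<partial>lborel \<partial>?P \<partial>lborel)"
    by (simp only: upd)
  \<comment> \<open>The outer coordinates \<open>r\<close>, \<open>s\<close> are brought together,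
    so that the inner double integral is the form of one dimension less for the slices.\<close>
  also have "\<dots> = (\<integral>\<^sup>+r. \<integral>\<^sup>+s. \<integral>\<^sup>+x. \<integral>\<^sup>+y. f (x(i := r)) * g (y(i := s)) *
      (riesz \<gamma> (r - s) * (\<Prod>j\<in>I. riesz \<gamma> (x j - y j))) \<partial>?P \<partial>?P \<partial>lborel \<partial>lborel)"
    by (intro nn_integral_cong P.Fubini'[symmetric]) measurable
  also have "\<dots> \<le> (\<integral>\<^sup>+r. \<integral>\<^sup>+s. ?C ^ card I * (ennpowr (\<Phi> r) (1 / p) * ennpowr (\<Psi> s) (1 / p) * riesz \<gamma> (r - s)) \<partial>lborel \<partial>lborel)"
  proof (intro nn_integral_mono)
    fix r s :: real
    have m: "(\<lambda>x. f (x(i := r))) \<in> borel_measurable ?P" "(\<lambda>x. g (x(i := s))) \<in> borel_measurable ?P"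
      by measurable
    have "(\<integral>\<^sup>+x. \<integral>\<^sup>+y. f (x(i := r)) * g (y(i := s)) * (riesz \<gamma> (r - s) * (\<Prod>j\<in>I. riesz \<gamma> (x j - y j))) \<partial>?P \<partial>?P) =
      (\<integral>\<^sup>+x. \<integral>\<^sup>+y. riesz \<gamma> (r - s) * (f (x(i := r)) * g (y(i := s)) * (\<Prod>j\<in>I. riesz \<gamma> (x j - y j))) \<partial>?P \<partial>?P)"
      by (simp only: mult_ac)
    also have "\<dots> = riesz \<gamma> (r - s) * (\<integral>\<^sup>+x. \<integral>\<^sup>+y. f (x(i := r)) * g (y(i := s)) * (\<Prod>j\<in>I. riesz \<gamma> (x j - y j)) \<partial>?P \<partial>?P)"
      by (subst nn_integral_cmult[symmetric], measurable) (intro nn_integral_cong nn_integral_cmult; measurable)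
    also have "\<dots> \<le> riesz \<gamma> (r - s) * (?C ^ card I * (ennpowr (\<Phi> r) (1 / p) * ennpowr (\<Psi> s) (1 / p)))"
      unfolding \<Phi>_def \<Psi>_def by (intro mult_left_mono insert.IH m) simp
    finally show "(\<integral>\<^sup>+x. \<integral>\<^sup>+y. f (x(i := r)) * g (y(i := s)) * (riesz \<gamma> (r - s) * (\<Prod>j\<in>I. riesz \<gamma> (x j - y j))) \<partial>?P \<partial>?P) \<le>
        ?C ^ card I * (ennpowr (\<Phi> r) (1 / p) * ennpowr (\<Psi> s) (1 / p) * riesz \<gamma> (r - s))"
      by (simp only: mult_ac)
  qed
  also have "\<dots> = ?C ^ card I * (\<integral>\<^sup>+r. \<integral>\<^sup>+s. ennpowr (\<Phi> r) (1 / p) * ennpowr (\<Psi> s) (1 / p) * riesz \<gamma> (r - s) \<partial>lborel \<partial>lborel)"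
    by (subst nn_integral_cmult[symmetric], measurable) (intro nn_integral_cong nn_integral_cmult; measurable)
  \<comment> \<open>The inequality is diagonal: the same \<open>p\<close> occurs in each variable,
    so the \<open>p\<close>-th power of a slice norm is its integral, and Fubini reassembles the
    full norm.\<close>
  also have "\<dots> \<le> ?C ^ card I * (?C * (ennpowr (\<integral>\<^sup>+r. ennpowr (ennpowr (\<Phi> r) (1 / p)) p \<partial>lborel) (1 / p) *
      ennpowr (\<integral>\<^sup>+r. ennpowr (ennpowr (\<Psi> r) (1 / p)) p \<partial>lborel) (1 / p)))"
    unfolding p_def by (intro mult_left_mono hls_real_line \<gamma>) simp_all
  also have "\<dots> = ?C ^ card (insert i I) * (ennpowr (\<integral>\<^sup>+r. \<Phi> r \<partial>lborel) (1 / p) * ennpowr (\<integral>\<^sup>+r. \<Psi> r \<partial>lborel) (1 / p))"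
    using insert.hyps p by (simp add: ennpowr_inverse mult_ac)
  also have "(\<integral>\<^sup>+r. \<Phi> r \<partial>lborel) = (\<integral>\<^sup>+x. ennpowr (f x) p \<partial>?Q)"
    unfolding \<Phi>_def by (rule ins[symmetric]) measurable
  also have "(\<integral>\<^sup>+r. \<Psi> r \<partial>lborel) = (\<integral>\<^sup>+x. ennpowr (g x) p \<partial>?Q)"
    unfolding \<Psi>_def by (rule ins[symmetric]) measurable
  finally show ?case .
qed

lemma hls_vec:
  fixes f g :: "real^'n::finite \<Rightarrow> ennreal" and \<gamma> :: real
  assumes \<gamma>: "0 < \<gamma>" "\<gamma> < 1"
    and [measurable]: "f \<in> borel_measurable borel" "g \<in> borel_measurable borel"
  defines "p \<equiv> 2 / (2 - \<gamma>)"
  shows "(\<integral>\<^sup>+x. \<integral>\<^sup>+y. f x * g y * (\<Prod>i\<in>UNIV. riesz \<gamma> (x $ i - y $ i)) \<partial>lborel \<partial>lborel) \<le>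
     ennreal (4 / (1 - \<gamma>) + 6) ^ CARD('n) *
     (ennpowr (\<integral>\<^sup>+x. ennpowr (f x) p \<partial>lborel) (1 / p) * ennpowr (\<integral>\<^sup>+x. ennpowr (g x) p \<partial>lborel) (1 / p))"
proof -
  have 1: "(\<integral>\<^sup>+y. f x * g y * (\<Prod>i\<in>UNIV. riesz \<gamma> (x $ i - y $ i)) \<partial>lborel) =
     (\<integral>\<^sup>+y. f x * g (\<chi> i. y i) * (\<Prod>i\<in>UNIV. riesz \<gamma> (x $ i - y i)) \<partial>(\<Pi>\<^sub>M i\<in>UNIV. lborel))" for x
    by (subst nn_integral_vec) simp_all
  have 2: "(\<integral>\<^sup>+x. \<integral>\<^sup>+y. f x * g y * (\<Prod>i\<in>UNIV. riesz \<gamma> (x $ i - y $ i)) \<partial>lborel \<partial>lborel) =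
     (\<integral>\<^sup>+x. \<integral>\<^sup>+y. f (\<chi> i. x i) * g (\<chi> i. y i) * (\<Prod>i\<in>UNIV. riesz \<gamma> (x i - y i)) \<partial>(\<Pi>\<^sub>M i\<in>UNIV. lborel) \<partial>(\<Pi>\<^sub>M i\<in>UNIV. lborel))"
    by (subst nn_integral_vec, measurable) (simp only: 1, simp only: vec_lambda_beta)
  have 3: "(\<integral>\<^sup>+x. ennpowr (h x) p \<partial>lborel) = (\<integral>\<^sup>+x. ennpowr (h (\<chi> i. x i)) p \<partial>(\<Pi>\<^sub>M i\<in>UNIV. lborel))"
    if [measurable]: "h \<in> borel_measurable borel" for h :: "real^'n \<Rightarrow> ennreal"
    by (rule nn_integral_vec) measurable
  show ?thesis
    unfolding 2 3[OF assms(3)] 3[OF assms(4)] unfolding p_def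
    by (rule hls_PiM) (use \<gamma> in simp_all)
qed

subsection \<open>Sufficiency: duality for the linearized operator\<close>

definition osc :: "real^'n::finite \<Rightarrow> real^'n \<Rightarrow> real^'n \<Rightarrow> real^'n \<Rightarrow> complex" where
  "osc a t x \<xi> = exp (\<i> * of_real (x \<bullet> \<xi>)) * exp (\<i> * of_real (\<Sum>j\<in>UNIV. t $ j * \<bar>\<xi> $ j\<bar> powr (a $ j)))"

lemma norm_osc [simp]: "norm (osc a t x \<xi>) = 1"
  by (simp add: osc_def norm_mult)

lemma osc_measurable [measurable (raw)]:
  fixes T X Z :: "'w \<Rightarrow> real^'n::finite"
  assumes [measurable]: "T \<in> borel_measurable M" "X \<in> borel_measurable M" "Z \<in> borel_measurable M"
  shows "(\<lambda>w. osc a (T w) (X w) (Z w)) \<in> borel_measurable M"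
  unfolding osc_def by measurable

lemma osc_prod: "osc a t x \<xi> = (\<Prod>j\<in>UNIV. cis (x $ j * \<xi> $ j + t $ j * \<bar>\<xi> $ j\<bar> powr (a $ j)))"
proof -
  have "osc a t x \<xi> = exp (\<Sum>j\<in>UNIV. \<i> * of_real (x $ j * \<xi> $ j + t $ j * \<bar>\<xi> $ j\<bar> powr (a $ j)))"
    unfolding osc_def exp_add[symmetric] inner_vec_def
    by (simp add: sum.distrib distrib_left sum_distrib_left)
  then show ?thesis by (simp add: exp_sum cis_conv_exp)
qed

text \<open>The phase has no mixed terms in the coordinates of \<xi>, so the T T* kernel splits into
  one-dimensional factors that depend on differences of positions and times.\<close>

lemma osc_mult_cnj:
  "osc a t x \<xi> * cnj (osc a t' y \<xi>) =
    (\<Prod>j\<in>UNIV. cis ((x $ j - y $ j) * \<xi> $ j + (t $ j - t' $ j) * \<bar>\<xi> $ j\<bar> powr (a $ j)))"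
  unfolding osc_prod cnj_prod prod.distrib[symmetric] cis_cnj cis_mult
  by (intro prod.cong refl arg_cong[of _ _ cis]) (simp add: algebra_simps)

lemma integrable_pair_mult:
  fixes u :: "'a::euclidean_space \<Rightarrow> complex" and v :: "'b::euclidean_space \<Rightarrow> complex"
  assumes u: "integrable lborel u" and v: "integrable lborel v"
  shows "integrable lborel (\<lambda>z. u (fst z) * v (snd z))"
    and "(LINT z|lborel. u (fst z) * v (snd z)) = (LINT x|lborel. u x) * (LINT y|lborel. v y)"
proof -
  have [measurable]: "u \<in> borel_measurable borel" "v \<in> borel_measurable borel"
    using borel_measurable_integrable[OF u] borel_measurable_integrable[OF v] by simp_all
  have i: "integrable (lborel \<Otimes>\<^sub>M lborel) (\<lambda>z. u (fst z) * v (snd z))"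
  proof (rule lborel_pair.Fubini_integrable)
    show "integrable lborel (\<lambda>x. LINT y|lborel. norm (u (fst (x, y)) * v (snd (x, y))))"
      using u by (simp add: norm_mult)
    show "AE x in lborel. integrable lborel (\<lambda>y. u (fst (x, y)) * v (snd (x, y)))"
      using v by simp
  qed measurable
  then show "integrable lborel (\<lambda>z. u (fst z) * v (snd z))" by (simp add: lborel_prod)
  have "(LINT z|(lborel \<Otimes>\<^sub>M lborel). u (fst z) * v (snd z)) = (LINT x|lborel. LINT y|lborel. u x * v y)"
    using lborel_pair.integral_fst'[OF i] by simp
  then show "(LINT z|lborel. u (fst z) * v (snd z)) = (LINT x|lborel. u x) * (LINT y|lborel. v y)"
    by (simp add: lborel_prod)
qed

lemma norm_integral_le_nn_integral:
  fixes f :: "'a \<Rightarrow> 'b::{banach, second_countable_topology}"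
  shows "ennreal (norm (integral\<^sup>L M f)) \<le> (\<integral>\<^sup>+x. ennreal (norm (f x)) \<partial>M)"
  by (cases "integrable M f") (auto simp: integral_norm_bound_ennreal not_integrable_integral_eq)

lemma prod_mono_ennreal:
  fixes f g :: "'a \<Rightarrow> ennreal"
  assumes "\<And>i. i \<in> I \<Longrightarrow> f i \<le> g i"
  shows "(\<Prod>i\<in>I. f i) \<le> (\<Prod>i\<in>I. g i)"
  using assms by (induction I rule: infinite_finite_induct) (auto intro: mult_mono)

text \<open>A substitute for \<open>norm \<xi> powr (- 2 * s)\<close>: almost everywhere on the cube
  it is larger, it factors over the coordinates, and the cutoff makes it integrable when \<alpha> is
  below 1.\<close>

definition cube_weight :: "real \<Rightarrow> real \<Rightarrow> real^'n::finite \<Rightarrow> real" where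
  "cube_weight \<alpha> N \<xi> = (\<Prod>j\<in>UNIV. indicator {-N..N} (\<xi> $ j) * \<bar>\<xi> $ j\<bar> powr (- \<alpha>))"

lemma cube_weight_nonneg: "0 \<le> cube_weight \<alpha> N \<xi>"
  unfolding cube_weight_def by (intro prod_nonneg) auto

lemma integrable_osc_mult:
  fixes h :: "real^'n::finite \<Rightarrow> complex"
  assumes h: "integrable lborel h" and [measurable]: "\<tau> \<in> borel_measurable borel"
  shows "integrable lborel (\<lambda>x. osc a (\<tau> x) x \<xi> * h x)"
proof -
  have [measurable]: "h \<in> borel_measurable borel"
    using borel_measurable_integrable[OF h] by simp
  show ?thesis by (rule Bochner_Integration.integrable_bound[OF h]) (auto simp: norm_mult)
qed

text \<open>Expanding the square and integrating in \<xi> first produces a product of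
  \<open>osc_kernel\<close> factors. Their bound is uniform in time, so the arbitrary measurable
  choice \<open>\<tau>\<close> drops out and only differences of positions remain.\<close>

lemma dual_operator_bound:
  fixes h :: "real^'n::finite \<Rightarrow> complex" and \<tau> :: "real^'n \<Rightarrow> real^'n"
  assumes h: "integrable lborel h" and [measurable]: "\<tau> \<in> borel_measurable borel"
    and \<alpha>: "\<alpha> < 1" and C: "0 < C"
    and K: "\<And>j N u t. u \<noteq> 0 \<Longrightarrow> norm (osc_kernel (a $ j) \<alpha> N u t) \<le> C * \<bar>u\<bar> powr (\<alpha> - 1)"
  defines "H \<equiv> \<lambda>\<xi>. LINT x|lborel. osc a (\<tau> x) x \<xi> * h x"
  shows "(\<integral>\<^sup>+\<xi>. ennreal (cube_weight \<alpha> N \<xi> * (norm (H \<xi>))\<^sup>2) \<partial>lborel) \<le> ennreal C ^ CARD('n) *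
     (\<integral>\<^sup>+x. \<integral>\<^sup>+y. ennreal (norm (h x)) * ennreal (norm (h y)) * (\<Prod>j\<in>UNIV. riesz (1 - \<alpha>) (x $ j - y $ j)) \<partial>lborel \<partial>lborel)"
proof -
  let ?w = "cube_weight \<alpha> N :: real^'n \<Rightarrow> real"
  have [measurable]: "h \<in> borel_measurable borel"
    using borel_measurable_integrable[OF h] by simp
  have [measurable]: "?w \<in> borel_measurable borel" unfolding cube_weight_def by measurable
  have [measurable]: "H \<in> borel_measurable borel" unfolding H_def by measurable
  have w: "integrable lborel ?w"
    unfolding cube_weight_def by (intro integrable_prod_vec integrable_osc_weight \<alpha>)
  have oi: "integrable lborel (\<lambda>x. osc a (\<tau> x) x \<xi> * h x)" for \<xi>
    by (rule integrable_osc_mult[OF h]) measurable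
  have Hb: "norm (H \<xi>) \<le> (LINT x|lborel. norm (h x))" for \<xi>
    unfolding H_def
    by (rule order_trans[OF integral_norm_bound]) (simp add: norm_mult)
  define Z where "Z = (\<lambda>(z :: (real^'n) \<times> (real^'n)) \<xi>. (osc a (\<tau> (fst z)) (fst z) \<xi> * h (fst z)) * cnj (osc a (\<tau> (snd z)) (snd z) \<xi> * h (snd z)))"
  have HH: "H \<xi> * cnj (H \<xi>) = (LINT z|lborel. Z z \<xi>)" for \<xi>
    using integrable_pair_mult(2)[OF oi[of \<xi>] integrable_cnj[OF oi[of \<xi>]]]
    unfolding Z_def H_def by (simp del: complex_cnj_mult)
  have iH: "integrable lborel (\<lambda>\<xi>. ?w \<xi> * (norm (H \<xi>))\<^sup>2)"
  proof (rule Bochner_Integration.integrable_bound)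
    show "integrable lborel (\<lambda>\<xi>. ?w \<xi> * (LINT x|lborel. norm (h x))\<^sup>2)" using w by simp
    show "AE \<xi> in lborel. norm (?w \<xi> * (norm (H \<xi>))\<^sup>2) \<le> norm (?w \<xi> * (LINT x|lborel. norm (h x))\<^sup>2)"
      using Hb by (intro AE_I2) (auto simp: abs_mult cube_weight_nonneg intro!: mult_left_mono power_mono)
  qed measurable
  have hh: "integrable lborel (\<lambda>z::(real^'n) \<times> (real^'n). h (fst z) * cnj (h (snd z)))"
    using integrable_pair_mult(1)[OF h integrable_cnj[OF h]] .
  have wc: "integrable lborel (\<lambda>\<xi>. complex_of_real (?w \<xi>))" using w by simp
  \<comment> \<open>Absolute convergence in all three variables, from the cut-off weight and the
    integrable \<open>h\<close>; this is what permits the exchange of integrals.\<close>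
  have "integrable lborel (\<lambda>p::(real^'n) \<times> (real^'n) \<times> (real^'n). complex_of_real (?w (fst p)) * (h (fst (snd p)) * cnj (h (snd (snd p)))))"
    using integrable_pair_mult(1)[OF wc hh] .
  then have "integrable lborel (\<lambda>p::(real^'n) \<times> (real^'n) \<times> (real^'n). complex_of_real (?w (fst p)) * Z (snd p) (fst p))"
  proof (rule Bochner_Integration.integrable_bound)
    have [measurable]: "cnj \<in> borel_measurable borel"
      by (intro borel_measurable_continuous_onI continuous_intros)
    have "(\<lambda>p::(real^'n) \<times> (real^'n) \<times> (real^'n). complex_of_real (?w (fst p)) * Z (snd p) (fst p)) \<in> borel_measurable (borel \<Otimes>\<^sub>M borel \<Otimes>\<^sub>M borel)"
      unfolding Z_def by measurable
    then show "(\<lambda>p::(real^'n) \<times> (real^'n) \<times> (real^'n). complex_of_real (?w (fst p)) * Z (snd p) (fst p)) \<in> borel_measurable lborel"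
      by (simp add: borel_prod)
  qed (simp add: Z_def norm_mult)
  then have iZ: "integrable (lborel \<Otimes>\<^sub>M lborel) (case_prod (\<lambda>\<xi> z. complex_of_real (?w \<xi>) * Z z \<xi>))"
    by (simp add: lborel_prod case_prod_beta')
  have ZK: "(LINT \<xi>|lborel. complex_of_real (?w \<xi>) * Z z \<xi>) =
     h (fst z) * cnj (h (snd z)) * (\<Prod>j\<in>UNIV. osc_kernel (a $ j) \<alpha> N (fst z $ j - snd z $ j) (\<tau> (fst z) $ j - \<tau> (snd z) $ j))" for z
  proof -
    have eq: "complex_of_real (?w \<xi>) * Z z \<xi> = (h (fst z) * cnj (h (snd z))) *
      (\<Prod>j\<in>UNIV. (indicator {-N..N} (\<xi> $ j) * \<bar>\<xi> $ j\<bar> powr (- \<alpha>)) *\<^sub>R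
        cis ((fst z $ j - snd z $ j) * \<xi> $ j + (\<tau> (fst z) $ j - \<tau> (snd z) $ j) * \<bar>\<xi> $ j\<bar> powr (a $ j)))" for \<xi>
    proof -
      have "Z z \<xi> = (h (fst z) * cnj (h (snd z))) * (osc a (\<tau> (fst z)) (fst z) \<xi> * cnj (osc a (\<tau> (snd z)) (snd z) \<xi>))"
        unfolding Z_def by (simp add: mult_ac)
      moreover have "(\<Prod>j\<in>UNIV. (indicator {-N..N} (\<xi> $ j) * \<bar>\<xi> $ j\<bar> powr (- \<alpha>)) *\<^sub>R c j) =
          complex_of_real (?w \<xi>) * (\<Prod>j\<in>UNIV. c j)" for c
        unfolding cube_weight_def of_real_prod scaleR_conv_of_real by (rule prod.distrib)
      ultimately show ?thesis
        unfolding osc_mult_cnj by (simp only: mult_ac)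
    qed
    have [measurable]: "cis \<in> borel_measurable borel"
      by (intro borel_measurable_continuous_onI continuous_intros)
    have "integrable lborel (\<lambda>r. (indicator {-N..N} r * \<bar>r\<bar> powr (- \<alpha>)) *\<^sub>R cis (u * r + t * \<bar>r\<bar> powr b))" for u t b
      by (rule Bochner_Integration.integrable_bound[OF integrable_osc_weight[OF \<alpha>, of N]]) auto
    then show ?thesis
      unfolding eq integral_mult_right_zero osc_kernel_def by (subst integral_prod_vec) auto
  qed
  have "(\<integral>\<^sup>+\<xi>. ennreal (?w \<xi> * (norm (H \<xi>))\<^sup>2) \<partial>lborel) = ennreal (LINT \<xi>|lborel. ?w \<xi> * (norm (H \<xi>))\<^sup>2)"
    by (intro nn_integral_eq_integral iH AE_I2 mult_nonneg_nonneg cube_weight_nonneg) simp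
  also have "\<dots> = ennreal (norm (LINT \<xi>|lborel. complex_of_real (?w \<xi> * (norm (H \<xi>))\<^sup>2)))"
    unfolding integral_complex_of_real norm_of_real
    by (subst abs_of_nonneg) (auto intro!: Bochner_Integration.integral_nonneg mult_nonneg_nonneg cube_weight_nonneg)
  also have "(LINT \<xi>|lborel. complex_of_real (?w \<xi> * (norm (H \<xi>))\<^sup>2)) = (LINT \<xi>|lborel. LINT z|lborel. complex_of_real (?w \<xi>) * Z z \<xi>)"
    unfolding integral_mult_right_zero HH[symmetric] of_real_mult complex_norm_square ..
  also have "\<dots> = (LINT z|lborel. LINT \<xi>|lborel. complex_of_real (?w \<xi>) * Z z \<xi>)"
    using lborel_pair.Fubini_integral[OF iZ] by simp
  \<comment> \<open>All cancellation sits in the \<xi> integral, so absolute values may now be taken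
    in the position variables.\<close>
  also have "ennreal (norm \<dots>) \<le> (\<integral>\<^sup>+z. ennreal (norm (LINT \<xi>|lborel. complex_of_real (?w \<xi>) * Z z \<xi>)) \<partial>lborel)"
    by (rule norm_integral_le_nn_integral)
  also have "\<dots> \<le> (\<integral>\<^sup>+z. ennreal C ^ CARD('n) * (ennreal (norm (h (fst z))) * ennreal (norm (h (snd z))) * (\<Prod>j\<in>UNIV. riesz (1 - \<alpha>) (fst z $ j - snd z $ j))) \<partial>lborel)"
  proof (intro nn_integral_mono)
    fix z :: "(real^'n) \<times> (real^'n)"
    have kb: "ennreal (norm (osc_kernel (a $ j) \<alpha> N u t)) \<le> ennreal C * riesz (1 - \<alpha>) u" for j u t
    \<comment> \<open>At \<open>u = 0\<close> the right side is \<infinity>, because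
      \<open>C\<close> is positive; the diagonal needs no separate exclusion.\<close>
    proof (cases "u = 0")
      case True
      then show ?thesis using C by (simp add: riesz_def ennreal_mult_top)
    next
      case False
      have "ennreal (norm (osc_kernel (a $ j) \<alpha> N u t)) \<le> ennreal (C * \<bar>u\<bar> powr (\<alpha> - 1))"
        by (intro ennreal_leI K False)
      then show ?thesis using False C by (simp add: riesz_def ennreal_mult)
    qed
    have "ennreal (norm (LINT \<xi>|lborel. complex_of_real (?w \<xi>) * Z z \<xi>)) =
      ennreal (norm (h (fst z))) * ennreal (norm (h (snd z))) *
      (\<Prod>j\<in>UNIV. ennreal (norm (osc_kernel (a $ j) \<alpha> N (fst z $ j - snd z $ j) (\<tau> (fst z) $ j - \<tau> (snd z) $ j))))"
      unfolding ZK by (simp add: norm_mult prod_norm[symmetric] ennreal_mult prod_ennreal prod_nonneg)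
    also have "\<dots> \<le> ennreal (norm (h (fst z))) * ennreal (norm (h (snd z))) *
      (\<Prod>j\<in>UNIV. ennreal C * riesz (1 - \<alpha>) (fst z $ j - snd z $ j))"
      by (intro mult_left_mono prod_mono_ennreal kb) auto
    also have "\<dots> = ennreal C ^ CARD('n) * (ennreal (norm (h (fst z))) * ennreal (norm (h (snd z))) * (\<Prod>j\<in>UNIV. riesz (1 - \<alpha>) (fst z $ j - snd z $ j)))"
      by (simp add: prod.distrib mult_ac)
    finally show "ennreal (norm (LINT \<xi>|lborel. complex_of_real (?w \<xi>) * Z z \<xi>)) \<le>
       ennreal C ^ CARD('n) * (ennreal (norm (h (fst z))) * ennreal (norm (h (snd z))) * (\<Prod>j\<in>UNIV. riesz (1 - \<alpha>) (fst z $ j - snd z $ j)))" .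
  qed
  also have "\<dots> = ennreal C ^ CARD('n) * (\<integral>\<^sup>+z. ennreal (norm (h (fst z))) * ennreal (norm (h (snd z))) * (\<Prod>j\<in>UNIV. riesz (1 - \<alpha>) (fst z $ j - snd z $ j)) \<partial>lborel)"
    unfolding lborel_prod[symmetric] by (rule nn_integral_cmult) measurable
  also have "(\<integral>\<^sup>+z. ennreal (norm (h (fst z))) * ennreal (norm (h (snd z))) * (\<Prod>j\<in>UNIV. riesz (1 - \<alpha>) (fst z $ j - snd z $ j)) \<partial>lborel) =
     (\<integral>\<^sup>+x. \<integral>\<^sup>+y. ennreal (norm (h x)) * ennreal (norm (h y)) * (\<Prod>j\<in>UNIV. riesz (1 - \<alpha>) (x $ j - y $ j)) \<partial>lborel \<partial>lborel)"
    unfolding lborel_prod[symmetric] by (subst lborel.nn_integral_fst[symmetric]) simp_all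
  finally show ?thesis .
qed

lemma osc_kernel_bound_uniform:
  fixes a :: "real^'n::finite"
  assumes a: "\<And>j. 1 < a $ j" and \<alpha>: "1 / 2 \<le> \<alpha>" "\<alpha> < 1"
  shows "\<exists>C>0. \<forall>j N u t. u \<noteq> 0 \<longrightarrow> norm (osc_kernel (a $ j) \<alpha> N u t) \<le> C * \<bar>u\<bar> powr (\<alpha> - 1)"
proof -
  have "\<forall>j. \<exists>C\<ge>0. \<forall>N u t. u \<noteq> 0 \<longrightarrow> norm (osc_kernel (a $ j) \<alpha> N u t) \<le> C * \<bar>u\<bar> powr (\<alpha> - 1)"
    using osc_kernel_bound[OF a \<alpha>] by blast
  then obtain C where C: "\<And>j. 0 \<le> C j" "\<And>j N u t. u \<noteq> 0 \<Longrightarrow> norm (osc_kernel (a $ j) \<alpha> N u t) \<le> C j * \<bar>u\<bar> powr (\<alpha> - 1)"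
    by metis
  have "norm (osc_kernel (a $ j) \<alpha> N u t) \<le> ((\<Sum>j\<in>UNIV. C j) + 1) * \<bar>u\<bar> powr (\<alpha> - 1)" if "u \<noteq> 0" for j N u t
  proof -
    have "C j \<le> (\<Sum>j\<in>UNIV. C j)" using C(1) by (intro member_le_sum) auto
    then have "C j * \<bar>u\<bar> powr (\<alpha> - 1) \<le> ((\<Sum>j\<in>UNIV. C j) + 1) * \<bar>u\<bar> powr (\<alpha> - 1)"
      by (intro mult_right_mono) auto
    then show ?thesis using C(2)[OF that, of j N t] by linarith
  qed
  moreover have "0 < (\<Sum>j\<in>UNIV. C j) + 1" using C(1) by (simp add: sum_nonneg add_nonneg_pos)
  ultimately show ?thesis by blast
qed

lemma cube_weight_le:
  fixes \<xi> :: "real^'n::finite"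
  assumes \<alpha>: "0 \<le> \<alpha>" and nz: "\<And>j. \<xi> $ j \<noteq> 0" and N: "\<And>j. \<bar>\<xi> $ j\<bar> \<le> N"
  shows "1 \<le> norm \<xi> powr (real CARD('n) * \<alpha>) * cube_weight \<alpha> N \<xi>"
proof -
  have n0: "0 < norm \<xi>" using nz by fastforce
  have "(1::real) = (\<Prod>j\<in>(UNIV::'n set). 1)" by simp
  also have "\<dots> \<le> (\<Prod>j\<in>(UNIV::'n set). norm \<xi> powr \<alpha> * (indicator {-N..N} (\<xi> $ j) * \<bar>\<xi> $ j\<bar> powr (- \<alpha>)))"
  proof (intro prod_mono conjI)
    fix j
    have "\<xi> $ j \<in> {-N..N}" using N[of j] by (auto simp: abs_le_iff)
    moreover have "\<bar>\<xi> $ j\<bar> powr \<alpha> \<le> norm \<xi> powr \<alpha>"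
      using \<alpha> component_le_norm_cart[of \<xi> j] by (intro powr_mono2) auto
    ultimately show "1 \<le> norm \<xi> powr \<alpha> * (indicator {-N..N} (\<xi> $ j) * \<bar>\<xi> $ j\<bar> powr (- \<alpha>))"
      using nz[of j] by (simp add: powr_minus field_simps)
  qed simp
  also have "\<dots> = norm \<xi> powr (real CARD('n) * \<alpha>) * cube_weight \<alpha> N \<xi>"
    using n0 by (simp add: prod.distrib cube_weight_def powr_realpow[symmetric] powr_powr mult.commute)
  finally show ?thesis .
qed

text \<open>Let \<open>A\<close> be the integral of \<open>norm (S x) powr q\<close> over a ball.
  Pairing \<open>S\<close> with its extremal dual function, then Cauchy-Schwarz and the dual bound,
  give \<open>A\<^sup>2 \<le> K * W * A powr (2 - \<gamma>)\<close>. The power of \<open>A\<close>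
  on the right is smaller and can be absorbed.\<close>

lemma linearized_maximal_bound:
  fixes a :: "real^'n::finite" and q s :: real
  assumes a: "\<And>j. 1 < a $ j" and q: "4 \<le> q" and s: "s = real CARD('n) * (1 / 2 - 1 / q)"
  shows "\<exists>K>0. \<forall>(F :: real^'n \<Rightarrow> complex) \<tau> W. integrable lborel F \<longrightarrow> \<tau> \<in> borel_measurable borel \<longrightarrow> 0 \<le> W \<longrightarrow>
     (\<integral>\<^sup>+\<xi>. ennreal (norm \<xi> powr (2 * s) * (norm (F \<xi>))\<^sup>2) \<partial>lborel) = ennreal W \<longrightarrow>
     (\<integral>\<^sup>+x. ennreal (norm (LINT \<xi>|lborel. osc a (\<tau> x) x \<xi> * F \<xi>) powr q) \<partial>lborel) \<le> ennreal ((K * W) powr (q / 2))"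
proof -
  define \<gamma> where "\<gamma> = 2 / q"
  define \<alpha> where "\<alpha> = 1 - \<gamma>"
  \<comment> \<open>With \<open>\<gamma> = 2 / q\<close> this is \<open>q / (q - 1)\<close>: the
    exponent dual to \<open>q\<close> coincides with the diagonal one for a kernel of order
    \<open>\<gamma>\<close>.\<close>
  define p where "p = 2 / (2 - \<gamma>)"
  have \<gamma>: "0 < \<gamma>" "\<gamma> \<le> 1 / 2" "\<gamma> < 1" unfolding \<gamma>_def using q by (auto simp: field_simps)
  have \<alpha>: "1 / 2 \<le> \<alpha>" "\<alpha> < 1" "1 - \<alpha> = \<gamma>" unfolding \<alpha>_def using \<gamma> by auto
  have p: "0 < p" "(q - 1) * p = q" "1 / p + 1 / p = 2 - \<gamma>"
    unfolding p_def \<gamma>_def using q by (auto simp: field_simps)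
  have sn: "real CARD('n) * \<alpha> = 2 * s" unfolding s \<alpha>_def \<gamma>_def by (simp add: field_simps)
  obtain C where C: "0 < C" "\<And>j N u t. u \<noteq> 0 \<Longrightarrow> norm (osc_kernel (a $ j) \<alpha> N u t) \<le> C * \<bar>u\<bar> powr (\<alpha> - 1)"
    using osc_kernel_bound_uniform[OF a \<alpha>(1,2)] by blast
  define D where "D = 4 / (1 - \<gamma>) + 6"
  have D: "0 < D" unfolding D_def using \<gamma> by (simp add: add_pos_pos)
  define K where "K = C ^ CARD('n) * D ^ CARD('n)"
  have K: "0 < K" unfolding K_def using C D by simp
  have "(\<integral>\<^sup>+x. ennreal (norm (LINT \<xi>|lborel. osc a (\<tau> x) x \<xi> * F \<xi>) powr q) \<partial>lborel) \<le> ennreal ((K * W) powr (q / 2))"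
    if F: "integrable lborel F" and [measurable]: "\<tau> \<in> borel_measurable borel" and W0: "0 \<le> W"
      and W: "(\<integral>\<^sup>+\<xi>. ennreal (norm \<xi> powr (2 * s) * (norm (F \<xi>))\<^sup>2) \<partial>lborel) = ennreal W"
    for F :: "real^'n \<Rightarrow> complex" and \<tau> W
  proof -
    have [measurable]: "F \<in> borel_measurable borel"
      using borel_measurable_integrable[OF F] by simp
    define S where "S = (\<lambda>x. LINT \<xi>|lborel. osc a (\<tau> x) x \<xi> * F \<xi>)"
    have [measurable]: "S \<in> borel_measurable borel" unfolding S_def by measurable
    define B1 where "B1 = (LINT \<xi>|lborel. norm (F \<xi>))"
    have Sb: "norm (S x) \<le> B1" for x
      unfolding S_def B1_def by (rule order_trans[OF integral_norm_bound]) (simp add: norm_mult)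
    have [measurable]: "cnj \<in> borel_measurable borel"
      by (intro borel_measurable_continuous_onI continuous_intros)
    have [measurable]: "cball (0::real^'n) R \<in> sets borel" for R
      by (intro borel_closed closed_cball)
    \<comment> \<open>\<open>S\<close> is bounded, so restriction to a ball makes \<open>A\<close>
      finite and a power of it may be cancelled. The bound does not involve
      \<open>R\<close>.\<close>
    have ball: "(\<integral>\<^sup>+x. indicator (cball 0 R) x * ennreal (norm (S x) powr q) \<partial>lborel) \<le> ennreal ((K * W) powr (q / 2))" for R
    proof -
      \<comment> \<open>The function that attains equality in duality: \<open>S x * h x\<close> is
        \<open>norm (S x) powr q\<close> on the ball, and so is
        \<open>norm (h x) powr p\<close>.\<close>
      define h where "h = (\<lambda>x. (indicator (cball 0 R) x * norm (S x) powr (q - 2)) *\<^sub>R cnj (S x))"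
      have [measurable]: "h \<in> borel_measurable borel" unfolding h_def by measurable
      have hn: "norm (h x) = indicator (cball 0 R) x * norm (S x) powr (q - 1)" for x
      proof (cases "S x = 0")
        case False
        then have "norm (S x) powr (q - 2) * norm (S x) = norm (S x) powr (q - 1)"
          using powr_add[of "norm (S x)" "q - 2" 1] by simp
        then show ?thesis by (simp add: h_def mult.assoc)
      qed (simp add: h_def)
      have cb: "integrable lborel (\<lambda>x::real^'n. indicator (cball 0 R) x * c)" for c :: real
        using emeasure_lborel_cball_finite[of "0::real^'n" R] by (intro integrable_mult_left) (simp add: integrable_indicator_iff)
      have hi: "integrable lborel h"
      proof (rule Bochner_Integration.integrable_bound[OF cb[of "B1 powr (q - 1)"]])
        show "AE x in lborel. norm (h x) \<le> norm (indicator (cball 0 R) x * B1 powr (q - 1))"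
          using q Sb by (intro AE_I2) (auto simp: hn indicator_def intro!: powr_mono2)
      qed measurable
      define A where "A = (LINT x|lborel. indicator (cball 0 R) x * norm (S x) powr q)"
      have Ai: "integrable lborel (\<lambda>x. indicator (cball 0 R) x * norm (S x) powr q)"
      proof (rule Bochner_Integration.integrable_bound[OF cb[of "B1 powr q"]])
        show "AE x in lborel. norm (indicator (cball 0 R) x * norm (S x) powr q) \<le> norm (indicator (cball 0 R) x * B1 powr q)"
          using q Sb by (intro AE_I2) (auto simp: indicator_def intro!: powr_mono2)
      qed measurable
      have A0: "0 \<le> A" unfolding A_def by (intro Bochner_Integration.integral_nonneg) auto
      have An: "(\<integral>\<^sup>+x. ennreal (indicator (cball 0 R) x * norm (S x) powr q) \<partial>lborel) = ennreal A"
        unfolding A_def by (intro nn_integral_eq_integral Ai) auto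
      have Sh: "S x * h x = of_real (indicator (cball 0 R) x * norm (S x) powr q)" for x
      proof (cases "S x = 0")
        case False
        have pw: "norm (S x) powr (q - 2) * norm (S x) powr 2 = norm (S x) powr q"
          by (simp only: powr_add[symmetric]) simp
        have "S x * h x = of_real (indicator (cball 0 R) x * norm (S x) powr (q - 2)) * (S x * cnj (S x))"
          by (simp add: h_def scaleR_conv_of_real mult_ac)
        also have "S x * cnj (S x) = of_real ((norm (S x))\<^sup>2)" by (rule complex_norm_square[symmetric])
        also have "(norm (S x))\<^sup>2 = norm (S x) powr 2" using False by (simp add: powr_numeral)
        finally show ?thesis
          by (simp only: of_real_mult[symmetric] mult.assoc pw)
      qed (use q in \<open>simp add: h_def\<close>)
      define H where "H = (\<lambda>\<xi>. LINT x|lborel. osc a (\<tau> x) x \<xi> * h x)"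
      have [measurable]: "H \<in> borel_measurable borel" unfolding H_def by measurable
      have fub: "integrable (lborel \<Otimes>\<^sub>M lborel) (case_prod (\<lambda>x \<xi>. osc a (\<tau> x) x \<xi> * F \<xi> * h x))"
      proof -
        have "integrable (lborel \<Otimes>\<^sub>M lborel) (\<lambda>z::(real^'n)\<times>(real^'n). h (fst z) * F (snd z))"
          using integrable_pair_mult(1)[OF hi F] by (simp add: lborel_prod)
        then show ?thesis
          by (rule Bochner_Integration.integrable_bound) (auto simp: norm_mult mult.commute case_prod_beta')
      qed
      have "complex_of_real A = (LINT x|lborel. S x * h x)"
        unfolding Sh A_def by (rule integral_complex_of_real[symmetric])
      also have "\<dots> = (LINT x|lborel. LINT \<xi>|lborel. osc a (\<tau> x) x \<xi> * F \<xi> * h x)"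
        unfolding S_def by simp
      also have "\<dots> = (LINT \<xi>|lborel. LINT x|lborel. osc a (\<tau> x) x \<xi> * F \<xi> * h x)"
        using lborel_pair.Fubini_integral[OF fub] by simp
      also have "\<dots> = (LINT \<xi>|lborel. F \<xi> * H \<xi>)"
        unfolding H_def integral_mult_right_zero[symmetric] by (simp only: mult_ac)
      finally have "ennreal A = ennreal (norm (LINT \<xi>|lborel. F \<xi> * H \<xi>))"
        using A0 by (metis abs_of_nonneg norm_of_real)
      also have "\<dots> \<le> (\<integral>\<^sup>+\<xi>. ennreal (norm (F \<xi> * H \<xi>)) \<partial>lborel)"
        by (rule norm_integral_le_nn_integral)
      finally have A1: "ennreal A \<le> (\<integral>\<^sup>+\<xi>. ennreal (norm (F \<xi>) * norm (H \<xi>)) \<partial>lborel)"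
        by (simp add: norm_mult)
      define Q where "Q = (\<lambda>N::nat. {\<xi>::real^'n. \<forall>j. \<bar>\<xi> $ j\<bar> \<le> real N})"
      have [measurable]: "Q N \<in> sets borel" for N
        unfolding Q_def by (intro borel_closed closed_Collect_all closed_Collect_le continuous_intros)
      \<comment> \<open>Cauchy-Schwarz pairs \<open>norm \<xi> powr s\<close> with the square root
        of the product weight; off the coordinate hyperplanes their product is at least 1 on
        \<open>Q N\<close>, so inserting both only increases the integral.\<close>
      have cube: "(\<integral>\<^sup>+\<xi>. indicator (Q N) \<xi> * ennreal (norm (F \<xi>) * norm (H \<xi>)) \<partial>lborel)\<^sup>2 \<le> ennreal (W * (K * A powr (2 - \<gamma>)))" for N
      proof -
        let ?w = "cube_weight \<alpha> (real N) :: real^'n \<Rightarrow> real"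
        have [measurable]: "?w \<in> borel_measurable borel" unfolding cube_weight_def by measurable
        have "AE \<xi> in lborel. \<forall>j. (\<xi>::real^'n) $ j \<noteq> 0"
          by (rule AE_all_countable[THEN iffD2]) (auto intro: AE_vec_nth_nonzero)
        then have "(\<integral>\<^sup>+\<xi>. indicator (Q N) \<xi> * ennreal (norm (F \<xi>) * norm (H \<xi>)) \<partial>lborel) \<le>
           (\<integral>\<^sup>+\<xi>. ennreal (norm \<xi> powr s * norm (F \<xi>)) * ennreal (sqrt (?w \<xi>) * norm (H \<xi>)) \<partial>lborel)"
        proof (intro nn_integral_mono_AE, eventually_elim)
          case (elim \<xi>)
          show ?case
          proof (cases "\<xi> \<in> Q N")
            case True
            have "1 \<le> norm \<xi> powr (2 * s) * ?w \<xi>"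
              using cube_weight_le[of \<alpha> \<xi> "real N"] elim True \<alpha> unfolding Q_def sn by simp
            then have "1 \<le> sqrt (norm \<xi> powr (2 * s) * ?w \<xi>)" by simp
            also have "\<dots> = norm \<xi> powr s * sqrt (?w \<xi>)"
              by (simp add: real_sqrt_mult powr_half_sqrt[symmetric] powr_powr)
            finally have "1 * (norm (F \<xi>) * norm (H \<xi>)) \<le> (norm \<xi> powr s * sqrt (?w \<xi>)) * (norm (F \<xi>) * norm (H \<xi>))"
              by (intro mult_right_mono) auto
            then show ?thesis
              using True cube_weight_nonneg[of \<alpha> "real N" \<xi>] by (simp add: ennreal_mult'[symmetric] mult_ac ennreal_leI)
          qed simp
        qed
        then have "(\<integral>\<^sup>+\<xi>. indicator (Q N) \<xi> * ennreal (norm (F \<xi>) * norm (H \<xi>)) \<partial>lborel)\<^sup>2 \<le>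
           (\<integral>\<^sup>+\<xi>. ennreal (norm \<xi> powr s * norm (F \<xi>)) * ennreal (sqrt (?w \<xi>) * norm (H \<xi>)) \<partial>lborel)\<^sup>2"
          by (rule power_mono) simp
        also have "\<dots> \<le> (\<integral>\<^sup>+\<xi>. (ennreal (norm \<xi> powr s * norm (F \<xi>)))\<^sup>2 \<partial>lborel) *
            (\<integral>\<^sup>+\<xi>. (ennreal (sqrt (?w \<xi>) * norm (H \<xi>)))\<^sup>2 \<partial>lborel)"
          by (rule Cauchy_Schwarz_nn_integral) measurable
        also have "(\<integral>\<^sup>+\<xi>. (ennreal (norm \<xi> powr s * norm (F \<xi>)))\<^sup>2 \<partial>lborel) = ennreal W"
          unfolding W[symmetric]
          by (intro nn_integral_cong) (simp add: ennreal_power power_mult_distrib power2_eq_square[of "_ powr _"] powr_add[symmetric])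
        also have "(\<integral>\<^sup>+\<xi>. (ennreal (sqrt (?w \<xi>) * norm (H \<xi>)))\<^sup>2 \<partial>lborel) = (\<integral>\<^sup>+\<xi>. ennreal (?w \<xi> * (norm (H \<xi>))\<^sup>2) \<partial>lborel)"
          by (intro nn_integral_cong, subst ennreal_power)
             (simp_all add: power_mult_distrib cube_weight_nonneg)
        also have "\<dots> \<le> ennreal C ^ CARD('n) * (\<integral>\<^sup>+x. \<integral>\<^sup>+y. ennreal (norm (h x)) * ennreal (norm (h y)) *
            (\<Prod>j\<in>UNIV. riesz (1 - \<alpha>) (x $ j - y $ j)) \<partial>lborel \<partial>lborel)"
          unfolding H_def by (rule dual_operator_bound[OF hi _ \<alpha>(2) C]) measurable
        also have "\<dots> \<le> ennreal C ^ CARD('n) * (ennreal D ^ CARD('n) *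
           (ennpowr (\<integral>\<^sup>+x. ennpowr (ennreal (norm (h x))) p \<partial>lborel) (1 / p) * ennpowr (\<integral>\<^sup>+x. ennpowr (ennreal (norm (h x))) p \<partial>lborel) (1 / p)))"
          unfolding \<alpha>(3) D_def p_def by (intro mult_left_mono hls_vec \<gamma>) auto
        also have "(\<integral>\<^sup>+x. ennpowr (ennreal (norm (h x))) p \<partial>lborel) = ennreal A"
          unfolding An[symmetric]
          by (intro nn_integral_cong) (use p q in \<open>auto simp: hn indicator_def powr_powr\<close>)
        also have "ennreal C ^ CARD('n) * (ennreal D ^ CARD('n) * (ennpowr (ennreal A) (1 / p) * ennpowr (ennreal A) (1 / p))) =
           ennreal (K * A powr (2 - \<gamma>))"
          using A0 C D by (simp add: K_def ennreal_power ennreal_mult[symmetric] powr_add[symmetric] p(3) mult.assoc)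
        finally show ?thesis using W0 K by (simp add: ennreal_mult mult_left_mono)
      qed
      have "(\<integral>\<^sup>+\<xi>. indicator (Q N) \<xi> * ennreal (norm (F \<xi>) * norm (H \<xi>)) \<partial>lborel) \<le> ennreal (sqrt (W * (K * A powr (2 - \<gamma>))))" for N
      proof -
        let ?I = "\<integral>\<^sup>+\<xi>. indicator (Q N) \<xi> * ennreal (norm (F \<xi>) * norm (H \<xi>)) \<partial>lborel"
        show ?thesis
        proof (cases ?I)
          case (real r)
          then have "r\<^sup>2 \<le> W * (K * A powr (2 - \<gamma>))"
            using cube[of N] W0 K by (simp add: ennreal_power)
          then show ?thesis using real by (simp add: ennreal_leI real_le_rsqrt)
        next
          case top
          then show ?thesis using cube[of N] by (simp add: power2_eq_square top_unique)
        qed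
      qed
      then have "(SUP N. \<integral>\<^sup>+\<xi>. indicator (Q N) \<xi> * ennreal (norm (F \<xi>) * norm (H \<xi>)) \<partial>lborel) \<le> ennreal (sqrt (W * (K * A powr (2 - \<gamma>))))"
        by (rule SUP_least)
      also have "(SUP N. \<integral>\<^sup>+\<xi>. indicator (Q N) \<xi> * ennreal (norm (F \<xi>) * norm (H \<xi>)) \<partial>lborel) =
         (\<integral>\<^sup>+\<xi>. (SUP N. indicator (Q N) \<xi> * ennreal (norm (F \<xi>) * norm (H \<xi>))) \<partial>lborel)"
      proof (rule nn_integral_monotone_convergence_SUP[symmetric])
        show "incseq (\<lambda>N \<xi>. indicator (Q N) \<xi> * ennreal (norm (F \<xi>) * norm (H \<xi>)))"
        proof (intro monoI le_funI mult_right_mono)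
          fix M N :: nat and \<xi> assume "M \<le> N"
          then have "Q M \<subseteq> Q N" unfolding Q_def by (auto intro: order_trans)
          then show "indicator (Q M) \<xi> \<le> (indicator (Q N) \<xi> :: ennreal)" by (auto simp: indicator_def)
        qed simp
      qed measurable
      finally have upper: "(\<integral>\<^sup>+\<xi>. (SUP N. indicator (Q N) \<xi> * ennreal (norm (F \<xi>) * norm (H \<xi>))) \<partial>lborel) \<le> ennreal (sqrt (W * (K * A powr (2 - \<gamma>))))" .
      have lower: "(\<integral>\<^sup>+\<xi>. ennreal (norm (F \<xi>) * norm (H \<xi>)) \<partial>lborel) \<le>
          (\<integral>\<^sup>+\<xi>. (SUP N. indicator (Q N) \<xi> * ennreal (norm (F \<xi>) * norm (H \<xi>))) \<partial>lborel)"
      proof (intro nn_integral_mono)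
        fix \<xi> :: "real^'n"
        obtain N :: nat where N: "norm \<xi> \<le> real N" using real_arch_simple by blast
        have "\<xi> \<in> Q N" unfolding Q_def using N component_le_norm_cart[of \<xi>] by (auto intro: order_trans)
        then have "ennreal (norm (F \<xi>) * norm (H \<xi>)) = indicator (Q N) \<xi> * ennreal (norm (F \<xi>) * norm (H \<xi>))" by simp
        also have "\<dots> \<le> (SUP N. indicator (Q N) \<xi> * ennreal (norm (F \<xi>) * norm (H \<xi>)))" by (rule SUP_upper) simp
        finally show "ennreal (norm (F \<xi>) * norm (H \<xi>)) \<le> (SUP N. indicator (Q N) \<xi> * ennreal (norm (F \<xi>) * norm (H \<xi>)))" .
      qed
      have "ennreal A \<le> ennreal (sqrt (W * (K * A powr (2 - \<gamma>))))"
        using A1 lower upper by (meson order_trans)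
      then have "A \<le> sqrt (W * (K * A powr (2 - \<gamma>)))"
        using W0 K by (subst (asm) ennreal_le_iff) auto
      then have "A\<^sup>2 \<le> (sqrt (W * (K * A powr (2 - \<gamma>))))\<^sup>2" using A0 by (rule power_mono)
      then have A2: "A\<^sup>2 \<le> K * W * A powr (2 - \<gamma>)" using W0 K by (simp add: mult_ac)
      \<comment> \<open>Cancelling \<open>A powr (2 - \<gamma>)\<close> leaves
        \<open>A powr \<gamma>\<close>, and \<open>\<gamma> * (q / 2) = 1\<close>.\<close>
      have "A \<le> (K * W) powr (q / 2)"
      proof (cases "A = 0")
        case False
        then have Ap: "0 < A" using A0 by simp
        have "A powr \<gamma> * A powr (2 - \<gamma>) \<le> K * W * A powr (2 - \<gamma>)"
          using A2 Ap by (simp add: powr_add[symmetric] powr_numeral)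
        then have "A powr \<gamma> \<le> K * W" using Ap by simp
        then have "(A powr \<gamma>) powr (q / 2) \<le> (K * W) powr (q / 2)" using q by (intro powr_mono2) auto
        moreover have "(A powr \<gamma>) powr (q / 2) = A" using Ap q by (simp add: powr_powr \<gamma>_def)
        ultimately show ?thesis by simp
      qed simp
      then have "ennreal A \<le> ennreal ((K * W) powr (q / 2))" by (rule ennreal_leI)
      also have "ennreal A = (\<integral>\<^sup>+x. indicator (cball 0 R) x * ennreal (norm (S x) powr q) \<partial>lborel)"
        unfolding An[symmetric] by (intro nn_integral_cong) (auto simp: indicator_def)
      finally show ?thesis .
    qed
    have "(\<integral>\<^sup>+x. ennreal (norm (S x) powr q) \<partial>lborel) \<le> (\<integral>\<^sup>+x. (SUP R::nat. indicator (cball 0 (real R)) x * ennreal (norm (S x) powr q)) \<partial>lborel)"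
    proof (intro nn_integral_mono)
      fix x :: "real^'n"
      obtain N :: nat where N: "norm x \<le> real N" using real_arch_simple by blast
      then have "ennreal (norm (S x) powr q) = indicator (cball 0 (real N)) x * ennreal (norm (S x) powr q)" by simp
      also have "\<dots> \<le> (SUP R::nat. indicator (cball 0 (real R)) x * ennreal (norm (S x) powr q))" by (rule SUP_upper) simp
      finally show "ennreal (norm (S x) powr q) \<le> (SUP R::nat. indicator (cball 0 (real R)) x * ennreal (norm (S x) powr q))" .
    qed
    also have "\<dots> = (SUP R::nat. \<integral>\<^sup>+x. indicator (cball 0 (real R)) x * ennreal (norm (S x) powr q) \<partial>lborel)"
    proof (rule nn_integral_monotone_convergence_SUP)
      show "incseq (\<lambda>(R::nat) x. indicator (cball 0 (real R)) x * ennreal (norm (S x) powr q))"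
        by (intro monoI le_funI mult_right_mono) (auto simp: indicator_def)
    qed measurable
    also have "\<dots> \<le> ennreal ((K * W) powr (q / 2))"
      by (rule SUP_least) (rule ball)
    finally show ?thesis unfolding S_def .
  qed
  then show ?thesis using K by blast
qed

section \<open>From measurable choices of time to the full supremum\<close>

lemma S_op_osc: "S_op a t f x = (LINT \<xi>|lborel. osc a t x \<xi> * fourier f \<xi>)"
  unfolding S_op_def osc_def ..

lemma isCont_S_op_time:
  assumes "integrable lborel (fourier f)"
  shows "isCont (\<lambda>t. S_op a t f x) t0"
  unfolding S_op_osc
proof (rule isCont_integral_multiplier[OF assms])
  have "isCont (\<lambda>t::real^'a. t $ j) t0" for j
    by (intro continuous_intros)
  then show "isCont (\<lambda>t. osc a t x \<xi>) t0" for \<xi>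
    unfolding osc_def by (intro continuous_intros)
qed auto

lemma schwartz_measurable:
  assumes "f \<in> schwartz"
  shows "f \<in> borel_measurable borel"
proof -
  have "iter_partial [] f differentiable_on UNIV"
    using assms unfolding schwartz_def by blast
  then have "continuous_on UNIV f"
    by (simp add: differentiable_imp_continuous_on)
  then show ?thesis by (rule borel_measurable_continuous_onI)
qed

text \<open>The exponentials have modulus 1, so the integrals for all \<open>t\<close> and
  \<open>x\<close> converge together or not at all; in the latter case each takes the default value
  0. Sufficiency may thus assume an integrable transform.\<close>

lemma maximal_not_integrable:
  assumes [measurable]: "f \<in> borel_measurable borel" and "\<not> integrable lborel (fourier f)"
  shows "maximal a f x = 0"
proof -
  have [measurable]: "fourier f \<in> borel_measurable borel" by (rule fourier_measurable) measurable
  have "\<not> integrable lborel (\<lambda>\<xi>. osc a t x \<xi> * fourier f \<xi>)" for t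
  proof
    assume "integrable lborel (\<lambda>\<xi>. osc a t x \<xi> * fourier f \<xi>)"
    then have "integrable lborel (fourier f)"
      by (rule Bochner_Integration.integrable_bound) (auto simp: norm_mult)
    with assms show False by simp
  qed
  then show ?thesis
    by (simp add: maximal_def S_op_osc not_integrable_integral_eq)
qed

text \<open>A measurable selection: at each point it keeps the best of the first
  \<open>k + 1\<close> times. The resulting moduli increase with \<open>k\<close>, so monotone
  convergence passes from the linearized bound to the supremum over the sequence.\<close>

fun best_time :: "real^'n::finite \<Rightarrow> (real^'n \<Rightarrow> complex) \<Rightarrow> (nat \<Rightarrow> real^'n) \<Rightarrow> nat \<Rightarrow> real^'n \<Rightarrow> real^'n" where
  "best_time a F T 0 x = T 0"
| "best_time a F T (Suc k) x =
    (if norm (LINT \<xi>|lborel. osc a (best_time a F T k x) x \<xi> * F \<xi>) < norm (LINT \<xi>|lborel. osc a (T (Suc k)) x \<xi> * F \<xi>)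
     then T (Suc k) else best_time a F T k x)"

lemma best_time_measurable:
  assumes [measurable]: "F \<in> borel_measurable borel"
  shows "best_time a F T k \<in> borel_measurable borel"
proof (induction k)
  case 0
  then show ?case by (simp add: fun_eq_iff[of "best_time a F T 0", THEN iffD2])
next
  case (Suc k)
  note [measurable] = Suc
  show ?case unfolding best_time.simps[abs_def] by measurable
qed

lemma best_time_ge:
  "i \<le> k \<Longrightarrow> norm (LINT \<xi>|lborel. osc a (T i) x \<xi> * F \<xi>) \<le> norm (LINT \<xi>|lborel. osc a (best_time a F T k x) x \<xi> * F \<xi>)"
proof (induction k)
  case (Suc k)
  then show ?case by (cases "i = Suc k") (auto simp: le_Suc_eq)
qed simp

lemma maximal_estimate_sufficient:
  fixes a :: "real^'n::finite" and q s :: real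
  assumes a: "\<And>j. 1 < a $ j" and q: "4 \<le> q" and s: "s = real CARD('n) * (1 / 2 - 1 / q)"
  shows "\<exists>C>0. \<forall>f\<in>schwartz. Lq_norm (ennreal q) (maximal a f) \<le> ennreal C * sobolev_norm s f"
proof -
  obtain K where K: "0 < K" and bound: "\<And>(F :: real^'n \<Rightarrow> complex) \<tau> W. integrable lborel F \<Longrightarrow> \<tau> \<in> borel_measurable borel \<Longrightarrow> 0 \<le> W \<Longrightarrow>
     (\<integral>\<^sup>+\<xi>. ennreal (norm \<xi> powr (2 * s) * (norm (F \<xi>))\<^sup>2) \<partial>lborel) = ennreal W \<Longrightarrow>
     (\<integral>\<^sup>+x. ennreal (norm (LINT \<xi>|lborel. osc a (\<tau> x) x \<xi> * F \<xi>) powr q) \<partial>lborel) \<le> ennreal ((K * W) powr (q / 2))"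
    using linearized_maximal_bound[OF a q s] by blast
  have "Lq_norm (ennreal q) (maximal a f) \<le> ennreal (sqrt K) * sobolev_norm s f" if f: "f \<in> schwartz" for f :: "real^'n \<Rightarrow> complex"
  proof (cases "integrable lborel (fourier f)")
    case False
    then have "maximal a f = (\<lambda>x. 0)"
      using maximal_not_integrable[OF schwartz_measurable[OF f]] by blast
    then show ?thesis using q by (simp add: Lq_norm_def)
  next
    case F: True
    define F where "F = fourier f"
    have [measurable]: "F \<in> borel_measurable borel"
      unfolding F_def using borel_measurable_integrable[OF F] by simp
    have iF: "integrable lborel F" using F by (simp add: F_def)
    show ?thesis
    proof (cases "\<integral>\<^sup>+\<xi>. ennreal (norm \<xi> powr (2 * s) * (norm (F \<xi>))\<^sup>2) \<partial>lborel")
      case top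
      then have "sobolev_norm s f = \<infinity>" unfolding sobolev_norm_def F_def[symmetric] by simp
      then show ?thesis using K by (simp add: ennreal_mult_top)
    next
      case (real W)
      \<comment> \<open>Times exceeding a given level form an open set by continuity in
        \<open>t\<close>. If it is nonempty it meets \<open>D\<close>, so the countable supremum
        already equals the full one.\<close>
      obtain D :: "(real^'n) set" where D: "countable D" "\<And>X. open X \<Longrightarrow> X \<noteq> {} \<Longrightarrow> \<exists>d\<in>D. d \<in> X"
        using countable_dense_setE by (metis (no_types, opaque_lifting))
      have "D \<noteq> {}" using D(2)[of UNIV] by auto
      define T where "T = from_nat_into D"
      have T: "range T = D" unfolding T_def using D(1) \<open>D \<noteq> {}\<close> by (rule range_from_nat_into[rotated])
      define \<tau> where "\<tau> = best_time a F T"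
      have [measurable]: "\<tau> k \<in> borel_measurable borel" for k
        unfolding \<tau>_def by (rule best_time_measurable) measurable
      define M where "M = (\<lambda>k x. norm (LINT \<xi>|lborel. osc a (\<tau> k x) x \<xi> * F \<xi>) powr q)"
      have [measurable]: "M k \<in> borel_measurable borel" for k unfolding M_def by measurable
      have Mmono: "M k x \<le> M (Suc k) x" for k x
        unfolding M_def \<tau>_def using q by (intro powr_mono2) auto
      have max_le: "maximal a f x \<le> ennpowr (SUP k. ennreal (M k x)) (1 / q)" for x
        unfolding maximal_def
      proof (rule SUP_least)
        fix t
        let ?R = "ennpowr (SUP k. ennreal (M k x)) (1 / q)"
        have dense: "ennreal (norm (S_op a (T i) f x)) \<le> ?R" for i
        proof -
          have "norm (S_op a (T i) f x) powr q \<le> M i x"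
            unfolding M_def S_op_osc F_def[symmetric] \<tau>_def using q best_time_ge[of i i a T x F] by (intro powr_mono2) auto
          then have "ennreal (norm (S_op a (T i) f x) powr q) \<le> (SUP k. ennreal (M k x))"
            by (intro SUP_upper2[of i] ennreal_leI) auto
          then have "ennpowr (ennreal (norm (S_op a (T i) f x) powr q)) (1 / q) \<le> ?R"
            using q by (intro ennpowr_mono) auto
          then show ?thesis using q by (simp add: powr_powr)
        qed
        show "ennreal (norm (S_op a t f x)) \<le> ?R"
        proof (rule ccontr)
          assume n: "\<not> ennreal (norm (S_op a t f x)) \<le> ?R"
          then obtain r where r: "?R = ennreal r" "0 \<le> r" by (cases ?R) auto
          have "r < norm (S_op a t f x)" using n ennreal_leI[of "norm (S_op a t f x)" r] unfolding r(1) by linarith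
          moreover have "open {t. r < norm (S_op a t f x)}"
          proof (rule open_Collect_less)
            show "continuous_on UNIV (\<lambda>t. norm (S_op a t f x))"
              using isCont_S_op_time[OF F] by (intro continuous_on_norm continuous_at_imp_continuous_on) auto
          qed (intro continuous_intros)
          ultimately obtain d where d: "d \<in> D" "r < norm (S_op a d f x)"
            using D(2)[of "{t. r < norm (S_op a t f x)}"] by blast
          then obtain i where "d = T i" using T by blast
          with d(2) dense[of i] r show False by (simp add: ennreal_le_iff)
        qed
      qed
      have "(\<integral>\<^sup>+x. ennpowr (maximal a f x) q \<partial>lborel) \<le> (\<integral>\<^sup>+x. (SUP k. ennreal (M k x)) \<partial>lborel)"
      proof (intro nn_integral_mono)
        fix x
        have "ennpowr (maximal a f x) q \<le> ennpowr (ennpowr (SUP k. ennreal (M k x)) (1 / q)) q"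
          using q by (intro ennpowr_mono max_le) auto
        then show "ennpowr (maximal a f x) q \<le> (SUP k. ennreal (M k x))"
          using q by (simp add: ennpowr_inverse)
      qed
      also have "\<dots> = (SUP k. \<integral>\<^sup>+x. ennreal (M k x) \<partial>lborel)"
      proof (rule nn_integral_monotone_convergence_SUP)
        show "incseq (\<lambda>k x. ennreal (M k x))"
          by (intro incseq_SucI le_funI ennreal_leI Mmono)
      qed measurable
      also have "\<dots> \<le> ennreal ((K * W) powr (q / 2))"
        unfolding M_def using real by (intro SUP_least bound iF) auto
      finally have "ennpowr (\<integral>\<^sup>+x. ennpowr (maximal a f x) q \<partial>lborel) (1 / q) \<le> ennpowr (ennreal ((K * W) powr (q / 2))) (1 / q)"
        using q by (intro ennpowr_mono) auto
      also have "\<dots> = ennreal ((K * W) powr (1 / 2))"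
        using q by (simp add: powr_powr)
      also have "\<dots> = ennreal (sqrt K) * ennreal (W powr (1 / 2))"
        using K real by (simp add: powr_mult ennreal_mult[symmetric] powr_half_sqrt real_sqrt_mult)
      also have "ennreal (W powr (1 / 2)) = sobolev_norm s f"
        unfolding sobolev_norm_def F_def[symmetric] real(2) using real(1) by simp
      finally show ?thesis using q by (simp add: Lq_norm_def)
    qed
  qed
  then show ?thesis using K by (intro exI[of _ "sqrt K"]) auto
qed

subsection \<open>The characterization\<close>

theorem theorem1p3:
  fixes a :: "real^'n::finite" and q :: ennreal and s :: real
  assumes "CARD('n) \<ge> 2"
    and "\<And>j. a $ j > 1"
    and "1 \<le> q"
  shows "(\<exists>C::real. C > 0 \<and>
            (\<forall>f\<in>schwartz. Lq_norm q (maximal a f) \<le> ennreal C * sobolev_norm s f)) \<longleftrightarrow>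
         (4 \<le> q \<and> q < \<infinity> \<and> s = real CARD('n) * (1 / 2 - 1 / enn2real q))"
proof
  assume "\<exists>C::real. C > 0 \<and> (\<forall>f\<in>schwartz. Lq_norm q (maximal a f) \<le> ennreal C * sobolev_norm s f)"
  then obtain C where C: "0 < C" "\<And>f. f \<in> schwartz \<Longrightarrow> Lq_norm q (maximal a f) \<le> ennreal C * sobolev_norm s f"
    by blast
  define r where "r = 1 / enn2real q"
  have s: "s = real CARD('n) * (1 / 2 - r)" and n: "real CARD('n) * r \<le> s"
    using maximal_estimate_scaling[OF assms(2,3) C] unfolding r_def by auto
  have "q \<noteq> \<infinity>"
  proof
    \<comment> \<open>Here \<open>enn2real q = 0\<close> gives \<open>r = 0\<close>, and scaling
      leaves \<open>s = n / 2\<close>, the critical exponent excluded by the sum of dyadic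
      Gaussians.\<close>
    assume q: "q = \<infinity>"
    have "s = real CARD('n) / 2" unfolding s r_def q by simp
    then show False
      using no_sup_norm_bound[of C a] C unfolding q by blast
  qed
  then have q: "q < \<infinity>" by (simp add: less_top)
  \<comment> \<open>The packet condition \<open>n * r \<le> s\<close> meets the scaling identity;
    together they say \<open>r \<le> 1 / 4\<close>.\<close>
  have "real CARD('n) * r \<le> real CARD('n) * (1 / 2 - r)" using n s by simp
  then have "r \<le> 1 / 2 - r" by (subst (asm) mult_le_cancel_left_pos) auto
  then have "r \<le> 1 / 4" by simp
  moreover have "1 \<le> enn2real q" by (rule ennreal_lt_top_cases[OF q assms(3)])
  ultimately have "4 \<le> enn2real q" unfolding r_def by (simp add: field_simps)
  then have "4 \<le> q" using q by (cases q) auto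
  with q s show "4 \<le> q \<and> q < \<infinity> \<and> s = real CARD('n) * (1 / 2 - 1 / enn2real q)"
    by (simp add: r_def)
next
  assume *: "4 \<le> q \<and> q < \<infinity> \<and> s = real CARD('n) * (1 / 2 - 1 / enn2real q)"
  then obtain p where p: "q = ennreal p" "0 \<le> p" by (cases q) auto
  have "4 \<le> p" using * p by (simp add: ennreal_le_iff flip: ennreal_numeral)
  moreover have "s = real CARD('n) * (1 / 2 - 1 / p)" using * p by simp
  ultimately show "\<exists>C::real. C > 0 \<and> (\<forall>f\<in>schwartz. Lq_norm q (maximal a f) \<le> ennreal C * sobolev_norm s f)"
    unfolding p(1) using assms(2) by (intro maximal_estimate_sufficient)
qed

end
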